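(* Let $(X,\omega,J)$ be a Calabi–Yau manifold and let $Y\subset(X,\omega,J)$ be a coisotropic submanifold. Then $Y$ is leafwise special coisotropic if and only if $Y$ is leafwise minimal, i.e. $\alpha_Y^{\parallel}=0$.
   Context: $(X,\omega,J)$ is Kähler of real dimension $2n$, $g=\omega(\cdot,J\cdot)$, $\nabla$ its Levi-Civita connection; Calabi–Yau means it carries a parallel holomorphic volume form $\Omega$ of constant length one (normalised so that $|f|=1$ below). $\iota:Y\hookrightarrow X$ is coisotropic: $(TY)^\omega\subset TY$, $\dim Y=n+k$; $T\mathcal F:=(TY)^\omega$ is tangent to the null foliation $\mathcal F$. Indices: $a$ runs over $1,\dots,k$; $\beta$ over $k+1,\dots,n$; repeated indices are summed. Adapted frame: a local orthonormal frame $\{e_1,\dots,e_n,f_1,\dots,f_n\}$ of $TX$ along $Y$, $f_j=Je_j$, such that $e_1,\dots,e_n,f_1,\dots,f_k$ span $TY$ and $e_{k+1},\dots,e_n$ span $T\mathcal F$. Put $u_j=\frac12(e_j-\sqrt{-1}f_j)$, $\theta^j=e_j^*+\sqrt{-1}f_j^*$, $\nabla u_j=\omega^i_j\otimes u_i$. The transverse canonical bundle is $K_Y=\det\big((N^*\mathcal F)^{1,0}\big)$, where $N^*\mathcal F\subset T^*X|_Y$ is the annihilator of $T\mathcal F\oplus J(T\mathcal F)$; it has local frame $\theta^1\wedge\cdots\wedge\theta^k$ and induced connection $\nabla(\theta^1\wedge\cdots\wedge\theta^k)=-\iota^*(\omega^a_a)\,\theta^1\wedge\cdots\wedge\theta^k$.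 The canonical transverse Maslov charge of $Y$ is the global section $\Delta_{(Y;\Omega)}=\big((u_{k+1}\wedge\cdots\wedge u_n)\rfloor\Omega\big)^{\otimes2}$ of $K_Y^{\otimes 2}$. Writing locally $\Omega=f\,\theta^1\wedge\cdots\wedge\theta^n$ with $f$ valued in $S^1$ and $\gamma=\log f$, $Y$ is called leafwise special coisotropic if $\Delta_{(Y;\Omega)}$ is leafwise parallel, i.e. $\nabla_v\Delta_{(Y;\Omega)}=0$ for all $v\in T\mathcal F$; equivalently $d_{\mathcal F}\gamma-\iota_{\mathcal F}^*(\omega^a_a)=0$, where $d_{\mathcal F}$ is the exterior derivative along leaves and $\iota_{\mathcal F}^*$ is restriction to $T\mathcal F$. With $S$ the second fundamental form of $Y\subset(X,g)$, the leafwise mean curvature vector is $\vec H^{\parallel}=\sum_\beta S(e_\beta,e_\beta)$ and the leafwise mean curvature one-form is $\alpha_Y^{\parallel}=(\vec H^{\parallel}\rfloor\omega)|_{TY}$. *)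

theory Defs
  imports "HOL-Analysis.Analysis" "HOL-Combinatorics.Permutations"
begin

section \<open>Smooth and holomorphic maps\<close>

text \<open>\<^term>\<open>S\<close> is meant to be open in the next three definitions.\<close>

primrec Ck_on :: "nat \<Rightarrow> 'a::real_normed_vector set \<Rightarrow> ('a \<Rightarrow> 'b::real_normed_vector) \<Rightarrow> bool" where
  "Ck_on 0 S f = continuous_on S f"
| "Ck_on (Suc m) S f = ((\<forall>x\<in>S. f differentiable (at x)) \<and>
     (\<forall>v. Ck_on m S (\<lambda>x. frechet_derivative f (at x) v)))"

definition smooth_on :: "'a::real_normed_vector set \<Rightarrow> ('a \<Rightarrow> 'b::real_normed_vector) \<Rightarrow> bool" where
  "smooth_on S f \<longleftrightarrow> (\<forall>m. Ck_on m S f)"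

text \<open>The complex structure of \<^typ>\<open>complex^'n\<close>, which is a real vector space of dimension
  \<^term>\<open>2 * CARD('n)\<close>.\<close>

definition Jop :: "complex^'n::finite \<Rightarrow> complex^'n" where
  "Jop v = \<i> *s v"

definition holomorphic_map_on :: "(complex^'n::finite) set \<Rightarrow> (complex^'n \<Rightarrow> complex^'n) \<Rightarrow> bool" where
  "holomorphic_map_on S f \<longleftrightarrow> smooth_on S f \<and>
     (\<forall>x\<in>S. \<forall>v. frechet_derivative f (at x) (Jop v) = Jop (frechet_derivative f (at x) v))"

definition holomorphic_fun_on :: "(complex^'n::finite) set \<Rightarrow> (complex^'n \<Rightarrow> complex) \<Rightarrow> bool" where
  "holomorphic_fun_on S f \<longleftrightarrow> smooth_on S f \<and>
     (\<forall>x\<in>S. \<forall>v. frechet_derivative f (at x) (Jop v) = \<i> * frechet_derivative f (at x) v)"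

text \<open>Smoothness on an arbitrary subset of a Euclidean space: local extendability to smooth maps
  on open sets. On an open set this is \<^const>\<open>smooth_on\<close>.\<close>

definition smooth_rel :: "'a::real_normed_vector set \<Rightarrow> ('a \<Rightarrow> 'b::real_normed_vector) \<Rightarrow> bool" where
  "smooth_rel S f \<longleftrightarrow> (\<forall>x\<in>S. \<exists>N h. open N \<and> x \<in> N \<and> smooth_on N h \<and> (\<forall>y\<in>N \<inter> S. h y = f y))"


section \<open>Complex manifolds\<close>

text \<open>The manifold is the whole type \<^typ>\<open>'x\<close> (Hausdorff and second countable in the theorem), of
  complex dimension \<^term>\<open>CARD('n)\<close>. A chart is a domain together with a coordinate map.\<close>

type_synonym ('x, 'n) chart = "'x set \<times> ('x \<Rightarrow> complex^'n)"

definition param :: "('x, 'n::finite) chart \<Rightarrow> complex^'n \<Rightarrow> 'x" where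
  "param c = inv_into (fst c) (snd c)"

definition chart_image :: "('x, 'n::finite) chart \<Rightarrow> 'x set \<Rightarrow> (complex^'n) set" where
  "chart_image c S = snd c ` (S \<inter> fst c)"

definition complex_atlas :: "('x::topological_space, 'n::finite) chart set \<Rightarrow> bool" where
  "complex_atlas A \<longleftrightarrow>
     (\<Union>c\<in>A. fst c) = UNIV \<and>
     (\<forall>c\<in>A. open (fst c) \<and> open (chart_image c UNIV) \<and>
        homeomorphism (fst c) (chart_image c UNIV) (snd c) (param c)) \<and>
     (\<forall>c\<in>A. \<forall>d\<in>A. holomorphic_map_on (chart_image c (fst d)) (snd d \<circ> param c))"

text \<open>As usual for the tangent bundle built from an atlas, the tangent space at \<^term>\<open>p\<close> is
  \<^typ>\<open>complex^'n\<close>, a vector being identified with its components in one preferred chart at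
  \<^term>\<open>p\<close>. The derivatives of the transition maps give the components in the other charts. As
  these derivatives are complex linear, the complex structure of the tangent space at \<^term>\<open>p\<close>
  is \<^const>\<open>Jop\<close> in every chart.\<close>

definition chart_at :: "('x, 'n::finite) chart set \<Rightarrow> 'x \<Rightarrow> ('x, 'n) chart" where
  "chart_at A p = (SOME c. c \<in> A \<and> p \<in> fst c)"

definition to_chart ::
  "('x, 'n::finite) chart set \<Rightarrow> ('x, 'n) chart \<Rightarrow> 'x \<Rightarrow> complex^'n \<Rightarrow> complex^'n" where
  "to_chart A c p =
     frechet_derivative (snd c \<circ> param (chart_at A p)) (at (snd (chart_at A p) p))"

definition from_chart ::
  "('x, 'n::finite) chart set \<Rightarrow> ('x, 'n) chart \<Rightarrow> 'x \<Rightarrow> complex^'n \<Rightarrow> complex^'n" where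
  "from_chart A c p = frechet_derivative (snd (chart_at A p) \<circ> param c) (at (snd c p))"

text \<open>Smooth functions on, and smooth vector fields along, a subset \<^term>\<open>S\<close>.\<close>

definition smooth_fun ::
  "('x, 'n::finite) chart set \<Rightarrow> 'x set \<Rightarrow> ('x \<Rightarrow> 'b::real_normed_vector) \<Rightarrow> bool" where
  "smooth_fun A S F \<longleftrightarrow> (\<forall>c\<in>A. smooth_rel (chart_image c S) (F \<circ> param c))"

definition smooth_field :: "('x, 'n::finite) chart set \<Rightarrow> 'x set \<Rightarrow> ('x \<Rightarrow> complex^'n) \<Rightarrow> bool" where
  "smooth_field A S W \<longleftrightarrow>
     (\<forall>c\<in>A. smooth_rel (chart_image c S) ((\<lambda>q. to_chart A c q (W q)) \<circ> param c))"


section \<open>Submanifolds and derivatives along them\<close>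

text \<open>Embedded submanifolds of real dimension \<^term>\<open>d\<close>: every point has a smooth slice chart.\<close>

definition submanifold :: "('x, 'n::finite) chart set \<Rightarrow> 'x set \<Rightarrow> nat \<Rightarrow> bool" where
  "submanifold A Y d \<longleftrightarrow>
     (\<forall>p\<in>Y. \<exists>N \<psi> \<phi> L.
        open N \<and> snd (chart_at A p) p \<in> N \<and> N \<subseteq> chart_image (chart_at A p) UNIV \<and>
        smooth_on N \<psi> \<and> open (\<psi> ` N) \<and> smooth_on (\<psi> ` N) \<phi> \<and> (\<forall>x\<in>N. \<phi> (\<psi> x) = x) \<and>
        subspace (L :: (complex^'n) set) \<and> dim L = d \<and>
        \<psi> ` (N \<inter> chart_image (chart_at A p) Y) = \<psi> ` N \<inter> L)"

text \<open>\<^term>\<open>\<gamma>\<close> is a smooth curve in \<^term>\<open>Y\<close> through \<^term>\<open>p\<close> at time 0 with velocity \<^term>\<open>v\<close>.\<close>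

definition curve_in ::
  "('x, 'n::finite) chart set \<Rightarrow> 'x set \<Rightarrow> 'x \<Rightarrow> complex^'n \<Rightarrow> (real \<Rightarrow> 'x) \<Rightarrow> bool" where
  "curve_in A Y p v \<gamma> \<longleftrightarrow> \<gamma> 0 = p \<and>
     (\<exists>\<epsilon>>0. \<gamma> ` {-\<epsilon><..<\<epsilon>} \<subseteq> Y \<inter> fst (chart_at A p) \<and>
        smooth_on {-\<epsilon><..<\<epsilon>} (snd (chart_at A p) \<circ> \<gamma>)) \<and>
     ((snd (chart_at A p) \<circ> \<gamma>) has_vector_derivative v) (at 0)"

definition tangent_space :: "('x, 'n::finite) chart set \<Rightarrow> 'x set \<Rightarrow> 'x \<Rightarrow> (complex^'n) set" where
  "tangent_space A Y p = {v. \<exists>\<gamma>. curve_in A Y p v \<gamma>}"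

text \<open>The derivative at \<^term>\<open>p\<close> in direction \<^term>\<open>v\<close> (tangent to \<^term>\<open>Y\<close>) of a smooth vector
  valued function which need only be defined on \<^term>\<open>Y\<close> near \<^term>\<open>p\<close>.\<close>

definition deriv_along ::
  "('x, 'n::finite) chart set \<Rightarrow> 'x set \<Rightarrow> ('x \<Rightarrow> 'b::real_normed_vector) \<Rightarrow> 'x \<Rightarrow> complex^'n \<Rightarrow> 'b"
where
  "deriv_along A Y F p v =
     (THE d. \<forall>\<gamma>. curve_in A Y p v \<gamma> \<longrightarrow> ((F \<circ> \<gamma>) has_vector_derivative d) (at 0))"


section \<open>Kaehler manifolds and the Levi-Civita connection\<close>

definition form_in_chart ::
  "('x, 'n::finite) chart set \<Rightarrow> ('x \<Rightarrow> complex^'n \<Rightarrow> complex^'n \<Rightarrow> real) \<Rightarrow> ('x, 'n) chart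
     \<Rightarrow> complex^'n \<Rightarrow> complex^'n \<Rightarrow> complex^'n \<Rightarrow> real" where
  "form_in_chart A b c x v w =
     b (param c x) (from_chart A c (param c x) v) (from_chart A c (param c x) w)"

text \<open>The three-term sum below is the exterior derivative of \<^term>\<open>\<omega>\<close> on constant vector fields of
  a chart.\<close>

definition kaehler ::
  "('x::topological_space, 'n::finite) chart set \<Rightarrow> ('x \<Rightarrow> complex^'n \<Rightarrow> complex^'n \<Rightarrow> real) \<Rightarrow> bool"
where
  "kaehler A \<omega> \<longleftrightarrow> complex_atlas A \<and>
     (\<forall>p. bilinear (\<omega> p) \<and> (\<forall>v w. \<omega> p w v = - \<omega> p v w) \<and>
        (\<forall>v w. \<omega> p (Jop v) (Jop w) = \<omega> p v w) \<and> (\<forall>v. v \<noteq> 0 \<longrightarrow> \<omega> p v (Jop v) > 0)) \<and>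
     (\<forall>c\<in>A. \<forall>v w. smooth_on (chart_image c UNIV) (\<lambda>x. form_in_chart A \<omega> c x v w)) \<and>
     (\<forall>c\<in>A. \<forall>x\<in>chart_image c UNIV. \<forall>u v w.
        frechet_derivative (\<lambda>y. form_in_chart A \<omega> c y v w) (at x) u +
        frechet_derivative (\<lambda>y. form_in_chart A \<omega> c y w u) (at x) v +
        frechet_derivative (\<lambda>y. form_in_chart A \<omega> c y u v) (at x) w = 0)"

definition metric ::
  "('x \<Rightarrow> complex^'n::finite \<Rightarrow> complex^'n \<Rightarrow> real) \<Rightarrow> 'x \<Rightarrow> complex^'n \<Rightarrow> complex^'n \<Rightarrow> real" where
  "metric \<omega> p v w = \<omega> p v (Jop w)"

text \<open>\<^term>\<open>christoffel A \<omega> c x v w\<close> is the vector with components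
  $\Gamma^l_{ij} v^i w^j$ at the point with coordinates \<^term>\<open>x\<close>, given by the Koszul formula.\<close>

definition christoffel ::
  "('x, 'n::finite) chart set \<Rightarrow> ('x \<Rightarrow> complex^'n \<Rightarrow> complex^'n \<Rightarrow> real) \<Rightarrow> ('x, 'n) chart
     \<Rightarrow> complex^'n \<Rightarrow> complex^'n \<Rightarrow> complex^'n \<Rightarrow> complex^'n" where
  "christoffel A \<omega> c x v w =
     (let g = form_in_chart A (metric \<omega>) c in
      THE \<Gamma>. \<forall>z. g x \<Gamma> z =
        (frechet_derivative (\<lambda>y. g y w z) (at x) v +
         frechet_derivative (\<lambda>y. g y v z) (at x) w -
         frechet_derivative (\<lambda>y. g y v w) (at x) z) / 2)"

text \<open>\<^term>\<open>nabla A \<omega> Y W p v\<close> is the Levi-Civita covariant derivative, in direction \<^term>\<open>v\<close> tangent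
  to \<^term>\<open>Y\<close> at \<^term>\<open>p\<close>, of a vector field \<^term>\<open>W\<close> of the ambient manifold along \<^term>\<open>Y\<close>. For
  \<^term>\<open>Y = UNIV\<close> it is the Levi-Civita connection itself.\<close>

definition nabla ::
  "('x, 'n::finite) chart set \<Rightarrow> ('x \<Rightarrow> complex^'n \<Rightarrow> complex^'n \<Rightarrow> real) \<Rightarrow> 'x set
     \<Rightarrow> ('x \<Rightarrow> complex^'n) \<Rightarrow> 'x \<Rightarrow> complex^'n \<Rightarrow> complex^'n" where
  "nabla A \<omega> Y W p v =
     (let c = chart_at A p in
      deriv_along A Y (\<lambda>q. to_chart A c q (W q)) p v + christoffel A \<omega> c (snd c p) v (W p))"


section \<open>Forms and Calabi-Yau manifolds\<close>

text \<open>A complex valued \<^term>\<open>m\<close>-form on a tangent space is a function on lists of tangent vectors, of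
  which only the values on lists of length \<^term>\<open>m\<close> matter.\<close>

type_synonym 'n form = "(complex^'n) list \<Rightarrow> complex"

text \<open>The wedge product of the one-forms with indices below \<^term>\<open>m\<close>.\<close>

definition wedge :: "nat \<Rightarrow> (nat \<Rightarrow> complex^'n::finite \<Rightarrow> complex) \<Rightarrow> 'n form" where
  "wedge m \<theta> ws = (\<Sum>\<pi> | \<pi> permutes {..<m}. of_int (sign \<pi>) * (\<Prod>i<m. \<theta> i (ws ! \<pi> i)))"

text \<open>\<^term>\<open>e\<close> together with its image under J is an orthonormal frame of the tangent space. Frame
  indices start at 0.\<close>

definition unitary_frame ::
  "('x \<Rightarrow> complex^'n::finite \<Rightarrow> complex^'n \<Rightarrow> real) \<Rightarrow> 'x \<Rightarrow> (nat \<Rightarrow> complex^'n) \<Rightarrow> bool" where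
  "unitary_frame \<omega> p e \<longleftrightarrow> (\<forall>i<CARD('n). \<forall>j<CARD('n).
     metric \<omega> p (e i) (e j) = (if i = j then 1 else 0) \<and>
     metric \<omega> p (e i) (Jop (e j)) = 0 \<and>
     metric \<omega> p (Jop (e i)) (Jop (e j)) = (if i = j then 1 else 0))"

text \<open>The coframe $\theta^j = e_j^* + \sqrt{-1} f_j^*$; the dual basis of an orthonormal basis is
  given by the metric.\<close>

definition coframe ::
  "('x \<Rightarrow> complex^'n::finite \<Rightarrow> complex^'n \<Rightarrow> real) \<Rightarrow> 'x \<Rightarrow> (nat \<Rightarrow> complex^'n)
     \<Rightarrow> nat \<Rightarrow> complex^'n \<Rightarrow> complex" where
  "coframe \<omega> p e j w = Complex (metric \<omega> p (e j) w) (metric \<omega> p (Jop (e j)) w)"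

text \<open>An alternating complex multilinear form, i.e. a form of type $(n,0)$.\<close>

definition top_form :: "'n::finite form \<Rightarrow> bool" where
  "top_form \<alpha> \<longleftrightarrow>
     (\<forall>ws i z u v. length ws = CARD('n) \<and> i < CARD('n) \<longrightarrow>
        \<alpha> (ws[i := z *s u + v]) = z * \<alpha> (ws[i := u]) + \<alpha> (ws[i := v])) \<and>
     (\<forall>ws i j. length ws = CARD('n) \<and> i < j \<and> j < CARD('n) \<and> ws ! i = ws ! j \<longrightarrow> \<alpha> ws = 0)"

text \<open>Holomorphic: of type $(n,0)$ with holomorphic components on constant vectors in each holomorphic
  chart.\<close>

definition holomorphic_volume_form ::
  "('x, 'n::finite) chart set \<Rightarrow> ('x \<Rightarrow> 'n form) \<Rightarrow> bool" where
  "holomorphic_volume_form A \<Omega> \<longleftrightarrow> (\<forall>p. top_form (\<Omega> p)) \<and>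
     (\<forall>c\<in>A. \<forall>ws. length ws = CARD('n) \<longrightarrow>
        holomorphic_fun_on (chart_image c UNIV)
          (\<lambda>x. \<Omega> (param c x) (map (from_chart A c (param c x)) ws)))"

text \<open>The covariant derivative of \<^term>\<open>\<Omega>\<close>, given by the Leibniz rule on smooth local vector
  fields, vanishes.\<close>

definition parallel_form ::
  "('x::topological_space, 'n::finite) chart set \<Rightarrow> ('x \<Rightarrow> complex^'n \<Rightarrow> complex^'n \<Rightarrow> real)
     \<Rightarrow> ('x \<Rightarrow> 'n form) \<Rightarrow> bool" where
  "parallel_form A \<omega> \<Omega> \<longleftrightarrow>
     (\<forall>U p Ws v. open U \<and> p \<in> U \<and> length Ws = CARD('n) \<and> (\<forall>W\<in>set Ws. smooth_field A U W) \<longrightarrow>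
        deriv_along A UNIV (\<lambda>q. \<Omega> q (map (\<lambda>W. W q) Ws)) p v =
        (\<Sum>i<CARD('n). \<Omega> p ((map (\<lambda>W. W p) Ws)[i := nabla A \<omega> UNIV (Ws ! i) p v])))"

text \<open>Constant length one, normalised such that $\Omega = f\,\theta^1\wedge\dots\wedge\theta^n$ with
  $|f| = 1$ in unitary frames.\<close>

definition unit_length_form ::
  "('x \<Rightarrow> complex^'n::finite \<Rightarrow> complex^'n \<Rightarrow> real) \<Rightarrow> ('x \<Rightarrow> 'n form) \<Rightarrow> bool" where
  "unit_length_form \<omega> \<Omega> \<longleftrightarrow>
     (\<forall>p e. unitary_frame \<omega> p e \<longrightarrow> (\<exists>f. cmod f = 1 \<and>
        (\<forall>ws. length ws = CARD('n) \<longrightarrow> \<Omega> p ws = f * wedge CARD('n) (coframe \<omega> p e) ws)))"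

definition calabi_yau ::
  "('x::topological_space, 'n::finite) chart set \<Rightarrow> ('x \<Rightarrow> complex^'n \<Rightarrow> complex^'n \<Rightarrow> real)
     \<Rightarrow> ('x \<Rightarrow> 'n form) \<Rightarrow> bool" where
  "calabi_yau A \<omega> \<Omega> \<longleftrightarrow> kaehler A \<omega> \<and>
     holomorphic_volume_form A \<Omega> \<and> parallel_form A \<omega> \<Omega> \<and> unit_length_form \<omega> \<Omega>"


section \<open>Coisotropic submanifolds and leafwise minimality\<close>

definition null_space ::
  "('x, 'n::finite) chart set \<Rightarrow> ('x \<Rightarrow> complex^'n \<Rightarrow> complex^'n \<Rightarrow> real) \<Rightarrow> 'x set \<Rightarrow> 'x
     \<Rightarrow> (complex^'n) set" where
  "null_space A \<omega> Y p = {v. \<forall>w\<in>tangent_space A Y p. \<omega> p v w = 0}"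

definition coisotropic ::
  "('x, 'n::finite) chart set \<Rightarrow> ('x \<Rightarrow> complex^'n \<Rightarrow> complex^'n \<Rightarrow> real) \<Rightarrow> 'x set \<Rightarrow> bool" where
  "coisotropic A \<omega> Y \<longleftrightarrow> (\<forall>p\<in>Y. null_space A \<omega> Y p \<subseteq> tangent_space A Y p)"

definition normal_part ::
  "('x, 'n::finite) chart set \<Rightarrow> ('x \<Rightarrow> complex^'n \<Rightarrow> complex^'n \<Rightarrow> real) \<Rightarrow> 'x set \<Rightarrow> 'x
     \<Rightarrow> complex^'n \<Rightarrow> complex^'n" where
  "normal_part A \<omega> Y p z =
     (THE m. (\<forall>t\<in>tangent_space A Y p. metric \<omega> p m t = 0) \<and> z - m \<in> tangent_space A Y p)"

definition second_ff ::
  "('x::topological_space, 'n::finite) chart set \<Rightarrow> ('x \<Rightarrow> complex^'n \<Rightarrow> complex^'n \<Rightarrow> real)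
     \<Rightarrow> 'x set \<Rightarrow> 'x \<Rightarrow> complex^'n \<Rightarrow> complex^'n \<Rightarrow> complex^'n" where
  "second_ff A \<omega> Y p v w =
     (THE s. \<forall>U W. open U \<and> p \<in> U \<and> smooth_field A (Y \<inter> U) W \<and>
        (\<forall>q\<in>Y \<inter> U. W q \<in> tangent_space A Y q) \<and> W p = w \<longrightarrow>
        s = normal_part A \<omega> Y p (nabla A \<omega> Y W p v))"

text \<open>An orthonormal basis $(e_{k+1},\dots,e_n)$ of the tangent space of the leaf at \<^term>\<open>p\<close>, chosen
  pointwise; the constructions below do not depend on the choice.\<close>

definition leaf_basis ::
  "('x, 'n::finite) chart set \<Rightarrow> ('x \<Rightarrow> complex^'n \<Rightarrow> complex^'n \<Rightarrow> real) \<Rightarrow> 'x set \<Rightarrow> 'x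
     \<Rightarrow> (complex^'n) list" where
  "leaf_basis A \<omega> Y p =
     (SOME bs. span (set bs) = null_space A \<omega> Y p \<and>
        (\<forall>i<length bs. \<forall>j<length bs. metric \<omega> p (bs ! i) (bs ! j) = (if i = j then 1 else 0)))"

definition leafwise_mean_curvature_vector ::
  "('x::topological_space, 'n::finite) chart set \<Rightarrow> ('x \<Rightarrow> complex^'n \<Rightarrow> complex^'n \<Rightarrow> real)
     \<Rightarrow> 'x set \<Rightarrow> 'x \<Rightarrow> complex^'n" where
  "leafwise_mean_curvature_vector A \<omega> Y p =
     (\<Sum>b\<leftarrow>leaf_basis A \<omega> Y p. second_ff A \<omega> Y p b b)"

definition leafwise_mean_curvature_form ::
  "('x::topological_space, 'n::finite) chart set \<Rightarrow> ('x \<Rightarrow> complex^'n \<Rightarrow> complex^'n \<Rightarrow> real)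
     \<Rightarrow> 'x set \<Rightarrow> 'x \<Rightarrow> complex^'n \<Rightarrow> real" where
  "leafwise_mean_curvature_form A \<omega> Y p v = \<omega> p (leafwise_mean_curvature_vector A \<omega> Y p) v"

definition leafwise_minimal ::
  "('x::topological_space, 'n::finite) chart set \<Rightarrow> ('x \<Rightarrow> complex^'n \<Rightarrow> complex^'n \<Rightarrow> real)
     \<Rightarrow> 'x set \<Rightarrow> bool" where
  "leafwise_minimal A \<omega> Y \<longleftrightarrow>
     (\<forall>p\<in>Y. \<forall>v\<in>tangent_space A Y p. leafwise_mean_curvature_form A \<omega> Y p v = 0)"


section \<open>The transverse Maslov charge and leafwise special coisotropic submanifolds\<close>

text \<open>The complexified tangent space: the pair \<^term>\<open>(a, b)\<close> stands for $a + \sqrt{-1}\,b$.\<close>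

type_synonym 'n cvec = "(complex^'n) \<times> (complex^'n)"

definition cscale :: "complex \<Rightarrow> 'n::finite cvec \<Rightarrow> 'n cvec" where
  "cscale z w = (Re z *\<^sub>R fst w - Im z *\<^sub>R snd w, Re z *\<^sub>R snd w + Im z *\<^sub>R fst w)"

text \<open>$u_j = \frac12 (e_j - \sqrt{-1} J e_j)$\<close>

definition u_vec :: "complex^'n::finite \<Rightarrow> 'n cvec" where
  "u_vec e = ((1/2) *\<^sub>R e, - ((1/2) *\<^sub>R Jop e))"

text \<open>Interior product with a complexified vector, and with $u_1 \wedge \dots \wedge u_m$ for a list
  of such vectors.\<close>

definition interior1 :: "'n::finite cvec \<Rightarrow> 'n form \<Rightarrow> 'n form" where
  "interior1 u \<alpha> = (\<lambda>ws. \<alpha> (fst u # ws) + \<i> * \<alpha> (snd u # ws))"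

definition interior :: "'n::finite cvec list \<Rightarrow> 'n form \<Rightarrow> 'n form" where
  "interior us \<alpha> = fold interior1 us \<alpha>"

text \<open>The tensor square of a form is a function of two lists of vectors.\<close>

definition tensor_square :: "'n::finite form \<Rightarrow> (complex^'n) list \<Rightarrow> 'n form" where
  "tensor_square \<alpha> ws ws' = \<alpha> ws * \<alpha> ws'"

definition maslov_charge ::
  "('x, 'n::finite) chart set \<Rightarrow> ('x \<Rightarrow> complex^'n \<Rightarrow> complex^'n \<Rightarrow> real) \<Rightarrow> ('x \<Rightarrow> 'n form)
     \<Rightarrow> 'x set \<Rightarrow> 'x \<Rightarrow> (complex^'n) list \<Rightarrow> 'n form" where
  "maslov_charge A \<omega> \<Omega> Y p = tensor_square (interior (map u_vec (leaf_basis A \<omega> Y p)) (\<Omega> p))"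

text \<open>Adapted frames on the part of \<^term>\<open>Y\<close> in the open set \<^term>\<open>U\<close>, where \<^term>\<open>Y\<close> has dimension
  \<^term>\<open>CARD('n) + k\<close>: the indices \<^term>\<open>j < k\<close> are transverse, the indices from \<^term>\<open>k\<close> on are
  those of the leaf directions.\<close>

definition adapted_frame ::
  "('x::topological_space, 'n::finite) chart set \<Rightarrow> ('x \<Rightarrow> complex^'n \<Rightarrow> complex^'n \<Rightarrow> real)
     \<Rightarrow> 'x set \<Rightarrow> nat \<Rightarrow> 'x set \<Rightarrow> (nat \<Rightarrow> 'x \<Rightarrow> complex^'n) \<Rightarrow> bool" where
  "adapted_frame A \<omega> Y k U E \<longleftrightarrow> open U \<and>
     (\<forall>j<CARD('n). smooth_field A (Y \<inter> U) (E j)) \<and>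
     (\<forall>p\<in>Y \<inter> U. unitary_frame \<omega> p (\<lambda>j. E j p) \<and>
        tangent_space A Y p =
          span ((\<lambda>j. E j p) ` {..<CARD('n)} \<union> (\<lambda>j. Jop (E j p)) ` {..<k}) \<and>
        null_space A \<omega> Y p = span ((\<lambda>j. E j p) ` {k..<CARD('n)}))"

text \<open>The covariant derivative of $u_j$ along \<^term>\<open>Y\<close>, and the coefficients
  \<^term>\<open>\<kappa> i j\<close> $= \omega^i_j(v)$ of the connection forms, $\nabla_v u_j = \omega^i_j(v)\, u_i$.\<close>

definition nabla_u ::
  "('x, 'n::finite) chart set \<Rightarrow> ('x \<Rightarrow> complex^'n \<Rightarrow> complex^'n \<Rightarrow> real) \<Rightarrow> 'x set
     \<Rightarrow> ('x \<Rightarrow> complex^'n) \<Rightarrow> 'x \<Rightarrow> complex^'n \<Rightarrow> 'n cvec" where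
  "nabla_u A \<omega> Y e p v =
     (nabla A \<omega> Y (\<lambda>q. fst (u_vec (e q))) p v, nabla A \<omega> Y (\<lambda>q. snd (u_vec (e q))) p v)"

definition connection_coeffs ::
  "('x, 'n::finite) chart set \<Rightarrow> ('x \<Rightarrow> complex^'n \<Rightarrow> complex^'n \<Rightarrow> real) \<Rightarrow> 'x set
     \<Rightarrow> (nat \<Rightarrow> 'x \<Rightarrow> complex^'n) \<Rightarrow> 'x \<Rightarrow> complex^'n \<Rightarrow> (nat \<Rightarrow> nat \<Rightarrow> complex) \<Rightarrow> bool" where
  "connection_coeffs A \<omega> Y E p v \<kappa> \<longleftrightarrow>
     (\<forall>j<CARD('n). nabla_u A \<omega> Y (E j) p v = (\<Sum>i<CARD('n). cscale (\<kappa> i j) (u_vec (E i p))))"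

text \<open>The covectors $\theta^1,\dots,\theta^k$ of an adapted frame are of type $(1,0)$, vanish on the leaf
  directions and their image under J, and span $(N^*\mathcal F)^{1,0}$; so
  $\theta^1 \wedge \dots \wedge \theta^k$ is a local frame of the transverse canonical bundle
  $K_Y = \det ((N^*\mathcal F)^{1,0})$.\<close>

definition canonical_frame ::
  "('x \<Rightarrow> complex^'n::finite \<Rightarrow> complex^'n \<Rightarrow> real) \<Rightarrow> nat \<Rightarrow> (nat \<Rightarrow> 'x \<Rightarrow> complex^'n)
     \<Rightarrow> 'x \<Rightarrow> 'n form" where
  "canonical_frame \<omega> k E p = wedge k (coframe \<omega> p (\<lambda>j. E j p))"

text \<open>\<^term>\<open>\<tau>\<close> is the covariant derivative at \<^term>\<open>p\<close> in direction \<^term>\<open>v\<close> of the section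
  \<^term>\<open>\<sigma>\<close> of $K_Y^{\otimes 2}$. The induced connection on $K_Y$ is
  $\nabla(\theta^1\wedge\dots\wedge\theta^k) = -\omega^a_a\,\theta^1\wedge\dots\wedge\theta^k$; the
  factor 2 is the Leibniz rule for the tensor square. The connection does not depend on the adapted
  frame.\<close>

definition has_canonical_sq_derivative ::
  "('x::topological_space, 'n::finite) chart set \<Rightarrow> ('x \<Rightarrow> complex^'n \<Rightarrow> complex^'n \<Rightarrow> real)
     \<Rightarrow> 'x set \<Rightarrow> nat \<Rightarrow> ('x \<Rightarrow> (complex^'n) list \<Rightarrow> 'n form) \<Rightarrow> 'x \<Rightarrow> complex^'n
     \<Rightarrow> ((complex^'n) list \<Rightarrow> 'n form) \<Rightarrow> bool" where
  "has_canonical_sq_derivative A \<omega> Y k \<sigma> p v \<tau> \<longleftrightarrow>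
     (\<exists>U E h \<kappa>. adapted_frame A \<omega> Y k U E \<and> p \<in> U \<and> smooth_fun A (Y \<inter> U) h \<and>
        (\<forall>q\<in>Y \<inter> U. \<forall>ws ws'. length ws = k \<and> length ws' = k \<longrightarrow>
           \<sigma> q ws ws' = h q * tensor_square (canonical_frame \<omega> k E q) ws ws') \<and>
        connection_coeffs A \<omega> Y E p v \<kappa> \<and>
        (\<forall>ws ws'. length ws = k \<and> length ws' = k \<longrightarrow>
           \<tau> ws ws' = (deriv_along A Y h p v - 2 * h p * (\<Sum>a<k. \<kappa> a a)) *
             tensor_square (canonical_frame \<omega> k E p) ws ws'))"

definition leafwise_special ::
  "('x::topological_space, 'n::finite) chart set \<Rightarrow> ('x \<Rightarrow> complex^'n \<Rightarrow> complex^'n \<Rightarrow> real)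
     \<Rightarrow> ('x \<Rightarrow> 'n form) \<Rightarrow> 'x set \<Rightarrow> nat \<Rightarrow> bool" where
  "leafwise_special A \<omega> \<Omega> Y k \<longleftrightarrow>
     (\<forall>p\<in>Y. \<forall>v\<in>null_space A \<omega> Y p.
        has_canonical_sq_derivative A \<omega> Y k (maslov_charge A \<omega> \<Omega> Y) p v (\<lambda>ws ws'. 0))"

end

theory Submission
  imports Defs
begin

text \<open>On \<open>Y\<close> take an adapted frame \<open>E\<close> and write \<open>F = \<Omega> (E 0, \<dots>, E (n - 1))\<close>. The transverse Maslov
  charge is \<open>F\<^sup>2\<close> times the square of the canonical frame, and \<open>\<Omega>\<close> being parallel gives
  \<open>v F = F * (\<Sum>i<n. \<theta>\<^sub>i (\<nabla>\<^sub>v (E i)))\<close>. So the derivative of the charge in a leaf direction \<open>v\<close> is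
  \<open>2 F\<^sup>2\<close> times \<open>\<Sum>i\<in>{k..<n}. \<theta>\<^sub>i (\<nabla>\<^sub>v (E i))\<close>, whose terms are purely imaginary, with imaginary parts
  \<open>\<omega> (E i, \<nabla>\<^sub>v (E i))\<close>. Since the Levi-Civita connection is torsion-free, commutes with J, and brackets
  of fields tangent to \<open>Y\<close> are tangent to \<open>Y\<close>, the sum of these imaginary parts is the value at \<open>v\<close>
  of the leafwise mean curvature form up to sign. The mean curvature vector lies in J of the leaf
  directions, so its form vanishes on \<open>Y\<close> as soon as it vanishes on the leaf directions.\<close>

section \<open>Calculus of smooth maps\<close>

text \<open>The charge is contracted with a leaf basis chosen pointwise by \<open>SOME\<close>,
  which need not vary continuously, so it cannot be differentiated as written. Two orthonormal bases
  of a leaf tangent space differ by a real orthogonal matrix, of determinant 1 or -1, and the tensor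
  square removes that sign; this lets a smooth frame \<open>E\<close> replace the chosen basis. The
  connection on the square of the canonical bundle subtracts twice the transverse part of the trace,
  which is why only the leaf indices survive. Fields such as \<open>E\<close> live on
  \<open>Y\<close> only, and tangent spaces at different points are written in different preferred
  charts, so derivatives are computed from an open extension of the components in the preferred
  chart at \<open>p\<close>. The Hermitian form \<open>H\<close> merges the metric and the Kaehler
  form: its real part measures orthonormality and its imaginary part isotropy. Adapted frames have
  to be constructed: null fields come from functions that vanish on \<open>Y\<close>, and since null
  spaces are isotropic, unitary Gram-Schmidt only forms real combinations of them.\<close>

abbreviation dd :: "('a::real_normed_vector \<Rightarrow> 'b::real_normed_vector) \<Rightarrow> 'a \<Rightarrow> 'a \<Rightarrow> 'b"
  where "dd f x \<equiv> frechet_derivative f (at x)"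

lemma dd_eqI: "(f has_derivative f') (at x) \<Longrightarrow> dd f x = f'"
  by (metis frechet_derivative_at)

lemma dd_works: "f differentiable (at x) \<Longrightarrow> (f has_derivative dd f x) (at x)"
  by (simp add: frechet_derivative_works)

lemma dd_cong_open:
  assumes "open S" "x \<in> S" "\<And>y. y \<in> S \<Longrightarrow> f y = g y"
  shows "dd f x = dd g x"
proof -
  have "(f has_derivative f') (at x) \<longleftrightarrow> (g has_derivative f') (at x)" for f'
    using assms has_derivative_transform_within_open[of f f' x UNIV S g]
      has_derivative_transform_within_open[of g f' x UNIV S f] by auto
  then show ?thesis by (simp add: frechet_derivative_def)
qed

lemma differentiable_cong_open:
  assumes "open S" "x \<in> S" "\<And>y. y \<in> S \<Longrightarrow> f y = g y" "f differentiable (at x)"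
  shows "g differentiable (at x)"
  using assms unfolding differentiable_def
  by (meson has_derivative_transform_within_open)

lemma Ck_on_cong:
  assumes "open S" "\<And>x. x \<in> S \<Longrightarrow> f x = g x" "Ck_on m S f"
  shows "Ck_on m S g"
  using assms(2,3)
proof (induction m arbitrary: f g)
  case 0
  then show ?case using continuous_on_cong[OF refl, of S f g] by simp
next
  case (Suc m)
  have "g differentiable (at x)" if "x \<in> S" for x
    by (rule differentiable_cong_open[OF assms(1) that, of f]) (use Suc.prems that in simp_all)
  moreover have "Ck_on m S (\<lambda>x. dd g x v)" for v
  proof (rule Suc.IH)
    show "dd f x v = dd g x v" if "x \<in> S" for x
      using dd_cong_open[OF assms(1) that, of f g] Suc.prems(1) by metis
    show "Ck_on m S (\<lambda>x. dd f x v)" using Suc.prems by simp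
  qed
  ultimately show ?case by simp
qed

lemma Ck_on_subset: "Ck_on m S f \<Longrightarrow> T \<subseteq> S \<Longrightarrow> Ck_on m T f"
  by (induction m arbitrary: f) (auto intro: continuous_on_subset)

lemma Ck_on_continuous: "Ck_on m S f \<Longrightarrow> continuous_on S f"
  by (cases m) (simp_all add: differentiable_imp_continuous_on differentiable_on_def differentiable_at_withinI)

lemma Ck_on_SucD: "Ck_on (Suc m) S f \<Longrightarrow> Ck_on m S f"
proof (induction m arbitrary: f)
  case 0
  then show ?case unfolding Ck_on.simps(1) by (rule Ck_on_continuous)
next
  case (Suc m)
  then show ?case by (metis Ck_on.simps(2))
qed

lemma Ck_on_const: "Ck_on m S (\<lambda>x. c)"
  by (induction m arbitrary: c) auto

lemma Ck_on_add:
  assumes "open S" "Ck_on m S f" "Ck_on m S g"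
  shows "Ck_on m S (\<lambda>x. f x + g x)"
  using assms(2,3)
proof (induction m arbitrary: f g)
  case 0
  then show ?case by (simp add: continuous_on_add)
next
  case (Suc m)
  have d: "((\<lambda>x. f x + g x) has_derivative (\<lambda>v. dd f x v + dd g x v)) (at x)" if "x \<in> S" for x
    using Suc.prems that by (intro has_derivative_add dd_works) auto
  have "Ck_on m S (\<lambda>x. dd (\<lambda>x. f x + g x) x v)" for v
    by (rule Ck_on_cong[OF assms(1) _ Suc.IH[of "\<lambda>x. dd f x v" "\<lambda>x. dd g x v"]])
      (use Suc.prems dd_eqI[OF d] in auto)
  with d[THEN differentiableI] show ?case by simp
qed

lemma Ck_on_sum:
  assumes "open S" "\<And>i. i \<in> I \<Longrightarrow> Ck_on m S (f i)"
  shows "Ck_on m S (\<lambda>x. \<Sum>i\<in>I. f i x)"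
  using assms(2)
proof (induction I rule: infinite_finite_induct)
  case (insert i I)
  then have "Ck_on m S (\<lambda>x. f i x + (\<Sum>i\<in>I. f i x))" by (intro Ck_on_add[OF assms(1)]) auto
  then show ?case using insert by simp
qed (simp_all add: Ck_on_const)

text \<open>The product rule turns the derivative into a sum of two products, each with one factor
  differentiated; the other factor has one degree to spare, which \<open>Ck_on_SucD\<close> gives
  up.\<close>

lemma (in bounded_bilinear) Ck_on:
  assumes "open S" "Ck_on m S f" "Ck_on m S g"
  shows "Ck_on m S (\<lambda>x. prod (f x) (g x))"
  using assms(2,3)
proof (induction m arbitrary: f g)
  case 0
  then show ?case by (auto intro: continuous_on)
next
  case (Suc m)
  have d: "((\<lambda>x. prod (f x) (g x)) has_derivative (\<lambda>v. prod (f x) (dd g x v) + prod (dd f x v) (g x))) (at x)"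
    if "x \<in> S" for x
    using Suc.prems that by (intro FDERIV dd_works) auto
  have "Ck_on m S (\<lambda>x. dd (\<lambda>x. prod (f x) (g x)) x v)" for v
    by (rule Ck_on_cong[OF assms(1) _ Ck_on_add[OF assms(1) Suc.IH[of f "\<lambda>x. dd g x v"]
          Suc.IH[of "\<lambda>x. dd f x v" g]]])
      (use Suc.prems dd_eqI[OF d] in \<open>auto intro: Ck_on_SucD\<close>)
  with d[THEN differentiableI] show ?case by simp
qed

lemma (in bounded_linear) Ck_on:
  assumes "open S" "Ck_on m S g"
  shows "Ck_on m S (\<lambda>x. f (g x))"
  using assms(2)
proof (induction m arbitrary: g)
  case 0
  then show ?case by (auto intro: continuous_on)
next
  case (Suc m)
  have d: "((\<lambda>x. f (g x)) has_derivative (\<lambda>v. f (dd g x v))) (at x)" if "x \<in> S" for x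
    using Suc.prems that by (intro has_derivative dd_works) auto
  have "Ck_on m S (\<lambda>x. dd (\<lambda>x. f (g x)) x v)" for v
    by (rule Ck_on_cong[OF assms(1) _ Suc.IH[of "\<lambda>x. dd g x v"]])
      (use Suc.prems dd_eqI[OF d] in auto)
  with d[THEN differentiableI] show ?case by simp
qed

lemma dd_linear: "f differentiable (at x) \<Longrightarrow> linear (dd f x)"
  by (simp add: linear_frechet_derivative)

lemma linear_basis_expand:
  fixes L :: "'a::euclidean_space \<Rightarrow> 'b::real_vector"
  assumes "linear L"
  shows "L v = (\<Sum>b\<in>Basis. (v \<bullet> b) *\<^sub>R L b)"
proof -
  have "L v = L (\<Sum>b\<in>Basis. (v \<bullet> b) *\<^sub>R b)" by (simp add: euclidean_representation)
  also have "\<dots> = (\<Sum>b\<in>Basis. (v \<bullet> b) *\<^sub>R L b)"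
    using assms by (simp add: linear_sum linear_scale)
  finally show ?thesis .
qed

text \<open>The chain rule applies \<open>dd g (f x)\<close> to a direction that moves with
  \<open>x\<close>, while the induction hypothesis covers only fixed directions. Expanding the
  moving direction in a basis of the finite-dimensional middle space reduces to those.\<close>

lemma Ck_on_compose:
  fixes g :: "'b::euclidean_space \<Rightarrow> 'c::real_normed_vector"
  assumes "open S" "open T" "f ` S \<subseteq> T" "Ck_on m S f" "Ck_on m T g"
  shows "Ck_on m S (\<lambda>x. g (f x))"
  using assms(4,5)
proof (induction m arbitrary: g)
  case 0
  then show ?case using assms(3) by (auto intro: continuous_on_compose2)
next
  case (Suc m)
  have d: "((\<lambda>x. g (f x)) has_derivative (\<lambda>v. dd g (f x) (dd f x v))) (at x)" if "x \<in> S" for x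
    using Suc.prems that assms(3)
    by (intro has_derivative_compose[of f _ x UNIV g] dd_works) auto
  have e: "dd g (f x) (dd f x v) = (\<Sum>b\<in>Basis. (dd f x v \<bullet> b) *\<^sub>R dd g (f x) b)" if "x \<in> S" for x v
    by (rule linear_basis_expand, rule dd_linear) (use Suc.prems that assms(3) in auto)
  have "Ck_on m S (\<lambda>x. (dd f x v \<bullet> b) *\<^sub>R dd g (f x) b)" for v b
    by (rule bounded_bilinear.Ck_on[OF bounded_bilinear_scaleR assms(1)
          bounded_linear.Ck_on[OF bounded_linear_inner_left assms(1)] Suc.IH])
       (use Suc.prems in \<open>auto intro: Ck_on_SucD\<close>)
  then have "Ck_on m S (\<lambda>x. \<Sum>b\<in>Basis. (dd f x v \<bullet> b) *\<^sub>R dd g (f x) b)" for v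
    by (intro Ck_on_sum[OF assms(1)])
  then have "Ck_on m S (\<lambda>x. dd (\<lambda>x. g (f x)) x v)" for v
    by (rule Ck_on_cong[OF assms(1), rotated]) (use e dd_eqI[OF d] in auto)
  with d[THEN differentiableI] show ?case by simp
qed

text \<open>Stated for every exponent because differentiation lowers it; the exponent -1/2 later
  normalises vectors in Gram-Schmidt.\<close>

lemma Ck_on_powr: "Ck_on m {0<..} (\<lambda>x::real. x powr a)"
proof (induction m arbitrary: a)
  case 0
  then show ?case by (simp add: continuous_on_powr)
next
  case (Suc m)
  have d: "((\<lambda>x. x powr a) has_derivative (\<lambda>v. v * (a * x powr (a - 1)))) (at x)" if "x > 0" for x :: real
    using that has_real_derivative_powr[of x a]
    by (simp add: has_field_derivative_def mult.commute[of _ "a * x powr (a - 1)"])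
  have "Ck_on m {0<..} (\<lambda>x. v * (a * x powr (a - 1)))" for v :: real
    by (intro bounded_linear.Ck_on[OF bounded_linear_mult_right] Suc.IH) auto
  then have "Ck_on m {0<..} (\<lambda>x. dd (\<lambda>x. x powr a) x v)" for v :: real
    by (rule Ck_on_cong[rotated 2]) (use dd_eqI[OF d] in auto)
  with d[THEN differentiableI] show ?case by simp
qed

section \<open>Closure properties of smooth maps\<close>

lemma smooth_on_const: "smooth_on S (\<lambda>x. c)" by (simp add: smooth_on_def Ck_on_const)

lemma smooth_on_bounded_linear:
  "bounded_linear L \<Longrightarrow> open S \<Longrightarrow> smooth_on S f \<Longrightarrow> smooth_on S (\<lambda>x. L (f x))"
  by (simp add: smooth_on_def bounded_linear.Ck_on)

lemma smooth_on_linear: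
  fixes L :: "'a::euclidean_space \<Rightarrow> 'b::real_normed_vector"
  shows "linear L \<Longrightarrow> open S \<Longrightarrow> smooth_on S f \<Longrightarrow> smooth_on S (\<lambda>x. L (f x))"
  by (simp add: linear_conv_bounded_linear smooth_on_bounded_linear)

lemma smooth_on_cong: "open S \<Longrightarrow> (\<And>x. x \<in> S \<Longrightarrow> f x = g x) \<Longrightarrow> smooth_on S f \<Longrightarrow> smooth_on S g"
  using Ck_on_cong[of S f g] by (auto simp: smooth_on_def)

lemma smooth_on_subset: "smooth_on S f \<Longrightarrow> T \<subseteq> S \<Longrightarrow> smooth_on T f"
  by (auto simp: smooth_on_def intro: Ck_on_subset)

lemma smooth_on_add: "open S \<Longrightarrow> smooth_on S f \<Longrightarrow> smooth_on S g \<Longrightarrow> smooth_on S (\<lambda>x. f x + g x)"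
  by (simp add: smooth_on_def Ck_on_add)

lemma smooth_on_sum:
  "open S \<Longrightarrow> (\<And>i. i \<in> I \<Longrightarrow> smooth_on S (f i)) \<Longrightarrow> smooth_on S (\<lambda>x. \<Sum>i\<in>I. f i x)"
  by (simp add: smooth_on_def Ck_on_sum)

lemma smooth_on_bilinear:
  "bounded_bilinear B \<Longrightarrow> open S \<Longrightarrow> smooth_on S f \<Longrightarrow> smooth_on S g \<Longrightarrow> smooth_on S (\<lambda>x. B (f x) (g x))"
  by (simp add: smooth_on_def bounded_bilinear.Ck_on)

lemma smooth_on_compose:
  fixes g :: "'b::euclidean_space \<Rightarrow> 'c::real_normed_vector"
  shows "open S \<Longrightarrow> open T \<Longrightarrow> f ` S \<subseteq> T \<Longrightarrow> smooth_on S f \<Longrightarrow> smooth_on T g \<Longrightarrow> smooth_on S (\<lambda>x. g (f x))"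
  by (auto simp: smooth_on_def intro: Ck_on_compose)

lemma smooth_on_differentiable: "smooth_on S f \<Longrightarrow> x \<in> S \<Longrightarrow> f differentiable (at x)"
  unfolding smooth_on_def by (metis Ck_on.simps(2))

lemma smooth_on_has_derivative: "smooth_on S f \<Longrightarrow> x \<in> S \<Longrightarrow> (f has_derivative dd f x) (at x)"
  by (simp add: dd_works smooth_on_differentiable)

lemma smooth_on_continuous: "smooth_on S f \<Longrightarrow> continuous_on S f"
  unfolding smooth_on_def by (metis Ck_on.simps(1))

lemma smooth_on_dd: "smooth_on S f \<Longrightarrow> smooth_on S (\<lambda>x. dd f x v)"
  unfolding smooth_on_def by (metis Ck_on.simps(2))

lemma smooth_on_ident: "smooth_on S (\<lambda>x. x)"
proof -
  have "Ck_on m S (\<lambda>x. x)" for m by (cases m) (auto intro: Ck_on_const)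
  then show ?thesis by (simp add: smooth_on_def)
qed

text \<open>A finite basis reduces a moving argument to fixed ones. This is how smooth fields are
  inserted into forms and into derivatives of transition maps, which are known to be smooth on
  constant vectors.\<close>

lemma smooth_on_linear_family:
  fixes L :: "'x::real_normed_vector \<Rightarrow> 'a::euclidean_space \<Rightarrow> 'b::real_normed_vector"
  assumes "open S" "\<And>x. x \<in> S \<Longrightarrow> linear (L x)" "\<And>a. smooth_on S (\<lambda>x. L x a)" "smooth_on S h"
  shows "smooth_on S (\<lambda>x. L x (h x))"
proof (rule smooth_on_cong[OF assms(1)])
  show "(\<Sum>b\<in>Basis. (h x \<bullet> b) *\<^sub>R L x b) = L x (h x)" if "x \<in> S" for x
    using linear_basis_expand[OF assms(2)[OF that], of "h x"] by (rule sym)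
  show "smooth_on S (\<lambda>x. \<Sum>b\<in>Basis. (h x \<bullet> b) *\<^sub>R L x b)"
    by (intro smooth_on_sum smooth_on_bilinear[OF bounded_bilinear_scaleR]
        smooth_on_bounded_linear[OF bounded_linear_inner_left] assms)
qed

text \<open>The product rule for a linear map and its argument varying together: one term from the
  map, one from the argument.\<close>

lemma has_derivative_linear_family:
  fixes L :: "'x::real_normed_vector \<Rightarrow> 'a::euclidean_space \<Rightarrow> 'b::real_normed_vector"
  assumes "open S" "x \<in> S" "\<And>y. y \<in> S \<Longrightarrow> linear (L y)"
    and D: "\<And>a. ((\<lambda>y. L y a) has_derivative D a) (at x)" and h: "(h has_derivative h') (at x)"
  shows "((\<lambda>y. L y (h y)) has_derivative (\<lambda>v. D (h x) v + L x (h' v))) (at x)"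
proof -
  \<comment> \<open>Linearity in \<open>a\<close> is inherited from the maps \<open>L y\<close> by
    uniqueness of derivatives, as \<open>D\<close> is given one vector at a time.\<close>
  have lD: "linear (\<lambda>a. D a v)" for v
  proof (rule linearI)
    show "D (a + b) v = D a v + D b v" for a b
    proof -
      have "((\<lambda>y. L y (a + b)) has_derivative (\<lambda>v. D a v + D b v)) (at x)"
        by (rule has_derivative_transform_within_open[OF has_derivative_add[OF D D] assms(1,2)])
          (simp add: assms(3) linear_add)
      then show ?thesis using D has_derivative_unique by metis
    qed
    show "D (c *\<^sub>R a) v = c *\<^sub>R D a v" for c a
    proof -
      have "((\<lambda>y. L y (c *\<^sub>R a)) has_derivative (\<lambda>v. c *\<^sub>R D a v)) (at x)"
        by (rule has_derivative_transform_within_open[OF has_derivative_scaleR_right[OF D] assms(1,2)])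
          (simp add: assms(3) linear_scale)
      then show ?thesis using D has_derivative_unique by metis
    qed
  qed
  have "((\<lambda>y. \<Sum>b\<in>Basis. (h y \<bullet> b) *\<^sub>R L y b) has_derivative
     (\<lambda>v. \<Sum>b\<in>Basis. (h x \<bullet> b) *\<^sub>R D b v + (h' v \<bullet> b) *\<^sub>R L x b)) (at x)"
    by (intro has_derivative_sum has_derivative_scaleR D has_derivative_inner_left h)
  moreover have "(\<Sum>b\<in>Basis. (h x \<bullet> b) *\<^sub>R D b v + (h' v \<bullet> b) *\<^sub>R L x b) = D (h x) v + L x (h' v)" for v
    using linear_basis_expand[OF lD, of "h x"] linear_basis_expand[OF assms(3)[OF assms(2)], of "h' v"]
    by (simp add: sum.distrib)
  ultimately have "((\<lambda>y. \<Sum>b\<in>Basis. (h y \<bullet> b) *\<^sub>R L y b) has_derivative (\<lambda>v. D (h x) v + L x (h' v))) (at x)"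
    by simp
  then show ?thesis
    by (rule has_derivative_transform_within_open[OF _ assms(1,2)])
      (rule linear_basis_expand[OF assms(3), symmetric])
qed

section \<open>Symmetry of second derivatives\<close>

lemma has_real_derivative_along_line:
  fixes f :: "'a::real_normed_vector \<Rightarrow> real"
  assumes "(f has_derivative f') (at (a + s *\<^sub>R v))"
  shows "((\<lambda>r. f (a + r *\<^sub>R v)) has_real_derivative f' v) (at s)"
proof -
  have "((\<lambda>r. a + r *\<^sub>R v) has_derivative (\<lambda>r. r *\<^sub>R v)) (at s)"
    by (auto intro!: derivative_eq_intros)
  from has_derivative_compose[OF this assms]
  show ?thesis
    using has_derivative_linear[OF assms]
    by (simp add: has_field_derivative_def linear_scale mult.commute[of _ "f' v"])
qed

text \<open>The second difference of \<open>f\<close> at \<open>x\<close> with increments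
  \<open>h v\<close> and \<open>h w\<close> is symmetric in \<open>v\<close> and \<open>w\<close>.
  Two applications of the mean value theorem write it as \<open>h * h\<close> times either mixed
  derivative at a point near \<open>x\<close>, and continuity of both mixed derivatives compares
  them at \<open>x\<close> itself.\<close>

lemma second_derivative_symmetric_real:
  fixes f :: "'a::real_normed_vector \<Rightarrow> real"
  assumes "open S" "x \<in> S" "Ck_on 2 S f"
  shows "dd (\<lambda>y. dd f y v) x w = dd (\<lambda>y. dd f y w) x v"
proof -
  have dif: "f differentiable (at y)" and dif2: "(\<lambda>z. dd f z u) differentiable (at y)"
    and cont: "continuous_on S (\<lambda>y. dd (\<lambda>z. dd f z u) y u')" if "y \<in> S" for y u u'
    using assms(3) that by (auto simp: numeral_2_eq_2)
  have key: "\<exists>s t. 0 < s \<and> s < h \<and> 0 < t \<and> t < h \<and>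
      f (x + h *\<^sub>R v + h *\<^sub>R w) - f (x + h *\<^sub>R v) - f (x + h *\<^sub>R w) + f x =
      h * h * dd (\<lambda>y. dd f y v) (x + s *\<^sub>R v + t *\<^sub>R w) w"
    if h: "h > 0" and sub: "\<And>s t. 0 \<le> s \<Longrightarrow> s \<le> h \<Longrightarrow> 0 \<le> t \<Longrightarrow> t \<le> h \<Longrightarrow> x + s *\<^sub>R v + t *\<^sub>R w \<in> S"
    for h v w
  proof -
    define p where "p s = f ((x + h *\<^sub>R w) + s *\<^sub>R v) - f (x + s *\<^sub>R v)" for s
    have dp: "(p has_real_derivative (dd f ((x + h *\<^sub>R w) + s *\<^sub>R v) v - dd f (x + s *\<^sub>R v) v)) (at s)"
      if "0 \<le> s" "s \<le> h" for s
      unfolding p_def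
      by (intro DERIV_diff has_real_derivative_along_line dd_works dif)
        (use sub[of s h] sub[of s 0] that h in \<open>simp_all add: ac_simps\<close>)
    obtain s where s: "0 < s" "s < h"
      "p h - p 0 = h * (dd f ((x + h *\<^sub>R w) + s *\<^sub>R v) v - dd f (x + s *\<^sub>R v) v)"
      using MVT2[of 0 h p, OF h dp] by auto
    define q where "q t = dd f ((x + s *\<^sub>R v) + t *\<^sub>R w) v" for t
    have dq: "(q has_real_derivative dd (\<lambda>y. dd f y v) ((x + s *\<^sub>R v) + t *\<^sub>R w) w) (at t)"
      if "0 \<le> t" "t \<le> h" for t
      unfolding q_def
      by (intro has_real_derivative_along_line dd_works dif2) (use sub[of s t] that s in simp)
    obtain t where t: "0 < t" "t < h" "q h - q 0 = h * dd (\<lambda>y. dd f y v) (x + s *\<^sub>R v + t *\<^sub>R w) w"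
      using MVT2[of 0 h q, OF h dq] by auto
    have "p h - p 0 = h * h * dd (\<lambda>y. dd f y v) (x + s *\<^sub>R v + t *\<^sub>R w) w"
      using s(3) t(3) by (simp add: q_def ac_simps)
    moreover have "p h - p 0 = f (x + h *\<^sub>R v + h *\<^sub>R w) - f (x + h *\<^sub>R v) - f (x + h *\<^sub>R w) + f x"
      by (simp add: p_def ac_simps)
    ultimately show ?thesis using s t by (intro exI[of _ s] exI[of _ t]) simp
  qed
  define P where "P = (\<lambda>y. dd (\<lambda>y. dd f y v) y w)"
  define Q where "Q = (\<lambda>y. dd (\<lambda>y. dd f y w) y v)"
  \<comment> \<open>One \<open>e\<close> for moving \<open>P\<close> from its intermediate point to
    \<open>x\<close>, the other for \<open>Q\<close>.\<close>
  have *: "norm (P x - Q x) \<le> e + e" if e: "e > 0" for e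
  proof -
    have "isCont P x" "isCont Q x"
      using cont assms(1,2) unfolding P_def Q_def by (auto simp: continuous_on_eq_continuous_at)
    then obtain d1 d2 where d: "d1 > 0" "d2 > 0" "\<And>y. dist y x < d1 \<Longrightarrow> dist (P y) (P x) < e"
      "\<And>y. dist y x < d2 \<Longrightarrow> dist (Q y) (Q x) < e"
      using e unfolding continuous_at_eps_delta by metis
    obtain d3 where d3: "d3 > 0" "ball x d3 \<subseteq> S" using assms(1,2) openE by blast
    define d where "d = min (min d1 d2) d3"
    have "d > 0" using d d3 by (simp add: d_def)
    \<comment> \<open>Small enough for the whole parallelogram spanned by \<open>h v\<close> and
      \<open>h w\<close> to lie within distance \<open>d\<close> of \<open>x\<close>; the summand 1
      keeps the denominator positive when \<open>v\<close> and \<open>w\<close> vanish.\<close>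
    define h where "h = d / (2 * (norm v + norm w + 1))"
    have pos: "norm v + norm w + 1 > 0" by (simp add: add_nonneg_pos)
    then have h: "h > 0" using \<open>d > 0\<close> by (simp add: h_def)
    have "h * (norm v + norm w) < h * (2 * (norm v + norm w + 1))"
    proof (rule mult_strict_left_mono[OF _ h])
      have "0 \<le> norm v + norm w" by simp
      then show "norm v + norm w < 2 * (norm v + norm w + 1)" by argo
    qed
    also have "\<dots> = d" using pos by (simp add: h_def)
    finally have h2: "h * norm v + h * norm w < d" by (simp add: distrib_left)
    have near: "dist (x + s *\<^sub>R v + t *\<^sub>R w) x < d" if "0 \<le> s" "s \<le> h" "0 \<le> t" "t \<le> h" for s t
    proof -
      have "dist (x + s *\<^sub>R v + t *\<^sub>R w) x \<le> norm (s *\<^sub>R v) + norm (t *\<^sub>R w)"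
        using norm_triangle_ineq[of "s *\<^sub>R v" "t *\<^sub>R w"] by (simp only: dist_norm add.assoc add_diff_cancel_left')
      also have "\<dots> \<le> h * norm v + h * norm w"
        using that by (auto intro!: add_mono mult_right_mono)
      finally show ?thesis using h2 by linarith
    qed
    have sub: "x + s *\<^sub>R v + t *\<^sub>R w \<in> S" if "0 \<le> s" "s \<le> h" "0 \<le> t" "t \<le> h" for s t
    proof -
      have "x + s *\<^sub>R v + t *\<^sub>R w \<in> ball x d3"
        using near[OF that] by (simp add: d_def dist_commute)
      then show ?thesis using d3 by blast
    qed
    have sub': "x + s *\<^sub>R w + t *\<^sub>R v \<in> S" if "0 \<le> s" "s \<le> h" "0 \<le> t" "t \<le> h" for s t
      using sub[of t s] that by (simp add: ac_simps)
    obtain s t where 1: "0 < s" "s < h" "0 < t" "t < h"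
      "f (x + h *\<^sub>R v + h *\<^sub>R w) - f (x + h *\<^sub>R v) - f (x + h *\<^sub>R w) + f x = h * h * P (x + s *\<^sub>R v + t *\<^sub>R w)"
      using key[OF h sub] unfolding P_def by blast
    obtain s' t' where 2: "0 < s'" "s' < h" "0 < t'" "t' < h"
      "f (x + h *\<^sub>R w + h *\<^sub>R v) - f (x + h *\<^sub>R w) - f (x + h *\<^sub>R v) + f x = h * h * Q (x + s' *\<^sub>R w + t' *\<^sub>R v)"
      using key[OF h sub'] unfolding Q_def by blast
    have "f (x + h *\<^sub>R w + h *\<^sub>R v) = f (x + h *\<^sub>R v + h *\<^sub>R w)" by (simp add: ac_simps)
    then have "h * h * P (x + s *\<^sub>R v + t *\<^sub>R w) = h * h * Q (x + s' *\<^sub>R w + t' *\<^sub>R v)"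
      using 1(5) 2(5) by linarith
    then have "P (x + s *\<^sub>R v + t *\<^sub>R w) = Q (x + s' *\<^sub>R w + t' *\<^sub>R v)"
      using h by simp
    moreover have "x + s' *\<^sub>R w + t' *\<^sub>R v = x + t' *\<^sub>R v + s' *\<^sub>R w" by (simp add: ac_simps)
    ultimately have eq: "P (x + s *\<^sub>R v + t *\<^sub>R w) = Q (x + t' *\<^sub>R v + s' *\<^sub>R w)" by simp
    have "dist (x + s *\<^sub>R v + t *\<^sub>R w) x < d" "dist (x + t' *\<^sub>R v + s' *\<^sub>R w) x < d"
      using 1 2 by (auto intro!: near)
    then have "dist (P (x + s *\<^sub>R v + t *\<^sub>R w)) (P x) < e" "dist (Q (x + t' *\<^sub>R v + s' *\<^sub>R w)) (Q x) < e"
      by (auto intro!: d(3,4) simp: d_def)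
    then show ?thesis using eq unfolding dist_real_def real_norm_def by linarith
  qed
  have "norm (P x - Q x) \<le> 0 + e" if "e > 0" for e
    using *[of "e / 2"] that by simp
  then have "norm (P x - Q x) \<le> 0" by (rule field_le_epsilon)
  then show ?thesis by (simp add: P_def Q_def)
qed

lemma second_derivative_symmetric:
  fixes f :: "'a::real_normed_vector \<Rightarrow> 'b::euclidean_space"
  assumes "open S" "x \<in> S" "smooth_on S f"
  shows "dd (\<lambda>y. dd f y v) x w = dd (\<lambda>y. dd f y w) x v"
proof (rule euclidean_eqI)
  fix b :: 'b
  have 1: "dd (\<lambda>y. f y \<bullet> b) y u = dd f y u \<bullet> b" if "y \<in> S" for y u
    using dd_eqI[OF has_derivative_inner_left[OF smooth_on_has_derivative[OF assms(3) that]], of b]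
    by (rule fun_cong)
  have 2: "dd (\<lambda>y. dd (\<lambda>y. f y \<bullet> b) y u) x u' = dd (\<lambda>y. dd f y u) x u' \<bullet> b" for u u'
  proof -
    have "dd (\<lambda>y. dd (\<lambda>y. f y \<bullet> b) y u) x = dd (\<lambda>y. dd f y u \<bullet> b) x"
      by (rule dd_cong_open[OF assms(1,2)]) (simp add: 1)
    moreover have "dd (\<lambda>y. dd f y u \<bullet> b) x = (\<lambda>u'. dd (\<lambda>y. dd f y u) x u' \<bullet> b)"
      by (rule dd_eqI, rule has_derivative_inner_left,
          rule smooth_on_has_derivative[OF smooth_on_dd[OF assms(3)] assms(2)])
    ultimately show ?thesis by simp
  qed
  have "smooth_on S (\<lambda>y. f y \<bullet> b)"
    by (rule smooth_on_bounded_linear[OF bounded_linear_inner_left assms(1,3)])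
  then have "Ck_on 2 S (\<lambda>y. f y \<bullet> b)" by (simp add: smooth_on_def)
  from second_derivative_symmetric_real[OF assms(1,2) this]
  show "dd (\<lambda>y. dd f y v) x w \<bullet> b = dd (\<lambda>y. dd f y w) x v \<bullet> b" by (simp add: 2)
qed

section \<open>Complex manifolds in charts\<close>

lemma linear_Jop: "linear Jop"
  by (rule linearI) (simp_all add: Jop_def vector_add_ldistrib vec_eq_iff)

lemma Jop_Jop [simp]: "Jop (Jop v) = - v"
  by (simp add: Jop_def vec_eq_iff)

lemma has_vector_derivative_compose_derivative:
  assumes "(f has_vector_derivative f') (at x)" "(g has_derivative g') (at (f x))"
  shows "((g \<circ> f) has_vector_derivative g' f') (at x)"
  using diff_chain_at[OF assms(1)[unfolded has_vector_derivative_def] assms(2)] has_derivative_linear[OF assms(2)]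
  unfolding has_vector_derivative_def by (simp add: o_def linear_scale)

abbreviation transition_deriv ::
  "('x, 'n::finite) chart \<Rightarrow> ('x, 'n) chart \<Rightarrow> 'x \<Rightarrow> complex^'n \<Rightarrow> complex^'n" where
  "transition_deriv d c p \<equiv> dd (snd d \<circ> param c) (snd c p)"

locale complex_manifold =
  fixes A :: "('x::topological_space, 'n::finite) chart set"
  assumes atlas: "complex_atlas A"
begin

lemma chart_at: "chart_at A p \<in> A" "p \<in> fst (chart_at A p)"
proof -
  have "\<exists>c. c \<in> A \<and> p \<in> fst c" using atlas unfolding complex_atlas_def by blast
  then have "chart_at A p \<in> A \<and> p \<in> fst (chart_at A p)" unfolding chart_at_def by (rule someI_ex)
  then show "chart_at A p \<in> A" "p \<in> fst (chart_at A p)" by auto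
qed

lemma homeo: "c \<in> A \<Longrightarrow> homeomorphism (fst c) (chart_image c UNIV) (snd c) (param c)"
  and open_fst: "c \<in> A \<Longrightarrow> open (fst c)"
  and open_image: "c \<in> A \<Longrightarrow> open (chart_image c UNIV)"
  using atlas unfolding complex_atlas_def by blast+

lemma param_snd [simp]: "c \<in> A \<Longrightarrow> p \<in> fst c \<Longrightarrow> param c (snd c p) = p"
  using homeo homeomorphism_apply1 by metis

lemma snd_param [simp]: "c \<in> A \<Longrightarrow> x \<in> chart_image c UNIV \<Longrightarrow> snd c (param c x) = x"
  using homeo homeomorphism_apply2 by metis

lemma param_in [simp]: "c \<in> A \<Longrightarrow> x \<in> chart_image c UNIV \<Longrightarrow> param c x \<in> fst c"
  using homeo homeomorphism_image2 by blast

lemma snd_in [simp]: "p \<in> fst c \<Longrightarrow> snd c p \<in> chart_image c UNIV"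
  by (auto simp: chart_image_def)

lemma in_chart_image_iff: "c \<in> A \<Longrightarrow> x \<in> chart_image c S \<longleftrightarrow> x \<in> chart_image c UNIV \<and> param c x \<in> S"
  unfolding chart_image_def by (auto simp: chart_image_def image_iff)

lemma chart_imageD: "x \<in> chart_image c S \<Longrightarrow> x \<in> chart_image c UNIV"
  "c \<in> A \<Longrightarrow> x \<in> chart_image c S \<Longrightarrow> param c x \<in> S"
  using in_chart_image_iff by (auto simp: chart_image_def)

lemma snd_in_iff [simp]: "c \<in> A \<Longrightarrow> p \<in> fst c \<Longrightarrow> snd c p \<in> chart_image c S \<longleftrightarrow> p \<in> S"
  by (subst in_chart_image_iff) auto

lemma open_chart_image:
  assumes "c \<in> A" "open U" shows "open (chart_image c U)"
proof -
  have "chart_image c U = chart_image c UNIV \<inter> param c -` U"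
    using in_chart_image_iff[OF assms(1)] by blast
  moreover have "continuous_on (chart_image c UNIV) (param c)"
    using homeo[OF assms(1)] homeomorphism_def by blast
  ultimately show ?thesis
    using continuous_open_preimage[OF _ open_image[OF assms(1)] assms(2)] by simp
qed

lemma open_param_image:
  assumes "c \<in> A" "open N" "N \<subseteq> chart_image c UNIV" shows "open (param c ` N)"
proof -
  have "param c ` N = fst c \<inter> snd c -` N"
    using assms by (auto simp: image_iff subset_iff) (metis param_snd)
  moreover have "continuous_on (fst c) (snd c)"
    using homeo[OF assms(1)] homeomorphism_def by blast
  ultimately show ?thesis
    using continuous_open_preimage[OF _ open_fst[OF assms(1)] assms(2)] by simp
qed

lemma transition_smooth: "c \<in> A \<Longrightarrow> d \<in> A \<Longrightarrow> smooth_on (chart_image c (fst d)) (snd d \<circ> param c)"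
  using atlas unfolding complex_atlas_def holomorphic_map_on_def by blast

lemma transition_has_derivative:
  assumes "c \<in> A" "d \<in> A" "p \<in> fst c" "p \<in> fst d"
  shows "((snd d \<circ> param c) has_derivative transition_deriv d c p) (at (snd c p))"
  by (rule smooth_on_has_derivative[OF transition_smooth]) (use assms in auto)

lemma transition_deriv_linear:
  assumes "c \<in> A" "d \<in> A" "p \<in> fst c" "p \<in> fst d"
  shows "linear (transition_deriv d c p)"
  using transition_has_derivative[OF assms] has_derivative_linear by blast

lemma transition_deriv_Jop:
  assumes "c \<in> A" "d \<in> A" "p \<in> fst c" "p \<in> fst d"
  shows "transition_deriv d c p (Jop v) = Jop (transition_deriv d c p v)"
proof -
  have "holomorphic_map_on (chart_image c (fst d)) (snd d \<circ> param c)"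
    using assms atlas unfolding complex_atlas_def by blast
  moreover have "snd c p \<in> chart_image c (fst d)" using assms by simp
  ultimately show ?thesis unfolding holomorphic_map_on_def by blast
qed

lemma transition_deriv_id:
  assumes "c \<in> A" "p \<in> fst c" shows "transition_deriv c c p = id"
proof (rule dd_eqI)
  show "((snd c \<circ> param c) has_derivative id) (at (snd c p))"
    by (rule has_derivative_transform_within_open[OF has_derivative_id open_image[OF assms(1)]])
      (use assms in auto)
qed

lemma transition_deriv_chain:
  assumes "c \<in> A" "d \<in> A" "e \<in> A" "p \<in> fst c" "p \<in> fst d" "p \<in> fst e"
  shows "transition_deriv e d p (transition_deriv d c p v) = transition_deriv e c p v"
proof -
  have "((snd e \<circ> param d) has_derivative transition_deriv e d p) (at ((snd d \<circ> param c) (snd c p)))"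
    using transition_has_derivative[OF assms(2,3,5,6)] assms by simp
  from diff_chain_at[OF transition_has_derivative[OF assms(1,2,4,5)] this]
  have "((snd e \<circ> param d) \<circ> (snd d \<circ> param c) has_derivative transition_deriv e d p \<circ> transition_deriv d c p) (at (snd c p))" .
  then have "((snd e \<circ> param c) has_derivative transition_deriv e d p \<circ> transition_deriv d c p) (at (snd c p))"
    by (rule has_derivative_transform_within_open[OF _ open_chart_image[OF assms(1) open_fst[OF assms(2)]]])
      (use assms in \<open>auto dest: chart_imageD\<close>)
  from dd_eqI[OF this] show ?thesis by simp
qed

lemma to_chart_eq: "to_chart A c p = transition_deriv c (chart_at A p) p"
  by (simp add: to_chart_def fun_eq_iff)

lemma from_chart_eq: "from_chart A c p = transition_deriv (chart_at A p) c p"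
  by (simp add: from_chart_def fun_eq_iff)

context
  fixes c p assumes c: "c \<in> A" "p \<in> fst c"
begin

lemma from_to_chart [simp]: "from_chart A c p (to_chart A c p v) = v"
  unfolding to_chart_eq from_chart_eq
  by (subst transition_deriv_chain) (use c chart_at[of p] in \<open>simp_all add: transition_deriv_id\<close>)

lemma to_from_chart [simp]: "to_chart A c p (from_chart A c p v) = v"
  unfolding to_chart_eq from_chart_eq
  by (subst transition_deriv_chain) (use c chart_at[of p] in \<open>simp_all add: transition_deriv_id\<close>)

lemma linear_to_chart: "linear (to_chart A c p)"
  unfolding to_chart_eq by (rule transition_deriv_linear) (use c chart_at[of p] in simp_all)

lemma linear_from_chart: "linear (from_chart A c p)"
  unfolding from_chart_eq by (rule transition_deriv_linear) (use c chart_at[of p] in simp_all)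

lemma to_chart_Jop: "to_chart A c p (Jop v) = Jop (to_chart A c p v)"
  unfolding to_chart_eq by (rule transition_deriv_Jop) (use c chart_at[of p] in simp_all)

lemma from_chart_Jop: "from_chart A c p (Jop v) = Jop (from_chart A c p v)"
  unfolding from_chart_eq by (rule transition_deriv_Jop) (use c chart_at[of p] in simp_all)

end

lemma to_chart_at [simp]: "to_chart A (chart_at A p) p v = v"
  unfolding to_chart_eq by (simp add: transition_deriv_id chart_at)

lemma from_chart_at [simp]: "from_chart A (chart_at A p) p v = v"
  unfolding from_chart_eq by (simp add: transition_deriv_id chart_at)

text \<open>In a second chart \<open>d\<close> the two derivatives through the preferred chart at
  \<open>q\<close> combine, by the chain rule, into the derivative of one transition map. The
  pointwise choice of preferred charts therefore cancels, and the components in \<open>d\<close> are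
  a smooth family of linear maps applied to a smooth map.\<close>

lemma smooth_field_of_chart:
  assumes c: "c \<in> A" and N: "open N" "N \<subseteq> chart_image c UNIV" and h: "smooth_on N h"
  shows "smooth_field A (S \<inter> param c ` N) (\<lambda>q. from_chart A c q (h (snd c q)))"
  unfolding smooth_field_def smooth_rel_def
proof (intro ballI)
  fix d y assume d: "d \<in> A" and y: "y \<in> chart_image d (S \<inter> param c ` N)"
  let ?N = "chart_image d (param c ` N)" and ?M = "N \<inter> chart_image c (fst d)"
  let ?K = "\<lambda>x. dd (snd d \<circ> param c) x (h x)"
  have op: "open ?N" "open ?M"
    using c d N by (auto intro!: open_chart_image open_param_image open_fst)
  have K: "smooth_on ?M ?K"
  proof (rule smooth_on_linear_family[where L = "dd (snd d \<circ> param c)" and h = h, OF op(2)])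
    show "linear (dd (snd d \<circ> param c) x)" if "x \<in> ?M" for x
      by (rule dd_linear, rule smooth_on_differentiable[OF transition_smooth]) (use c d that in auto)
    show "smooth_on ?M (\<lambda>x. dd (snd d \<circ> param c) x a)" for a
      by (rule smooth_on_subset[OF smooth_on_dd[OF transition_smooth]]) (use c d in auto)
    show "smooth_on ?M h" by (rule smooth_on_subset[OF h]) auto
  qed
  have img: "z \<in> chart_image d UNIV" "param d z \<in> fst c" "param d z \<in> fst d" "snd c (param d z) \<in> ?M"
    if zN: "z \<in> ?N" for z
  proof -
    show z: "z \<in> chart_image d UNIV" using zN by (rule chart_imageD)
    obtain x where x: "x \<in> N" "param d z = param c x" using chart_imageD(2)[OF d zN] by blast
    show "param d z \<in> fst c" using x N c by (simp add: subset_iff)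
    show dz: "param d z \<in> fst d" using z d by simp
    have "x \<in> chart_image c (fst d)"
      using in_chart_image_iff[OF c, of x "fst d"] x N dz by auto
    then show "snd c (param d z) \<in> ?M" using x N c by (simp add: subset_iff)
  qed
  have "smooth_on ?N (snd c \<circ> param d)"
    by (rule smooth_on_subset[OF transition_smooth[OF d c]]) (use img d in \<open>auto simp: in_chart_image_iff[OF d, of _ "fst c"]\<close>)
  then have "smooth_on ?N (\<lambda>z. ?K ((snd c \<circ> param d) z))"
    by (intro smooth_on_compose[OF op _ _ K]) (use img in \<open>auto simp: o_def\<close>)
  moreover have "?K ((snd c \<circ> param d) z) =
     ((\<lambda>q. to_chart A d q (from_chart A c q (h (snd c q)))) \<circ> param d) z" if "z \<in> ?N" for z
    using img[OF that] c d chart_at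
    by (simp add: to_chart_eq from_chart_eq transition_deriv_chain)
  ultimately show "\<exists>N' h'. open N' \<and> y \<in> N' \<and> smooth_on N' h' \<and>
     (\<forall>z\<in>N' \<inter> chart_image d (S \<inter> param c ` N). h' z =
        ((\<lambda>q. to_chart A d q (from_chart A c q (h (snd c q)))) \<circ> param d) z)"
    using y op by (intro exI[of _ ?N] exI[of _ "\<lambda>z. ?K ((snd c \<circ> param d) z)"])
      (auto simp: in_chart_image_iff[OF d, of _ "S \<inter> param c ` N"] in_chart_image_iff[OF d, of _ "param c ` N"])
qed

text \<open>Trades smoothness on a subset, which is local extendability, for a map \<open>h\<close>
  on an open set that agrees with the components on \<open>S\<close>. Derivatives along
  \<open>S\<close> are then computed on \<open>h\<close>.\<close>

lemma smooth_field_rep: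
  assumes W: "smooth_field A (S \<inter> U) W" and U: "open U" "p \<in> S \<inter> U" and c: "c \<in> A" "p \<in> fst c"
  obtains N h where "open N" "snd c p \<in> N" "N \<subseteq> chart_image c U" "smooth_on N h"
    "\<And>q. q \<in> S \<Longrightarrow> q \<in> fst c \<Longrightarrow> snd c q \<in> N \<Longrightarrow> h (snd c q) = to_chart A c q (W q)"
proof -
  have "snd c p \<in> chart_image c (S \<inter> U)" using U c by simp
  from bspec[OF bspec[OF W[unfolded smooth_field_def smooth_rel_def] c(1)] this]
  obtain N h where N: "open N" "snd c p \<in> N" "smooth_on N h"
    "\<And>y. y \<in> N \<inter> chart_image c (S \<inter> U) \<Longrightarrow> h y = ((\<lambda>q. to_chart A c q (W q)) \<circ> param c) y"
    by auto
  show thesis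
  proof (rule that[of "N \<inter> chart_image c U" h])
    show "open (N \<inter> chart_image c U)" using N U c by (auto intro: open_chart_image)
    show "smooth_on (N \<inter> chart_image c U) h" by (rule smooth_on_subset[OF N(3)]) auto
    show "h (snd c q) = to_chart A c q (W q)" if "q \<in> S" "q \<in> fst c" "snd c q \<in> N \<inter> chart_image c U" for q
      using N(4)[of "snd c q"] that c by simp
  qed (use N U c in auto)
qed

lemma smooth_fun_rep:
  assumes W: "smooth_fun A (S \<inter> U) F" and U: "open U" "p \<in> S \<inter> U" and c: "c \<in> A" "p \<in> fst c"
  obtains N h where "open N" "snd c p \<in> N" "N \<subseteq> chart_image c U" "smooth_on N h"
    "\<And>q. q \<in> S \<Longrightarrow> q \<in> fst c \<Longrightarrow> snd c q \<in> N \<Longrightarrow> h (snd c q) = F q"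
proof -
  have "snd c p \<in> chart_image c (S \<inter> U)" using U c by simp
  from bspec[OF bspec[OF W[unfolded smooth_fun_def smooth_rel_def] c(1)] this]
  obtain N h where N: "open N" "snd c p \<in> N" "smooth_on N h"
    "\<And>y. y \<in> N \<inter> chart_image c (S \<inter> U) \<Longrightarrow> h y = (F \<circ> param c) y"
    by auto
  show thesis
  proof (rule that[of "N \<inter> chart_image c U" h])
    show "open (N \<inter> chart_image c U)" using N U c by (auto intro: open_chart_image)
    show "smooth_on (N \<inter> chart_image c U) h" by (rule smooth_on_subset[OF N(3)]) auto
    show "h (snd c q) = F q" if "q \<in> S" "q \<in> fst c" "snd c q \<in> N \<inter> chart_image c U" for q
      using N(4)[of "snd c q"] that c by simp
  qed (use N U c in auto)
qed

section \<open>Curves and derivatives along a subset\<close>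

lemma curve_eventually:
  assumes "curve_in A S p v \<gamma>" "open U" "p \<in> U"
  shows "\<forall>\<^sub>F t in nhds 0. \<gamma> t \<in> S \<inter> U \<inter> fst (chart_at A p)"
proof -
  let ?c = "chart_at A p"
  obtain e where e: "e > 0" "\<gamma> ` {-e<..<e} \<subseteq> S \<inter> fst ?c" and d: "((snd ?c \<circ> \<gamma>) has_vector_derivative v) (at 0)"
    and g0: "\<gamma> 0 = p"
    using assms(1) unfolding curve_in_def by auto
  have "isCont (snd ?c \<circ> \<gamma>) 0" using d by (rule has_vector_derivative_continuous)
  then have "filterlim (snd ?c \<circ> \<gamma>) (nhds (snd ?c p)) (at 0)" using g0 by (simp add: isCont_def)
  then have "filterlim (snd ?c \<circ> \<gamma>) (nhds (snd ?c p)) (nhds 0)"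
    using g0 by (simp add: tendsto_nhds_iff)
  moreover have "open (chart_image ?c U)" "snd ?c p \<in> chart_image ?c U"
    using assms chart_at by (auto intro: open_chart_image)
  ultimately have 1: "\<forall>\<^sub>F t in nhds 0. (snd ?c \<circ> \<gamma>) t \<in> chart_image ?c U"
    by (rule topological_tendstoD)
  have 2: "\<forall>\<^sub>F t in nhds 0. t \<in> {-e<..<e}" using e(1) by (intro eventually_nhds_in_open) auto
  show ?thesis using 1 2
  proof eventually_elim
    case (elim t)
    then have "\<gamma> t \<in> S \<inter> fst ?c" using e(2) by blast
    with elim show ?case using chart_at by simp
  qed
qed

lemma curve_start: "curve_in A S p v \<gamma> \<Longrightarrow> p \<in> S" "curve_in A S p v \<gamma> \<Longrightarrow> \<gamma> 0 = p"
  using curve_eventually[of S p v \<gamma> UNIV, THEN eventually_nhds_x_imp_x] by (auto simp: curve_in_def)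

lemma curve_deriv_in_chart:
  assumes "curve_in A S p v \<gamma>" "c \<in> A" "p \<in> fst c"
  shows "((snd c \<circ> \<gamma>) has_vector_derivative to_chart A c p v) (at 0)"
proof -
  let ?c = "chart_at A p"
  have g: "\<gamma> 0 = p" "((snd ?c \<circ> \<gamma>) has_vector_derivative v) (at 0)"
    using assms(1) unfolding curve_in_def by auto
  have "((snd c \<circ> param ?c) has_derivative to_chart A c p) (at ((snd ?c \<circ> \<gamma>) 0))"
    unfolding to_chart_eq using transition_has_derivative[OF _ assms(2) _ assms(3)] chart_at g by simp
  from has_vector_derivative_compose_derivative[OF g(2) this]
  have "(((snd c \<circ> param ?c) \<circ> (snd ?c \<circ> \<gamma>)) has_vector_derivative to_chart A c p v) (at 0)" .
  moreover have "\<forall>\<^sub>F t in at 0. ((snd c \<circ> param ?c) \<circ> (snd ?c \<circ> \<gamma>)) t = (snd c \<circ> \<gamma>) t"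
    using curve_eventually[OF assms(1) open_UNIV] chart_at
    by (auto simp: eventually_at_filter elim!: eventually_mono)
  ultimately show ?thesis
    unfolding has_vector_derivative_def
    by (rule has_derivative_transform_eventually) (use chart_at g in auto)
qed

text \<open>\<open>F\<close> may be meaningful on \<open>S\<close> alone; along a curve in
  \<open>S\<close> it coincides near 0 with the composite of \<open>h\<close> and the chart, which
  has an ordinary derivative.\<close>

lemma curve_deriv_fun:
  assumes "curve_in A S p v \<gamma>" "c \<in> A" "p \<in> fst c" "open N" "snd c p \<in> N"
    and "h differentiable (at (snd c p))"
    and eq: "\<And>q. q \<in> S \<Longrightarrow> q \<in> fst c \<Longrightarrow> snd c q \<in> N \<Longrightarrow> h (snd c q) = F q"
  shows "((F \<circ> \<gamma>) has_vector_derivative dd h (snd c p) (to_chart A c p v)) (at 0)"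
proof -
  let ?U = "fst c \<inter> snd c -` N"
  have U: "open ?U"
  proof -
    have "continuous_on (fst c) (snd c)" using homeo[OF assms(2)] homeomorphism_def by blast
    then show ?thesis using continuous_open_preimage open_fst assms by metis
  qed
  have g: "\<gamma> 0 = p" "p \<in> S" using curve_start[OF assms(1)] by auto
  have "(h has_derivative dd h (snd c p)) (at ((snd c \<circ> \<gamma>) 0))"
    using dd_works[OF assms(6)] g by simp
  from has_vector_derivative_compose_derivative[OF curve_deriv_in_chart[OF assms(1-3)] this]
  have "((h \<circ> (snd c \<circ> \<gamma>)) has_vector_derivative dd h (snd c p) (to_chart A c p v)) (at 0)" .
  moreover have "\<forall>\<^sub>F t in at 0. (h \<circ> (snd c \<circ> \<gamma>)) t = (F \<circ> \<gamma>) t"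
    using curve_eventually[OF assms(1) U] assms(3,5) eq
    by (auto simp: eventually_at_filter elim!: eventually_mono)
  ultimately show ?thesis
    unfolding has_vector_derivative_def
    by (rule has_derivative_transform_eventually) (use assms g eq in auto)
qed

text \<open>The existence of one curve in direction \<open>v\<close> makes the description in
  \<open>deriv_along\<close> unique; with no curve every value would satisfy it.\<close>

lemma deriv_along_eq_curve:
  assumes "curve_in A S p v \<gamma>0" "\<And>\<gamma>. curve_in A S p v \<gamma> \<Longrightarrow> ((F \<circ> \<gamma>) has_vector_derivative d) (at 0)"
  shows "deriv_along A S F p v = d"
  unfolding deriv_along_def
proof (rule the_equality)
  fix d' assume "\<forall>\<gamma>. curve_in A S p v \<gamma> \<longrightarrow> ((F \<circ> \<gamma>) has_vector_derivative d') (at 0)"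
  then show "d' = d"
    using assms(1) assms(2)[OF assms(1)] vector_derivative_unique_at by blast
qed (use assms in blast)

lemma deriv_along_eq:
  assumes "v \<in> tangent_space A S p" "c \<in> A" "p \<in> fst c" "open N" "snd c p \<in> N"
    and "h differentiable (at (snd c p))"
    and "\<And>q. q \<in> S \<Longrightarrow> q \<in> fst c \<Longrightarrow> snd c q \<in> N \<Longrightarrow> h (snd c q) = F q"
  shows "deriv_along A S F p v = dd h (snd c p) (to_chart A c p v)"
proof -
  obtain \<gamma> where "curve_in A S p v \<gamma>" using assms(1) by (auto simp: tangent_space_def)
  then show ?thesis
    by (rule deriv_along_eq_curve) (rule curve_deriv_fun[OF _ assms(2-)])
qed

text \<open>Along a curve through \<open>p\<close> the two functions agree near 0, so the
  descriptions inside \<open>deriv_along\<close> are the same predicate.\<close>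

lemma deriv_along_cong:
  assumes "open U" "p \<in> U" "\<And>q. q \<in> S \<inter> U \<Longrightarrow> F q = G q"
  shows "deriv_along A S F p v = deriv_along A S G p v"
proof -
  have "((F \<circ> \<gamma>) has_vector_derivative d) (at 0) \<longleftrightarrow> ((G \<circ> \<gamma>) has_vector_derivative d) (at 0)"
    if "curve_in A S p v \<gamma>" for \<gamma> d
  proof -
    have "\<forall>\<^sub>F t in nhds 0. (F \<circ> \<gamma>) t = (G \<circ> \<gamma>) t"
      using curve_eventually[OF that assms(1,2)] assms(3) by (auto elim!: eventually_mono)
    then show ?thesis
      by (intro has_vector_derivative_cong_ev) (auto elim: eventually_mono dest: eventually_nhds_x_imp_x)
  qed
  then show ?thesis unfolding deriv_along_def by (auto intro!: arg_cong[of _ _ The])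
qed

end

section \<open>Hermitian linear algebra and the Christoffel symbols of a Kaehler metric\<close>

lemma complex_scale_eq: "z *s (v::complex^'n::finite) = Re z *\<^sub>R v + Im z *\<^sub>R Jop v"
  by (simp add: vec_eq_iff Jop_def complex_eq_iff)

locale hermitian_form =
  fixes om :: "complex^'n::finite \<Rightarrow> complex^'n \<Rightarrow> real"
  assumes bil: "bilinear om"
    and skew: "om w v = - om v w"
    and om_Jop: "om (Jop v) (Jop w) = om v w"
    and pos: "v \<noteq> 0 \<Longrightarrow> om v (Jop v) > 0"
begin

text \<open>The Hermitian form whose real part is the metric, complex linear in its second argument
  and conjugate symmetric. With a frame vector as first argument it is the corresponding covector of
  the coframe.\<close>

definition H :: "complex^'n \<Rightarrow> complex^'n \<Rightarrow> complex" where
  "H v w = Complex (om v (Jop w)) (om v w)"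

lemmas om_simps = bilinear_ladd[OF bil] bilinear_radd[OF bil] bilinear_lmul[OF bil] bilinear_rmul[OF bil]
  bilinear_lneg[OF bil] bilinear_rneg[OF bil] bilinear_lzero[OF bil] bilinear_rzero[OF bil]
  bilinear_lsub[OF bil] bilinear_rsub[OF bil]

lemmas J_simps = linear_add[OF linear_Jop] linear_scale[OF linear_Jop] linear_neg[OF linear_Jop]
  linear_0[OF linear_Jop] linear_diff[OF linear_Jop] linear_sum[OF linear_Jop]

lemma om_Jop_left: "om (Jop v) w = - om v (Jop w)"
  using om_Jop[of "Jop v" w] by (simp add: om_simps)

lemma om_self [simp]: "om v v = 0"
  using skew[of v v] by simp

lemma g_sym: "om v (Jop w) = om w (Jop v)"
  using om_Jop_left[of v w] skew[of w "Jop v"] by simp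

lemma H_add: "H v (w + w') = H v w + H v w'"
  by (simp add: H_def om_simps J_simps complex_eq_iff)

lemma H_scaleC: "H v (z *s w) = z * H v w"
  by (simp add: H_def om_simps J_simps complex_eq_iff complex_scale_eq algebra_simps)

lemma H_zero [simp]: "H v 0 = 0"
  by (simp add: H_def om_simps J_simps complex_eq_iff)

lemma H_sum: "H v (\<Sum>i\<in>I. f i) = (\<Sum>i\<in>I. H v (f i))"
  by (induction I rule: infinite_finite_induct) (simp_all add: H_add)

lemma H_scaleR: "H v (r *\<^sub>R w) = of_real r * H v w"
  by (simp add: H_def om_simps J_simps complex_eq_iff)

lemma H_diff: "H v (w - w') = H v w - H v w'"
  by (simp add: H_def om_simps J_simps complex_eq_iff)

lemma H_cnj: "cnj (H v w) = H w v"
  using g_sym[of v w] skew[of v w] by (simp add: H_def complex_eq_iff)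

lemma H_pos: "v \<noteq> 0 \<Longrightarrow> Re (H v v) > 0"
  using pos by (simp add: H_def)

lemma H_self: "H v v = of_real (Re (H v v))"
  by (simp add: H_def complex_eq_iff)

lemma H_eq_0_iff [simp]: "H v v = 0 \<longleftrightarrow> v = 0"
  using H_pos[of v] by (cases "v = 0") auto

definition unitary :: "(nat \<Rightarrow> complex^'n) \<Rightarrow> nat \<Rightarrow> bool" where
  "unitary e m \<longleftrightarrow> (\<forall>i<m. \<forall>j<m. H (e i) (e j) = (if i = j then 1 else 0))"

lemma unitaryD: "unitary e m \<Longrightarrow> i < m \<Longrightarrow> j < m \<Longrightarrow> H (e i) (e j) = (if i = j then 1 else 0)"
  by (simp add: unitary_def)

lemma H_frame_sum: "unitary e m \<Longrightarrow> j < m \<Longrightarrow> H (e j) (\<Sum>i<m. z i *s e i) = z j"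
  by (simp add: H_sum H_scaleC unitaryD if_distrib[of "\<lambda>x. _ * x"] cong: if_cong)

lemma orthogonal_family_card:
  assumes "\<And>i j. i < m \<Longrightarrow> j < m \<Longrightarrow> i \<noteq> j \<Longrightarrow> H (e i) (e j) = 0" "\<And>i. i < m \<Longrightarrow> e i \<noteq> 0"
  shows "m \<le> CARD('n)"
proof -
  have inj: "inj_on e {..<m}"
    using assms by (intro inj_onI) (metis H_eq_0_iff lessThan_iff)
  have "vec.independent (e ` {..<m})"
  proof (rule vec.independent_if_scalars_zero)
    fix f x assume s: "(\<Sum>x\<in>e ` {..<m}. f x *s x) = 0" and "x \<in> e ` {..<m}"
    then obtain j where j: "j < m" "x = e j" by auto
    have "0 = H (e j) (\<Sum>x\<in>e ` {..<m}. f x *s x)" using s by simp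
    also have "\<dots> = (\<Sum>i<m. f (e i) * H (e j) (e i))"
      by (simp add: H_sum H_scaleC sum.reindex[OF inj])
    also have "\<dots> = (\<Sum>i<m. if i = j then f (e j) * H (e j) (e j) else 0)"
      by (rule sum.cong) (use assms(1) j in auto)
    also have "\<dots> = f x * H x x" using j by simp
    finally show "f x = 0" using assms(2) j by simp
  qed simp
  then have "card (e ` {..<m}) \<le> vec.dim (UNIV :: (complex^'n) set)"
    by (intro vec.independent_card_le_dim) auto
  then show ?thesis unfolding card_image[OF inj] vec_dim_card by simp
qed

text \<open>A nonzero \<open>w\<close> would extend the frame to more pairwise orthogonal nonzero
  vectors than the complex dimension allows.\<close>

lemma unitary_orthogonal_zero:
  assumes "unitary e CARD('n)" "\<And>i. i < CARD('n) \<Longrightarrow> H (e i) w = 0"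
  shows "w = 0"
proof (rule ccontr)
  assume "w \<noteq> 0"
  let ?f = "\<lambda>i. if i < CARD('n) then e i else w"
  have "H w (e i) = 0" if "i < CARD('n)" for i
    using assms(2)[OF that] H_cnj[of "e i" w] by simp
  moreover have "e i \<noteq> 0" if "i < CARD('n)" for i
    using unitaryD[OF assms(1) that that] by auto
  ultimately have "Suc CARD('n) \<le> CARD('n)"
    using assms \<open>w \<noteq> 0\<close> unitaryD[OF assms(1)]
    by (intro orthogonal_family_card[of _ ?f]) (auto simp: less_Suc_eq)
  then show False by simp
qed

lemma unitary_expand:
  assumes "unitary e CARD('n)"
  shows "w = (\<Sum>i<CARD('n). H (e i) w *s e i)"
proof -
  have "w - (\<Sum>i<CARD('n). H (e i) w *s e i) = 0"
    by (rule unitary_orthogonal_zero[OF assms]) (simp add: H_diff H_frame_sum[OF assms])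
  then show ?thesis by simp
qed

lemma real_orthonormal_independent:
  fixes b :: "nat \<Rightarrow> complex^'n"
  assumes "\<And>i j. i < m \<Longrightarrow> j < m \<Longrightarrow> om (b i) (Jop (b j)) = (if i = j then 1 else 0)"
  shows "inj_on b {..<m}" "independent (b ` {..<m})"
proof -
  show inj: "inj_on b {..<m}"
    using assms by (intro inj_onI) (metis lessThan_iff zero_neq_one)
  show "independent (b ` {..<m})"
  proof (rule independent_if_scalars_zero)
    fix f x assume s: "(\<Sum>x\<in>b ` {..<m}. f x *\<^sub>R x) = 0" and "x \<in> b ` {..<m}"
    then obtain j where j: "j < m" "x = b j" by auto
    have "0 = H (b j) (\<Sum>x\<in>b ` {..<m}. f x *\<^sub>R x)" using s by simp
    also have "\<dots> = (\<Sum>i<m. of_real (f (b i)) * H (b j) (b i))"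
      by (simp add: H_sum H_scaleR sum.reindex[OF inj])
    finally have "0 = Re (\<Sum>i<m. of_real (f (b i)) * H (b j) (b i))" by simp
    also have "\<dots> = (\<Sum>i<m. if i = j then f (b j) else 0)"
      unfolding Re_sum by (rule sum.cong) (use assms j in \<open>auto simp: H_def\<close>)
    also have "\<dots> = f x" using j by simp
    finally show "f x = 0" by simp
  qed simp
qed

lemma real_orthonormal_expand:
  fixes b :: "nat \<Rightarrow> complex^'n"
  assumes "\<And>i j. i < m \<Longrightarrow> j < m \<Longrightarrow> om (b i) (Jop (b j)) = (if i = j then 1 else 0)"
    and "v \<in> span (b ` {..<m})"
  shows "v = (\<Sum>i<m. om (b i) (Jop v) *\<^sub>R b i)"
proof -
  have "\<exists>u. v = (\<Sum>x\<in>b ` {..<m}. u x *\<^sub>R x)"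
    using assms(2) unfolding span_finite[OF finite_imageI[OF finite_lessThan]] by blast
  then obtain u where "v = (\<Sum>x\<in>b ` {..<m}. u x *\<^sub>R x)" by blast
  then have v: "v = (\<Sum>i<m. u (b i) *\<^sub>R b i)"
    using real_orthonormal_independent(1)[OF assms(1)] by (simp add: sum.reindex)
  have "om (b j) (Jop v) = u (b j)" if "j < m" for j
  proof -
    have "om (b j) (Jop v) = Re (H (b j) v)" by (simp add: H_def)
    also have "\<dots> = (\<Sum>i<m. u (b i) * om (b j) (Jop (b i)))"
      by (subst v) (simp add: H_sum H_scaleR Re_sum, simp add: H_def)
    also have "\<dots> = (\<Sum>i<m. if i = j then u (b j) else 0)"
      by (rule sum.cong) (use assms(1) that in auto)
    finally show ?thesis using that by simp
  qed
  then show ?thesis by (subst v) simp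
qed

lemma g_nondegenerate: "(\<And>z. om X (Jop z) = om Y (Jop z)) \<Longrightarrow> X = Y"
  using pos[of "X - Y"] by (auto simp: om_simps J_simps)

text \<open>Gives meaning to the definite description in the Koszul formula.\<close>

lemma riesz:
  assumes "linear (\<phi> :: complex^'n \<Rightarrow> real)"
  shows "\<exists>!X. \<forall>z. om X (Jop z) = \<phi> z"
proof -
  \<comment> \<open>The metric written through the Euclidean inner product; nondegeneracy makes this
    map injective, hence surjective in finite dimension.\<close>
  define T where "T X = (\<Sum>b\<in>Basis. om X (Jop b) *\<^sub>R b)" for X
  have T: "z \<bullet> T X = om X (Jop z)" for z X
  proof -
    have "linear (\<lambda>z. om X (Jop z))"
      by (rule linearI) (simp_all add: om_simps J_simps)
    from linear_basis_expand[OF this, of z] show ?thesis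
      by (simp add: T_def inner_sum_right mult.commute)
  qed
  have lin: "linear T"
    by (rule linearI) (simp_all add: T_def om_simps scaleR_add_left sum.distrib scaleR_sum_right)
  have "inj T"
  proof (rule injI)
    fix X Y assume "T X = T Y"
    then show "X = Y" using T by (metis g_nondegenerate)
  qed
  then have "surj T" using lin linear_injective_imp_surjective by blast
  then obtain X where X: "T X = (\<Sum>b\<in>Basis. \<phi> b *\<^sub>R b)" by (metis surjD)
  have "om X (Jop z) = \<phi> z" for z
    using T[of z X] linear_basis_expand[OF assms, of z] by (simp add: X inner_sum_right mult.commute)
  then show ?thesis using g_nondegenerate by (metis)
qed

end

text \<open>\<open>D u\<close> stands for the derivative in direction \<open>u\<close> of the components of the Kaehler form in a
  chart.\<close>

locale kaehler_jet = hermitian_form om for om :: "complex^'n::finite \<Rightarrow> complex^'n \<Rightarrow> real" +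
  fixes D :: "complex^'n \<Rightarrow> complex^'n \<Rightarrow> complex^'n \<Rightarrow> real"
  assumes D_lin: "linear (\<lambda>u. D u v w)"
    and D_bil: "bilinear (D u)"
    and D_skew: "D u w v = - D u v w"
    and D_Jop: "D u (Jop v) (Jop w) = D u v w"
    and closed: "D u v w + D v w u + D w u v = 0"
begin

text \<open>The Koszul formula at one point: it involves only the form and its first derivative, so
  the properties of the connection become linear algebra.\<close>

definition Gam :: "complex^'n \<Rightarrow> complex^'n \<Rightarrow> complex^'n" where
  "Gam v w = (THE \<Gamma>. \<forall>z. om \<Gamma> (Jop z) = (D v w (Jop z) + D w v (Jop z) - D z v (Jop w)) / 2)"

lemmas D_simps = bilinear_ladd[OF D_bil] bilinear_radd[OF D_bil] bilinear_lmul[OF D_bil]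
  bilinear_rmul[OF D_bil] bilinear_rneg[OF D_bil] bilinear_lneg[OF D_bil]
  linear_add[OF D_lin] linear_scale[OF D_lin] linear_neg[OF D_lin]

lemma Gam: "om (Gam v w) (Jop z) = (D v w (Jop z) + D w v (Jop z) - D z v (Jop w)) / 2"
proof -
  have "linear (\<lambda>z. (D v w (Jop z) + D w v (Jop z) - D z v (Jop w)) / 2)"
    by (rule linearI) (simp_all add: D_simps J_simps algebra_simps add_divide_distrib diff_divide_distrib)
  from theI'[OF riesz[OF this]] show ?thesis unfolding Gam_def by blast
qed

lemma Dg_sym: "D u v (Jop w) = D u w (Jop v)"
  using D_Jop[of u v "Jop w"] D_skew[of u "Jop v" w] by (simp add: D_simps)

lemma Gam_sym: "Gam v w = Gam w v"
  by (rule g_nondegenerate) (simp add: Gam Dg_sym[of _ v w])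

text \<open>In the sum of the Koszul formulas for \<open>Gam v w\<close> against \<open>z\<close>
  and for \<open>Gam v z\<close> against \<open>w\<close>, the derivatives in the directions
  \<open>w\<close> and \<open>z\<close> cancel; the two that remain are equal by
  \<open>Dg_sym\<close>.\<close>

lemma Gam_compatible: "D v w (Jop z) = om (Gam v w) (Jop z) + om w (Jop (Gam v z))"
  using Gam[of v w z] Gam[of v z w] Dg_sym[of v z w] Dg_sym[of w v z] Dg_sym[of z v w] g_sym[of w "Gam v z"]
  by simp

text \<open>The Kaehler condition enters here: two instances of the cyclic identity
  \<open>closed\<close>, together with invariance of \<open>D\<close> under \<open>Jop\<close>,
  match the two Koszul formulas. Consequently the Levi-Civita connection commutes with J.\<close>

lemma Gam_Jop: "Gam v (Jop w) = Jop (Gam v w)"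
proof (rule g_nondegenerate)
  fix z
  have "om (Jop (Gam v w)) (Jop z) = om (Gam v w) (Jop (- Jop z))"
    by (simp add: om_Jop J_simps)
  then show "om (Gam v (Jop w)) (Jop z) = om (Jop (Gam v w)) (Jop z)"
    using closed[of "Jop w" v "Jop z"] closed[of v w z] D_Jop[of v w z] D_Jop[of v z w]
      D_skew[of "Jop z" "Jop w" v] D_skew[of w z v] D_skew[of v w z]
    by (simp only: Gam) (simp add: D_simps D_Jop J_simps)
qed

lemma Gam_linear_right: "linear (Gam v)"
proof (rule linearI)
  show "Gam v (a + b) = Gam v a + Gam v b" for a b
    by (rule g_nondegenerate) (simp add: om_simps Gam D_simps J_simps field_simps)
  show "Gam v (r *\<^sub>R a) = r *\<^sub>R Gam v a" for r a
    by (rule g_nondegenerate) (simp add: om_simps Gam D_simps J_simps field_simps)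
qed

lemma Gam_linear_left: "linear (\<lambda>v. Gam v w)"
  using Gam_linear_right[of w] by (simp add: Gam_sym[of _ w])

lemma Gam_scaleC: "Gam v (z *s w) = z *s Gam v w"
  using linear_add[OF Gam_linear_right] linear_scale[OF Gam_linear_right]
  by (simp add: complex_scale_eq Gam_Jop)

end

section \<open>The Levi-Civita connection along a submanifold\<close>

lemma smooth_rel_cong: "(\<And>x. x \<in> S \<Longrightarrow> f x = g x) \<Longrightarrow> smooth_rel S f \<Longrightarrow> smooth_rel S g"
  unfolding smooth_rel_def by (metis (no_types, lifting) Int_iff)

lemma smooth_rel_linear:
  fixes L :: "'a::euclidean_space \<Rightarrow> 'b::real_normed_vector"
  assumes "smooth_rel S f" "linear L" shows "smooth_rel S (\<lambda>x. L (f x))"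
  unfolding smooth_rel_def
proof
  fix x assume "x \<in> S"
  then obtain N h where "open N" "x \<in> N" "smooth_on N h" "\<forall>y\<in>N \<inter> S. h y = f y"
    using assms(1) unfolding smooth_rel_def by blast
  then show "\<exists>N h. open N \<and> x \<in> N \<and> smooth_on N h \<and> (\<forall>y\<in>N \<inter> S. h y = L (f y))"
    using smooth_on_linear[OF assms(2)] by (intro exI[of _ N] exI[of _ "\<lambda>x. L (h x)"]) auto
qed

lemma smooth_rel_add:
  assumes "smooth_rel S f" "smooth_rel S g" shows "smooth_rel S (\<lambda>x. f x + g x)"
  unfolding smooth_rel_def
proof
  fix x assume x: "x \<in> S"
  obtain N h where N: "open N" "x \<in> N" "smooth_on N h" "\<forall>y\<in>N \<inter> S. h y = f y"
    using assms(1) x unfolding smooth_rel_def by blast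
  obtain M k where M: "open M" "x \<in> M" "smooth_on M k" "\<forall>y\<in>M \<inter> S. k y = g y"
    using assms(2) x unfolding smooth_rel_def by blast
  have "smooth_on (N \<inter> M) (\<lambda>x. h x + k x)"
    by (intro smooth_on_add smooth_on_subset[OF N(3)] smooth_on_subset[OF M(3)]) (use N M in auto)
  then show "\<exists>N h. open N \<and> x \<in> N \<and> smooth_on N h \<and> (\<forall>y\<in>N \<inter> S. h y = f y + g y)"
    using N M by (intro exI[of _ "N \<inter> M"] exI[of _ "\<lambda>x. h x + k x"]) auto
qed

lemma (in complex_manifold) smooth_field_scaleC:
  assumes "smooth_field A S V" shows "smooth_field A S (\<lambda>q. z *s V q)"
  unfolding smooth_field_def
proof
  fix c assume c: "c \<in> A"
  have lin: "linear (\<lambda>v::complex^'b. z *s v)"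
    by (rule linearI) (simp_all add: vector_add_ldistrib vec_eq_iff)
  have "smooth_rel (chart_image c S) (\<lambda>x. z *s ((\<lambda>q. to_chart A c q (V q)) \<circ> param c) x)"
    by (rule smooth_rel_linear[OF _ lin]) (use assms c in \<open>simp add: smooth_field_def o_def\<close>)
  then show "smooth_rel (chart_image c S) ((\<lambda>q. to_chart A c q (z *s V q)) \<circ> param c)"
  proof (rule smooth_rel_cong[rotated])
    fix x assume "x \<in> chart_image c S"
    then have "param c x \<in> fst c" using c chart_imageD(1)[of x c S] by simp
    then show "z *s ((\<lambda>q. to_chart A c q (V q)) \<circ> param c) x = ((\<lambda>q. to_chart A c q (z *s V q)) \<circ> param c) x"
      using c by (simp add: complex_scale_eq to_chart_Jop linear_add[OF linear_to_chart] linear_scale[OF linear_to_chart])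
  qed
qed

lemma (in complex_manifold) smooth_field_add:
  assumes "smooth_field A S V" "smooth_field A S W" shows "smooth_field A S (\<lambda>q. V q + W q)"
  unfolding smooth_field_def
proof
  fix c assume c: "c \<in> A"
  have "smooth_rel (chart_image c S) (\<lambda>x. ((\<lambda>q. to_chart A c q (V q)) \<circ> param c) x + ((\<lambda>q. to_chart A c q (W q)) \<circ> param c) x)"
    by (rule smooth_rel_add) (use assms c in \<open>simp_all add: smooth_field_def o_def\<close>)
  then show "smooth_rel (chart_image c S) ((\<lambda>q. to_chart A c q (V q + W q)) \<circ> param c)"
  proof (rule smooth_rel_cong[rotated])
    fix x assume "x \<in> chart_image c S"
    then have "param c x \<in> fst c" using c chart_imageD(1)[of x c S] by simp
    then show "((\<lambda>q. to_chart A c q (V q)) \<circ> param c) x + ((\<lambda>q. to_chart A c q (W q)) \<circ> param c) x = ((\<lambda>q. to_chart A c q (V q + W q)) \<circ> param c) x"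
      using c by (simp add: linear_add[OF linear_to_chart])
  qed
qed

lemma (in complex_manifold) smooth_field_zero: "smooth_field A S (\<lambda>q. 0)"
  unfolding smooth_field_def
proof
  fix c assume c: "c \<in> A"
  have "smooth_rel (chart_image c S) (\<lambda>x. 0 :: complex^'b)"
    unfolding smooth_rel_def using smooth_on_const by blast
  then show "smooth_rel (chart_image c S) ((\<lambda>q. to_chart A c q 0) \<circ> param c)"
  proof (rule smooth_rel_cong[rotated])
    fix x assume "x \<in> chart_image c S"
    then have "param c x \<in> fst c" using c chart_imageD(1)[of x c S] by simp
    then show "0 = ((\<lambda>q. to_chart A c q 0) \<circ> param c) x"
      using c by (simp add: linear_0[OF linear_to_chart])
  qed
qed

lemma (in complex_manifold) smooth_field_sum:
  "(\<And>i. i \<in> I \<Longrightarrow> smooth_field A S (V i)) \<Longrightarrow> smooth_field A S (\<lambda>q. \<Sum>i\<in>I. V i q)"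
  by (induction I rule: infinite_finite_induct) (simp_all add: smooth_field_zero smooth_field_add)

locale kaehler_manifold = complex_manifold A
  for A :: "('x::topological_space, 'n::finite) chart set" +
  fixes \<omega> :: "'x \<Rightarrow> complex^'n \<Rightarrow> complex^'n \<Rightarrow> real"
  assumes kaehler: "kaehler A \<omega>"
begin

lemma hermitian: "hermitian_form (\<omega> p)"
  using kaehler unfolding kaehler_def hermitian_form_def by blast

sublocale om: hermitian_form "\<omega> p" for p
  by (rule hermitian)

lemma form_smooth:
  assumes "c \<in> A" shows "smooth_on (chart_image c UNIV) (\<lambda>x. form_in_chart A \<omega> c x v w)"
  using kaehler assms unfolding kaehler_def by blast

lemma hermitian_chart:
  assumes "c \<in> A" "x \<in> chart_image c UNIV" shows "hermitian_form (form_in_chart A \<omega> c x)"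
proof
  have q: "param c x \<in> fst c" using assms by simp
  note lin = linear_from_chart[OF assms(1) q]
  show "bilinear (form_in_chart A \<omega> c x)"
    unfolding bilinear_def
    by (auto intro!: linearI simp: form_in_chart_def linear_add[OF lin] linear_scale[OF lin] om.om_simps)
  show "form_in_chart A \<omega> c x w v = - form_in_chart A \<omega> c x v w" for v w
    unfolding form_in_chart_def by (rule om.skew)
  show "form_in_chart A \<omega> c x (Jop v) (Jop w) = form_in_chart A \<omega> c x v w" for v w
    unfolding form_in_chart_def using assms(1) q by (simp add: from_chart_Jop om.om_Jop)
  show "form_in_chart A \<omega> c x v (Jop v) > 0" if "v \<noteq> 0" for v
  proof -
    have "from_chart A c (param c x) v \<noteq> 0"
      using that to_from_chart[OF assms(1) q, of v] linear_0[OF linear_to_chart[OF assms(1) q]] by auto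
    then show ?thesis unfolding form_in_chart_def using assms(1) q by (simp add: from_chart_Jop om.pos)
  qed
qed

lemma form_smooth_fields:
  assumes c: "c \<in> A" and N: "open N" "N \<subseteq> chart_image c UNIV" and "smooth_on N h" "smooth_on N k"
  shows "smooth_on N (\<lambda>x. form_in_chart A \<omega> c x (h x) (k x))"
proof (rule smooth_on_linear_family[where L = "\<lambda>x u. form_in_chart A \<omega> c x u (k x)", OF N(1)])
  have bil: "bilinear (form_in_chart A \<omega> c x)" if "x \<in> N" for x
    using hermitian_form.bil[OF hermitian_chart] c N that by blast
  then show "linear (\<lambda>u. form_in_chart A \<omega> c x u (k x))" if "x \<in> N" for x
    using that by (simp add: bilinear_def)
  show "smooth_on N (\<lambda>x. form_in_chart A \<omega> c x a (k x))" for a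
    by (rule smooth_on_linear_family[where L = "\<lambda>x. form_in_chart A \<omega> c x a", OF N(1)])
      (use bil assms smooth_on_subset[OF form_smooth[OF c]] in \<open>auto simp: bilinear_def\<close>)
qed fact

definition form_deriv where
  "form_deriv c x u v w = dd (\<lambda>y. form_in_chart A \<omega> c y v w) x u"

lemma form_has_derivative:
  assumes "c \<in> A" "x \<in> chart_image c UNIV"
  shows "((\<lambda>y. form_in_chart A \<omega> c y v w) has_derivative (\<lambda>u. form_deriv c x u v w)) (at x)"
  unfolding form_deriv_def by (rule smooth_on_has_derivative[OF form_smooth]) fact+

text \<open>Every identity satisfied by the form at all points of the chart passes to its derivative
  by uniqueness; \<open>F\<close> is the other side of such an identity.\<close>

lemma form_deriv_unique:
  assumes c: "c \<in> A" "x \<in> chart_image c UNIV"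
    and "\<And>y. y \<in> chart_image c UNIV \<Longrightarrow> F y = form_in_chart A \<omega> c y v w" "(F has_derivative F') (at x)"
  shows "form_deriv c x u v w = F' u"
proof -
  have "((\<lambda>y. form_in_chart A \<omega> c y v w) has_derivative F') (at x)"
    by (rule has_derivative_transform_within_open[OF assms(4) open_image[OF c(1)] c(2)]) (simp add: assms(3))
  then show ?thesis using form_has_derivative[OF c] has_derivative_unique by metis
qed

lemma jet:
  assumes c: "c \<in> A" "x \<in> chart_image c UNIV"
  shows "kaehler_jet (form_in_chart A \<omega> c x) (form_deriv c x)"
proof -
  note u = form_deriv_unique[OF c] and d = form_has_derivative[OF c]
  interpret hermitian_form "form_in_chart A \<omega> c x" by (rule hermitian_chart[OF c])
  show ?thesis
  proof (intro kaehler_jet.intro kaehler_jet_axioms.intro hermitian_form_axioms)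
    show "linear (\<lambda>u. form_deriv c x u v w)" for v w
      by (rule has_derivative_linear[OF d])
    show "bilinear (form_deriv c x u)" for u
      unfolding bilinear_def
    proof (intro allI conjI linearI)
      fix v w w' r
      note b = hermitian_form.om_simps[OF hermitian_chart[OF c(1)]]
      show "form_deriv c x u v (w + w') = form_deriv c x u v w + form_deriv c x u v w'"
        by (rule u[OF _ has_derivative_add[OF d d]]) (simp add: b)
      show "form_deriv c x u (w + w') v = form_deriv c x u w v + form_deriv c x u w' v"
        by (rule u[OF _ has_derivative_add[OF d d]]) (simp add: b)
      show "form_deriv c x u v (r *\<^sub>R w) = r *\<^sub>R form_deriv c x u v w"
        by (rule u[OF _ has_derivative_scaleR_right[OF d]]) (simp add: b)
      show "form_deriv c x u (r *\<^sub>R w) v = r *\<^sub>R form_deriv c x u w v"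
        by (rule u[OF _ has_derivative_scaleR_right[OF d]]) (simp add: b)
    qed
    show "form_deriv c x u w v = - form_deriv c x u v w" for u v w
      by (rule u[OF _ has_derivative_minus[OF d]]) (rule hermitian_form.skew[OF hermitian_chart[OF c(1)], symmetric])
    show "form_deriv c x u (Jop v) (Jop w) = form_deriv c x u v w" for u v w
      by (rule u[OF _ d]) (rule hermitian_form.om_Jop[OF hermitian_chart[OF c(1)], symmetric])
    show "form_deriv c x u v w + form_deriv c x v w u + form_deriv c x w u v = 0" for u v w
      using kaehler c unfolding kaehler_def form_deriv_def by blast
  qed
qed

lemma christoffel_eq:
  assumes c: "c \<in> A" "x \<in> chart_image c UNIV"
  shows "christoffel A \<omega> c x v w = kaehler_jet.Gam (form_in_chart A \<omega> c x) (form_deriv c x) v w"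
proof -
  have m: "form_in_chart A (metric \<omega>) c y v w = form_in_chart A \<omega> c y v (Jop w)" if "y \<in> chart_image c UNIV" for y v w
    using c(1) that by (simp add: form_in_chart_def metric_def from_chart_Jop)
  have "dd (\<lambda>y. form_in_chart A (metric \<omega>) c y v w) x = dd (\<lambda>y. form_in_chart A \<omega> c y v (Jop w)) x" for v w
    by (rule dd_cong_open[OF open_image[OF c(1)] c(2)]) (rule m)
  then show ?thesis
    unfolding christoffel_def Let_def kaehler_jet.Gam_def[OF jet[OF c]] by (simp add: m[OF c(2)] form_deriv_def)
qed

section \<open>Covariant derivatives of fields along a subset\<close>

context
  fixes Y U p v
  assumes U: "open U" "p \<in> Y \<inter> U" and v: "v \<in> tangent_space A Y p"
begin

text \<open>Any smooth extension \<open>h\<close> of the components serves, so covariant derivatives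
  along different subsets, in a common tangent direction, agree as soon as the same \<open>h\<close>
  extends both fields and their values at \<open>p\<close> agree.\<close>

lemma nabla_rep:
  assumes "open N" "snd (chart_at A p) p \<in> N" "smooth_on N h"
    "\<And>q. q \<in> Y \<Longrightarrow> q \<in> fst (chart_at A p) \<Longrightarrow> snd (chart_at A p) q \<in> N \<Longrightarrow> h (snd (chart_at A p) q) = to_chart A (chart_at A p) q (V q)"
  shows "nabla A \<omega> Y V p v = dd h (snd (chart_at A p) p) v + christoffel A \<omega> (chart_at A p) (snd (chart_at A p) p) v (V p)"
  unfolding nabla_def Let_def
  using deriv_along_eq[OF v chart_at assms(1,2) smooth_on_differentiable[OF assms(3,2)] assms(4)]
  by simp

lemma nabla_scaleC:
  assumes V: "smooth_field A (Y \<inter> U) V"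
  shows "nabla A \<omega> Y (\<lambda>q. z *s V q) p v = z *s nabla A \<omega> Y V p v"
proof -
  let ?c = "chart_at A p"
  obtain N h where N: "open N" "snd ?c p \<in> N" "N \<subseteq> chart_image ?c U" "smooth_on N h"
    "\<And>q. q \<in> Y \<Longrightarrow> q \<in> fst ?c \<Longrightarrow> snd ?c q \<in> N \<Longrightarrow> h (snd ?c q) = to_chart A ?c q (V q)"
    using smooth_field_rep[OF V U chart_at] by blast
  have lin: "linear (\<lambda>v::complex^'n. z *s v)"
    by (rule linearI) (simp_all add: vector_add_ldistrib vec_eq_iff)
  then have bl: "bounded_linear (\<lambda>v::complex^'n. z *s v)" by (simp add: linear_conv_bounded_linear)
  have "dd (\<lambda>x. z *s h x) (snd ?c p) = (\<lambda>v. z *s dd h (snd ?c p) v)"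
    by (rule dd_eqI, rule bounded_linear.has_derivative[OF bl], rule smooth_on_has_derivative[OF N(4,2)])
  moreover have "nabla A \<omega> Y (\<lambda>q. z *s V q) p v = dd (\<lambda>x. z *s h x) (snd ?c p) v + christoffel A \<omega> ?c (snd ?c p) v (z *s V p)"
    by (rule nabla_rep[OF N(1,2) smooth_on_linear[OF lin N(1,4)]])
      (simp add: N(5) complex_scale_eq to_chart_Jop chart_at linear_add[OF linear_to_chart] linear_scale[OF linear_to_chart])
  ultimately show ?thesis
    using nabla_rep[OF N(1,2,4,5)] chart_at
    by (simp add: christoffel_eq kaehler_jet.Gam_scaleC[OF jet] vector_add_ldistrib)
qed

text \<open>Compatibility is stated for the Kaehler form rather than the metric, which is possible
  since the connection commutes with J. Constant pairings are what frames provide.\<close>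

lemma nabla_compatible:
  assumes V: "smooth_field A (Y \<inter> U) V" and W: "smooth_field A (Y \<inter> U) W"
    and const: "\<And>q. q \<in> Y \<inter> U \<Longrightarrow> \<omega> q (V q) (W q) = r"
  shows "\<omega> p (nabla A \<omega> Y V p v) (W p) + \<omega> p (V p) (nabla A \<omega> Y W p v) = 0"
proof -
  let ?c = "chart_at A p" and ?x = "snd (chart_at A p) p"
  let ?f = "form_in_chart A \<omega> ?c"
  obtain N h where N: "open N" "?x \<in> N" "N \<subseteq> chart_image ?c U" "smooth_on N h"
    "\<And>q. q \<in> Y \<Longrightarrow> q \<in> fst ?c \<Longrightarrow> snd ?c q \<in> N \<Longrightarrow> h (snd ?c q) = to_chart A ?c q (V q)"
    using smooth_field_rep[OF V U chart_at] by blast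
  obtain M k where M: "open M" "?x \<in> M" "M \<subseteq> chart_image ?c U" "smooth_on M k"
    "\<And>q. q \<in> Y \<Longrightarrow> q \<in> fst ?c \<Longrightarrow> snd ?c q \<in> M \<Longrightarrow> k (snd ?c q) = to_chart A ?c q (W q)"
    using smooth_field_rep[OF W U chart_at] by blast
  have x: "?x \<in> chart_image ?c UNIV" using chart_at by simp
  have hx: "h ?x = V p" "k ?x = W p" using N(5)[of p] M(5)[of p] U chart_at N(2) M(2) by auto
  interpret kaehler_jet "?f ?x" "form_deriv ?c ?x" by (rule jet[OF chart_at(1) x])
  have f_p: "?f ?x = \<omega> p" using chart_at by (simp add: fun_eq_iff form_in_chart_def)
  have bil': "bilinear (?f y)" if "y \<in> chart_image ?c UNIV" for y
    using hermitian_form.bil[OF hermitian_chart] chart_at that by blast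
  have 1: "((\<lambda>y. ?f y a (k y)) has_derivative (\<lambda>u. form_deriv ?c ?x u a (k ?x) + ?f ?x a (dd k ?x u))) (at ?x)" for a
    by (rule has_derivative_linear_family[where L = "\<lambda>y. ?f y a" and D = "\<lambda>b u. form_deriv ?c ?x u a b",
          OF open_image[OF chart_at(1)] x])
       (use bil' form_has_derivative[OF chart_at(1) x] smooth_on_has_derivative[OF M(4,2)] in \<open>auto simp: bilinear_def\<close>)
  have 2: "((\<lambda>y. ?f y (h y) (k y)) has_derivative
      (\<lambda>u. (form_deriv ?c ?x u (h ?x) (k ?x) + ?f ?x (h ?x) (dd k ?x u)) + ?f ?x (dd h ?x u) (k ?x))) (at ?x)"
    by (rule has_derivative_linear_family[where L = "\<lambda>y a. ?f y a (k y)" and D = "\<lambda>a u. form_deriv ?c ?x u a (k ?x) + ?f ?x a (dd k ?x u)",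
          OF open_image[OF chart_at(1)] x])
       (use bil' 1 smooth_on_has_derivative[OF N(4,2)] in \<open>auto simp: bilinear_def\<close>)
  have eq: "?f (snd ?c q) (h (snd ?c q)) (k (snd ?c q)) = r"
    if "q \<in> Y" "q \<in> fst ?c" "snd ?c q \<in> N \<inter> M" for q
  proof -
    have "q \<in> U" using that N(3) chart_at(1) by (auto dest!: subsetD)
    then show ?thesis
      using that const[of q] chart_at(1) by (simp add: N(5) M(5) form_in_chart_def)
  qed
  \<comment> \<open>The constant pairing is differentiated in two ways: through the chart
    expression, which need not be constant off \<open>Y\<close>, and directly, which gives
    0.\<close>
  have "deriv_along A Y (\<lambda>q. r) p v = dd (\<lambda>y. ?f y (h y) (k y)) ?x (to_chart A ?c p v)"
    by (rule deriv_along_eq[OF v chart_at, of "N \<inter> M"]) (use N M 2 eq in \<open>auto simp: differentiable_def\<close>)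
  moreover have "deriv_along A Y (\<lambda>q. r) p v = dd (\<lambda>y. r) ?x (to_chart A ?c p v)"
    by (rule deriv_along_eq[OF v chart_at, of "N \<inter> M"]) (use N M in auto)
  ultimately have "(form_deriv ?c ?x v (V p) (W p) + \<omega> p (V p) (dd k ?x v)) + \<omega> p (dd h ?x v) (W p) = 0"
    by (simp add: dd_eqI[OF 2] hx f_p)
  \<comment> \<open>The argument \<open>- Jop (W p)\<close> turns a metric pairing into a pairing by
    the form.\<close>
  moreover have "form_deriv ?c ?x v (V p) (W p) = \<omega> p (Gam v (V p)) (W p) + \<omega> p (V p) (Gam v (W p))"
    using Gam_compatible[of v "V p" "- Jop (W p)"]
    by (simp add: J_simps linear_neg[OF Gam_linear_right] Gam_Jop) (simp add: f_p)
  ultimately show ?thesis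
    using nabla_rep[OF N(1,2,4,5)] nabla_rep[OF M(1,2,4,5)]
    by (simp add: christoffel_eq[OF chart_at(1) x] om.om_simps)
qed

end

text \<open>Provides a linear map on the whole space that equals the covariant derivative on tangent
  directions, so that directions can be expanded in bases.\<close>

lemma nabla_linear:
  assumes V: "smooth_field A (Y \<inter> U) V" and U: "open U" "p \<in> Y \<inter> U"
  obtains K where "linear K" "\<And>v. v \<in> tangent_space A Y p \<Longrightarrow> nabla A \<omega> Y V p v = K v"
proof -
  let ?c = "chart_at A p" and ?x = "snd (chart_at A p) p"
  obtain N h where N: "open N" "?x \<in> N" "N \<subseteq> chart_image ?c U" "smooth_on N h"
    "\<And>q. q \<in> Y \<Longrightarrow> q \<in> fst ?c \<Longrightarrow> snd ?c q \<in> N \<Longrightarrow> h (snd ?c q) = to_chart A ?c q (V q)"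
    using smooth_field_rep[OF V U chart_at] by blast
  have x: "?x \<in> chart_image ?c UNIV" using chart_at by simp
  show thesis
  proof
    show "nabla A \<omega> Y V p v = dd h ?x v + kaehler_jet.Gam (form_in_chart A \<omega> ?c ?x) (form_deriv ?c ?x) v (V p)"
      if "v \<in> tangent_space A Y p" for v
      using nabla_rep[OF U that N(1,2,4,5)] by (simp add: christoffel_eq[OF chart_at(1) x])
    show "linear (\<lambda>v. dd h ?x v + kaehler_jet.Gam (form_in_chart A \<omega> ?c ?x) (form_deriv ?c ?x) v (V p))"
      by (intro linear_compose_add kaehler_jet.Gam_linear_left[OF jet[OF chart_at(1) x]]
          has_derivative_linear[OF smooth_on_has_derivative[OF N(4,2)]])
  qed
qed

end

section \<open>Gram-Schmidt orthonormalisation\<close>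

context hermitian_form
begin

abbreviation skew_complement :: "(complex^'n) set \<Rightarrow> (complex^'n) set" where
  "skew_complement T \<equiv> {v. \<forall>w\<in>T. om v w = 0}"

lemma subspace_skew_complement: "subspace (skew_complement T)"
  by (rule subspaceI) (simp_all add: om_simps)

lemma DIM_complex_vec: "DIM(complex^'n) = 2 * CARD('n)"
  by simp

text \<open>\<open>M\<close> represents \<open>om\<close> through the Euclidean inner product, so it
  carries the skew complement of \<open>T\<close> bijectively onto the Euclidean orthogonal
  complement.\<close>

lemma dim_skew_complement:
  assumes "subspace T" shows "dim (skew_complement T) + dim T = 2 * CARD('n)"
proof -
  define M where "M v = (\<Sum>b\<in>Basis. om v b *\<^sub>R b)" for v
  have lin_om: "linear (om v)" for v using bil by (simp add: bilinear_def)
  have M: "w \<bullet> M v = om v w" for v w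
    using linear_basis_expand[OF lin_om, of v w] by (simp add: M_def inner_sum_right mult.commute)
  have lin: "linear M"
    by (rule linearI) (simp_all add: M_def om_simps scaleR_add_left sum.distrib scaleR_sum_right)
  have inj: "inj M"
  proof (rule injI)
    fix v w assume "M v = M w"
    then show "v = w" using M by (metis g_nondegenerate)
  qed
  have "M ` skew_complement T = {y\<in>UNIV. \<forall>x\<in>T. orthogonal x y}"
  proof -
    have "surj M" using lin inj linear_injective_imp_surjective by blast
    have "y \<in> M ` skew_complement T" if "\<forall>x\<in>T. orthogonal x y" for y
    proof -
      obtain v where "y = M v" using \<open>surj M\<close> by (metis surjD)
      then show ?thesis using that by (auto simp: orthogonal_def M)
    qed
    moreover have "orthogonal x (M v)" if "v \<in> skew_complement T" "x \<in> T" for x v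
      using that by (simp add: orthogonal_def M)
    ultimately show ?thesis by blast
  qed
  moreover have "dim (M ` skew_complement T) = dim (skew_complement T)"
    by (rule dim_image_eq[OF lin]) (use inj in \<open>auto intro: inj_on_subset\<close>)
  ultimately show ?thesis
    using dim_subspace_orthogonal_to_vectors[OF assms subspace_UNIV subset_UNIV] DIM_complex_vec by simp
qed

text \<open>One inclusion is skew symmetry, and the dimensions agree. It serves to recover a tangent
  space from its null space.\<close>

lemma skew_complement_twice:
  assumes "subspace T" shows "skew_complement (skew_complement T) = T"
proof -
  have sub: "T \<subseteq> skew_complement (skew_complement T)"
  proof
    fix w assume "w \<in> T"
    then have "om v w = 0" if "v \<in> skew_complement T" for v using that by blast
    then have "om w v = 0" if "v \<in> skew_complement T" for v using skew[of w v] that by simp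
    then show "w \<in> skew_complement (skew_complement T)" by blast
  qed
  have "dim (skew_complement (skew_complement T)) = dim T"
    using dim_skew_complement[OF assms] dim_skew_complement[OF subspace_skew_complement, of T] by linarith
  then show ?thesis
    using subspace_dim_equal[OF assms subspace_skew_complement sub] by simp
qed

lemma unitary_real_orthonormal:
  assumes "unitary e m" "i < m" "j < m" shows "om (e i) (Jop (e j)) = (if i = j then 1 else 0)" "om (e i) (e j) = 0"
  using unitaryD[OF assms] by (auto simp: H_def complex_eq_iff split: if_splits)

lemma scaleC_of_real: "complex_of_real r *s (v :: complex^'n) = r *\<^sub>R v"
  by (simp add: complex_scale_eq)

text \<open>If every vector equalled this combination, \<open>m\<close> vectors would span a complex
  space of dimension greater than \<open>m\<close>.\<close>

lemma unitary_extend_exists: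
  assumes "m < CARD('n)" obtains v where "v \<noteq> (\<Sum>i<m. H (e i) v *s e i)"
proof (rule ccontr)
  assume "\<not> thesis"
  then have all: "v = (\<Sum>i<m. H (e i) v *s e i)" for v using that by blast
  have "v \<in> vec.span (e ` {..<m})" for v
  proof -
    have "(\<Sum>i<m. H (e i) v *s e i) \<in> vec.span (e ` {..<m})"
      by (intro vec.span_sum vec.span_scale vec.span_base) simp
    then show ?thesis using all[of v] by simp
  qed
  then have "UNIV \<subseteq> vec.span (e ` {..<m})" by blast
  then have "vec.dim (UNIV :: (complex^'n) set) \<le> card (e ` {..<m})"
    by (rule vec.dim_le_card) simp
  also have "\<dots> \<le> m" using card_image_le[of "{..<m}" e] by simp
  finally show False using assms unfolding vec_dim_card by simp
qed

end

section \<open>Smooth unitary frames in a chart\<close>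

lemma smooth_on_powr_comp:
  fixes f :: "'a::real_normed_vector \<Rightarrow> real"
  shows "open S \<Longrightarrow> smooth_on S f \<Longrightarrow> (\<And>x. x \<in> S \<Longrightarrow> f x > 0) \<Longrightarrow> smooth_on S (\<lambda>x. f x powr a)"
  by (rule smooth_on_compose[where T = "{0<..}" and g = "\<lambda>t. t powr a"]) (auto simp: smooth_on_def Ck_on_powr)

context kaehler_manifold
begin

abbreviation Hc where "Hc c x \<equiv> hermitian_form.H (form_in_chart A \<omega> c x)"
abbreviation unitary_in_chart where "unitary_in_chart c x \<equiv> hermitian_form.unitary (form_in_chart A \<omega> c x)"

lemma Hc_smooth:
  assumes c: "c \<in> A" and N: "open N" "N \<subseteq> chart_image c UNIV" and h: "smooth_on N h" "smooth_on N k"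
  shows "smooth_on N (\<lambda>x. Hc c x (h x) (k x))"
proof (rule smooth_on_cong[OF N(1)])
  have Jk: "smooth_on N (\<lambda>x. Jop (k x))" by (rule smooth_on_linear[OF linear_Jop N(1) h(2)])
  show "smooth_on N (\<lambda>x. complex_of_real (form_in_chart A \<omega> c x (h x) (Jop (k x))) +
      \<i> * complex_of_real (form_in_chart A \<omega> c x (h x) (k x)))"
    by (intro smooth_on_add N smooth_on_bounded_linear[OF bounded_linear_of_real]
        smooth_on_bounded_linear[OF bounded_linear_mult_right] form_smooth_fields c h Jk)
  show "complex_of_real (form_in_chart A \<omega> c x (h x) (Jop (k x))) +
      \<i> * complex_of_real (form_in_chart A \<omega> c x (h x) (k x)) = Hc c x (h x) (k x)" if "x \<in> N" for x
    using hermitian_form.H_def[OF hermitian_chart[OF c]] N(2) that by (simp add: subset_iff complex_eq_iff)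
qed

lemma smooth_on_scaleC:
  fixes h :: "complex^'n \<Rightarrow> complex^'n"
  assumes "open N" "smooth_on N f" "smooth_on N h"
  shows "smooth_on N (\<lambda>x. f x *s h x)"
proof -
  have "smooth_on N (\<lambda>x. Re (f x) *\<^sub>R h x + Im (f x) *\<^sub>R Jop (h x))"
    by (intro smooth_on_add smooth_on_bilinear[OF bounded_bilinear_scaleR] smooth_on_linear[OF linear_Jop]
        smooth_on_bounded_linear[OF bounded_linear_Re] smooth_on_bounded_linear[OF bounded_linear_Im] assms)
  then show ?thesis by (simp add: complex_scale_eq)
qed

text \<open>The residual of \<open>v\<close> after projection is normalised where it does not
  vanish, an open set around \<open>x0\<close>. The last conclusion records that the new vector is a
  real multiple of this residual, which later keeps it inside null spaces.\<close>

lemma gram_schmidt_step: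
  assumes c: "c \<in> A" and N: "open N" "N \<subseteq> chart_image c UNIV" "x0 \<in> N"
    and e: "\<And>i. i < m \<Longrightarrow> smooth_on N (e i)" "\<And>x. x \<in> N \<Longrightarrow> unitary_in_chart c x (\<lambda>i. e i x) m"
    and v: "smooth_on N v" "v x0 \<noteq> (\<Sum>i<m. Hc c x0 (e i x0) (v x0) *s e i x0)"
  obtains N' e' where "open N'" "x0 \<in> N'" "N' \<subseteq> N" "smooth_on N' e'"
    "\<And>x. x \<in> N' \<Longrightarrow> unitary_in_chart c x (\<lambda>i. (e(m := e')) i x) (Suc m)"
    "\<And>x. x \<in> N' \<Longrightarrow> \<exists>r. e' x = r *\<^sub>R (v x - (\<Sum>i<m. Hc c x (e i x) (v x) *s e i x))"
proof -
  \<comment> \<open>The scalar -1 replaces subtraction so that closure of smooth maps under sums and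
    complex scaling applies.\<close>
  define w where "w x = v x + (-1) *s (\<Sum>i<m. Hc c x (e i x) (v x) *s e i x)" for x
  define s where "s x = form_in_chart A \<omega> c x (w x) (Jop (w x))" for x
  define N' where "N' = N \<inter> w -` (- {0})"
  have w_eq: "w x = v x - (\<Sum>i<m. Hc c x (e i x) (v x) *s e i x)" for x
    by (simp add: w_def)
  have w: "smooth_on N w"
    unfolding w_def
    by (intro smooth_on_add smooth_on_scaleC smooth_on_sum smooth_on_const Hc_smooth c N v e) simp_all
  have N': "open N'" "N' \<subseteq> N" "x0 \<in> N'"
    unfolding N'_def using continuous_open_preimage[OF smooth_on_continuous[OF w] N(1), of "- {0}"] N(3) v(2)
    by (auto simp: w_eq)
  have w': "smooth_on N' w" by (rule smooth_on_subset[OF w N'(2)])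
  have "smooth_on N' s"
    unfolding s_def using N' N by (intro form_smooth_fields c smooth_on_linear[OF linear_Jop] w') auto
  moreover have s_pos: "s x > 0" if "x \<in> N'" for x
    unfolding s_def using that N N' by (intro hermitian_form.pos[OF hermitian_chart[OF c]]) (auto simp: N'_def)
  ultimately have sm: "smooth_on N' (\<lambda>x. s x powr (-1/2) *\<^sub>R w x)"
    by (intro smooth_on_bilinear[OF bounded_bilinear_scaleR] smooth_on_powr_comp N' w')
  show thesis
  proof (rule that[OF N'(1,3,2) sm])
    fix x assume x: "x \<in> N'"
    interpret hermitian_form "form_in_chart A \<omega> c x" using x N N' by (intro hermitian_chart c) auto
    let ?e' = "s x powr (-1/2) *\<^sub>R w x"
    have u: "unitary (\<lambda>i. e i x) m" using e(2) x N' by blast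
    have 0: "H (e i x) (w x) = 0" if "i < m" for i
      using that by (simp add: w_eq H_diff H_frame_sum[OF u])
    have Hw: "H (w x) (w x) = of_real (s x)"
      by (subst H_self) (simp add: H_def s_def)
    have 1: "H ?e' ?e' = 1"
    proof -
      have "H ?e' ?e' = of_real (s x powr (-1/2)) * cnj (H (w x) ?e')"
        by (subst H_scaleR) (simp add: H_cnj)
      also have "\<dots> = of_real (s x powr (-1/2) * s x powr (-1/2) * s x)"
        by (simp add: H_scaleR Hw)
      also have "s x powr (-1/2) * s x powr (-1/2) * s x = 1"
        using s_pos[OF x] by (simp add: powr_add[symmetric] powr_minus_divide)
      finally show ?thesis by simp
    qed
    have 2: "H (e i x) ?e' = 0" "H ?e' (e i x) = 0" if "i < m" for i
      using 0[OF that] H_cnj[of "e i x" ?e'] by (auto simp: H_scaleR)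
    show "unitary (\<lambda>i. (e(m := \<lambda>x. s x powr (-1/2) *\<^sub>R w x)) i x) (Suc m)"
      unfolding unitary_def
    proof (intro allI impI)
      fix i j assume "i < Suc m" "j < Suc m"
      then show "H ((e(m := \<lambda>x. s x powr (-1/2) *\<^sub>R w x)) i x) ((e(m := \<lambda>x. s x powr (-1/2) *\<^sub>R w x)) j x) = (if i = j then 1 else 0)"
        using 1 2 unitaryD[OF u, of i j] by (cases "i = m"; cases "j = m") auto
    qed
    show "\<exists>r. ?e' = r *\<^sub>R (v x - (\<Sum>i<m. H (e i x) (v x) *s e i x))"
      by (auto simp: w_eq)
  qed
qed

lemma unitary_frame_extend:
  assumes c: "c \<in> A" and N: "open N" "N \<subseteq> chart_image c UNIV" "x0 \<in> N"
    and e: "\<And>i. i < m \<Longrightarrow> smooth_on N (e i)" "\<And>x. x \<in> N \<Longrightarrow> unitary_in_chart c x (\<lambda>i. e i x) m"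
    and m: "m \<le> m'" "m' \<le> CARD('n)"
  shows "\<exists>N' e'. open N' \<and> x0 \<in> N' \<and> N' \<subseteq> N \<and> (\<forall>i<m'. smooth_on N' (e' i)) \<and>
    (\<forall>x\<in>N'. unitary_in_chart c x (\<lambda>i. e' i x) m') \<and> (\<forall>i<m. e' i = e i)"
  using m
proof (induction m' rule: dec_induct)
  case base
  then show ?case using N e by (intro exI[of _ N] exI[of _ e]) auto
next
  case (step l)
  then obtain N1 e1 where "open N1 \<and> x0 \<in> N1 \<and> N1 \<subseteq> N \<and> (\<forall>i<l. smooth_on N1 (e1 i)) \<and>
    (\<forall>x\<in>N1. unitary_in_chart c x (\<lambda>i. e1 i x) l) \<and> (\<forall>i<m. e1 i = e i)"
    by auto
  then have 1: "open N1" "x0 \<in> N1" "N1 \<subseteq> N" "\<And>i. i < l \<Longrightarrow> smooth_on N1 (e1 i)"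
    "\<And>x. x \<in> N1 \<Longrightarrow> unitary_in_chart c x (\<lambda>i. e1 i x) l" "\<forall>i<m. e1 i = e i"
    by auto
  have "x0 \<in> chart_image c UNIV" using N by auto
  then interpret hermitian_form "form_in_chart A \<omega> c x0" by (rule hermitian_chart[OF c])
  have "l < CARD('n)" using step.prems by simp
  \<comment> \<open>A vector that differs from its projection at \<open>x0\<close> alone is enough:
    kept constant in the chart, it is a smooth field, and the Gram-Schmidt step shrinks the
    neighbourhood.\<close>
  then obtain v where v: "v \<noteq> (\<Sum>i<l. H (e1 i x0) v *s e1 i x0)" by (rule unitary_extend_exists)
  have N1: "N1 \<subseteq> chart_image c UNIV" using 1 N by auto
  obtain N2 e2 where 2: "open N2" "x0 \<in> N2" "N2 \<subseteq> N1" "smooth_on N2 e2"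
    "\<And>x. x \<in> N2 \<Longrightarrow> unitary_in_chart c x (\<lambda>i. (e1(l := e2)) i x) (Suc l)"
    using gram_schmidt_step[OF c 1(1) N1 1(2) 1(4,5) smooth_on_const v] by metis
  show ?case
  proof (intro exI[of _ N2] exI[of _ "e1(l := e2)"] conjI allI impI)
    show "smooth_on N2 ((e1(l := e2)) i)" if "i < Suc l" for i
      using that 2 1(4) by (auto intro: smooth_on_subset simp: less_Suc_eq)
    show "(e1(l := e2)) i = e i" if "i < m" for i
      using that 1(6) step.hyps by auto
  qed (use 1 2 in auto)
qed

end

section \<open>Tangent spaces of submanifolds\<close>

text \<open>The component \<open>z\<close> of the derivative orthogonal to \<open>L\<close> has a
  pairing with \<open>f\<close> that vanishes near 0; differentiating it shows that \<open>z\<close>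
  is zero.\<close>

lemma vector_derivative_in_subspace:
  fixes f :: "real \<Rightarrow> 'a::euclidean_space"
  assumes "subspace L" "(f has_vector_derivative f') (at 0)" "\<forall>\<^sub>F t in nhds 0. f t \<in> L"
  shows "f' \<in> L"
proof -
  obtain y z where yz: "y \<in> span L" "\<And>w. w \<in> span L \<Longrightarrow> orthogonal z w" "f' = y + z"
    using orthogonal_subspace_decomp_exists[of L f'] by blast
  have sp: "span L = L" using assms(1) by (simp add: span_eq_iff)
  have "((\<lambda>t. f t \<bullet> z) has_vector_derivative f' \<bullet> z) (at 0)"
    using has_vector_derivative_compose_derivative[OF assms(2)
        bounded_linear.has_derivative[OF bounded_linear_inner_left has_derivative_ident]]
    unfolding o_def .
  moreover have "((\<lambda>t. f t \<bullet> z) has_vector_derivative 0) (at 0)"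
  proof -
    have "\<forall>\<^sub>F t in nhds 0. f t \<bullet> z = 0"
      using assms(3) by eventually_elim (use yz(2) sp in \<open>simp add: orthogonal_def inner_commute[of _ z]\<close>)
    moreover have "((\<lambda>t::real. 0::real) has_vector_derivative 0) (at 0)" by simp
    ultimately show ?thesis
      by (subst has_vector_derivative_cong_ev[where g = "\<lambda>t. 0"])
        (auto elim: eventually_mono dest: eventually_nhds_x_imp_x)
  qed
  ultimately have "f' \<bullet> z = 0" using vector_derivative_unique_at by blast
  then have "y \<bullet> z + z \<bullet> z = 0" unfolding yz(3) inner_add_left .
  moreover have "y \<bullet> z = 0"
    using yz(2)[OF yz(1)] unfolding orthogonal_def by (metis inner_commute)
  ultimately have "z = 0" by simp
  then show ?thesis using yz(1,3) sp by simp
qed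

locale slice_chart = complex_manifold A
  for A :: "('x::topological_space, 'n::finite) chart set" +
  fixes Y :: "'x set" and p :: 'x and N :: "(complex^'n) set" and \<psi> \<phi> :: "complex^'n \<Rightarrow> complex^'n"
    and L :: "(complex^'n) set"
  assumes p: "p \<in> Y" and N: "open N" "snd (chart_at A p) p \<in> N" "N \<subseteq> chart_image (chart_at A p) UNIV"
    and \<psi>: "smooth_on N \<psi>" "open (\<psi> ` N)" and \<phi>: "smooth_on (\<psi> ` N) \<phi>" "\<And>x. x \<in> N \<Longrightarrow> \<phi> (\<psi> x) = x"
    and L: "subspace L" and slice: "\<psi> ` (N \<inter> chart_image (chart_at A p) Y) = \<psi> ` N \<inter> L"
begin

abbreviation c where "c \<equiv> chart_at A p"
abbreviation x0 where "x0 \<equiv> snd c p"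

lemma deriv_left:
  assumes "x \<in> N" shows "dd \<phi> (\<psi> x) (dd \<psi> x v) = v"
proof -
  have "(\<phi> \<circ> \<psi> has_derivative dd \<phi> (\<psi> x) \<circ> dd \<psi> x) (at x)"
    by (rule diff_chain_at[OF smooth_on_has_derivative[OF \<psi>(1) assms] smooth_on_has_derivative[OF \<phi>(1)]])
      (use assms in auto)
  moreover have "(\<phi> \<circ> \<psi> has_derivative id) (at x)"
    by (rule has_derivative_transform_within_open[OF has_derivative_id N(1) assms]) (simp add: \<phi>(2))
  ultimately have "dd \<phi> (\<psi> x) \<circ> dd \<psi> x = id" by (rule has_derivative_unique)
  then show ?thesis by (simp add: fun_eq_iff)
qed

lemma linear_deriv: "x \<in> N \<Longrightarrow> linear (dd \<psi> x)" "x \<in> N \<Longrightarrow> linear (dd \<phi> (\<psi> x))"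
  using has_derivative_linear[OF smooth_on_has_derivative[OF \<psi>(1)]]
    has_derivative_linear[OF smooth_on_has_derivative[OF \<phi>(1)]] by auto

lemma inj_deriv: "x \<in> N \<Longrightarrow> inj (dd \<psi> x)"
  by (rule inj_on_inverseI[of _ "dd \<phi> (\<psi> x)"]) (simp add: deriv_left)

text \<open>\<open>\<phi>\<close> is given only as a left inverse of \<open>\<psi>\<close>; an
  injective linear map between spaces of equal finite dimension is onto, so its left inverse is
  two-sided.\<close>

lemma deriv_right:
  assumes "x \<in> N" shows "dd \<psi> x (dd \<phi> (\<psi> x) v) = v"
proof -
  have "surj (dd \<psi> x)"
    using linear_injective_imp_surjective linear_deriv(1)[OF assms] inj_deriv[OF assms] by blast
  then obtain u where "v = dd \<psi> x u" by (metis surjD)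
  then show ?thesis using deriv_left[OF assms] by simp
qed

lemma psi_in_L: "q \<in> Y \<Longrightarrow> q \<in> fst c \<Longrightarrow> snd c q \<in> N \<Longrightarrow> \<psi> (snd c q) \<in> L"
  using slice chart_at(1) by (metis IntI IntD2 imageI snd_in_iff)

text \<open>The image of a curve under the slice chart stays in \<open>L\<close>, hence so does its
  velocity. The statement covers every point \<open>q\<close> of the slice neighbourhood because
  tangent fields and null fields have to be controlled near \<open>p\<close>, not only at
  \<open>p\<close>.\<close>

lemma tangent_imp:
  assumes "v \<in> tangent_space A Y q" "q \<in> fst c" "snd c q \<in> N"
  shows "dd \<psi> (snd c q) (to_chart A c q v) \<in> L"
proof -
  obtain \<gamma> where g: "curve_in A Y q v \<gamma>" using assms(1) by (auto simp: tangent_space_def)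
  have U: "open (param c ` N)" by (rule open_param_image[OF chart_at(1) N(1,3)])
  have q: "q \<in> param c ` N" using assms chart_at by (auto simp: image_iff) (metis param_snd)
  have "(((\<psi> \<circ> snd c) \<circ> \<gamma>) has_vector_derivative dd \<psi> (snd c q) (to_chart A c q v)) (at 0)"
    by (rule curve_deriv_fun[OF g chart_at(1) assms(2) N(1) assms(3) smooth_on_differentiable[OF \<psi>(1) assms(3)]]) simp
  moreover have "\<forall>\<^sub>F t in nhds 0. ((\<psi> \<circ> snd c) \<circ> \<gamma>) t \<in> L"
    using curve_eventually[OF g U q]
  proof eventually_elim
    case (elim t)
    then obtain x where "x \<in> N" "\<gamma> t = param c x" by blast
    then show ?case using elim psi_in_L[of "\<gamma> t"] N(3) chart_at(1) by (auto simp: subset_iff)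
  qed
  ultimately show ?thesis by (rule vector_derivative_in_subspace[OF L])
qed

text \<open>The witness is the straight line through \<open>\<psi> x0\<close> inside
  \<open>L\<close>, pulled back by \<open>\<phi>\<close> and carried to the manifold by the
  chart.\<close>

lemma in_tangent:
  assumes "dd \<psi> x0 v \<in> L" shows "v \<in> tangent_space A Y p"
proof -
  define l where "l = dd \<psi> x0 v"
  define a where "a t = \<psi> x0 + t *\<^sub>R l" for t :: real
  have cont: "continuous_on UNIV a" unfolding a_def by (intro continuous_intros)
  have "open (a -` (\<psi> ` N))" using continuous_open_vimage[OF \<psi>(2)] cont
    by (simp add: continuous_on_open_vimage[OF open_UNIV] \<psi>(2))
  moreover have "0 \<in> a -` (\<psi> ` N)" using N by (simp add: a_def)
  ultimately obtain e where e: "e > 0" "ball 0 e \<subseteq> a -` (\<psi> ` N)" using openE by blast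
  have at: "a t \<in> \<psi> ` N" if "t \<in> {-e<..<e}" for t
    using that e(2) by (auto simp: subset_iff dist_real_def)
  have aL: "a t \<in> L" for t
    unfolding a_def l_def using L assms psi_in_L[OF p chart_at(2) N(2)] by (intro subspace_add subspace_scale)
  define \<gamma> where "\<gamma> t = param c (\<phi> (a t))" for t
  have phi: "\<phi> (a t) \<in> N" "param c (\<phi> (a t)) \<in> Y" if "t \<in> {-e<..<e}" for t
  proof -
    have "a t \<in> \<psi> ` (N \<inter> chart_image c Y)" using at[OF that] aL slice by simp
    then obtain y where y: "y \<in> N" "y \<in> chart_image c Y" "a t = \<psi> y" by blast
    then show "\<phi> (a t) \<in> N" "param c (\<phi> (a t)) \<in> Y"
      using chart_imageD(2)[OF chart_at(1) y(2)] by (simp_all add: \<phi>(2))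
  qed
  have sg: "(snd c \<circ> \<gamma>) t = \<phi> (a t)" if "t \<in> {-e<..<e}" for t
    using phi(1)[OF that] N(3) chart_at(1) by (simp add: \<gamma>_def subset_iff)
  have op: "open {-e<..<e}" by simp
  have "smooth_on {-e<..<e} (\<lambda>t. \<phi> (a t))"
  proof (rule smooth_on_compose[OF op \<psi>(2) _ _ \<phi>(1)])
    show "smooth_on {-e<..<e} a"
      unfolding a_def
      by (intro smooth_on_add smooth_on_const op smooth_on_bilinear[OF bounded_bilinear_scaleR] smooth_on_ident)
  qed (use at in auto)
  then have smooth: "smooth_on {-e<..<e} (snd c \<circ> \<gamma>)"
    by (rule smooth_on_cong[OF op, rotated]) (simp only: sg)
  have "(a has_vector_derivative l) (at 0)"
    unfolding a_def by (auto intro!: derivative_eq_intros simp: has_vector_derivative_def)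
  moreover have "(\<phi> has_derivative dd \<phi> (\<psi> x0)) (at (a 0))"
    using smooth_on_has_derivative[OF \<phi>(1), of "\<psi> x0"] N by (simp add: a_def)
  ultimately have "((\<phi> \<circ> a) has_vector_derivative dd \<phi> (\<psi> x0) l) (at 0)"
    by (rule has_vector_derivative_compose_derivative)
  then have "((\<phi> \<circ> a) has_vector_derivative v) (at 0)"
    using deriv_left[OF N(2)] by (simp add: l_def)
  moreover have "0 \<in> {-e<..<e}" using e by simp
  ultimately have vd: "((snd c \<circ> \<gamma>) has_vector_derivative v) (at 0)"
    unfolding has_vector_derivative_def
    by (rule has_derivative_transform_within_open[OF _ op]) (simp add: sg[unfolded o_def])
  have "\<gamma> 0 = p"
    using \<phi>(2)[OF N(2)] chart_at by (simp add: \<gamma>_def a_def)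
  moreover have "\<gamma> ` {-e<..<e} \<subseteq> Y \<inter> fst c"
    using phi N(3) chart_at(1) by (force simp: \<gamma>_def subset_iff)
  ultimately have "curve_in A Y p v \<gamma>"
    unfolding curve_in_def using e smooth vd by blast
  then show ?thesis by (auto simp: tangent_space_def)
qed

lemma tangent_space_eq: "tangent_space A Y p = {v. dd \<psi> x0 v \<in> L}"
  using tangent_imp[OF _ chart_at(2) N(2)] in_tangent by auto

lemma tangent_space_image: "tangent_space A Y p = dd \<phi> (\<psi> x0) ` L"
  unfolding tangent_space_eq using deriv_left[OF N(2)] deriv_right[OF N(2)]
  by (auto simp: image_iff) metis

lemma subspace_tangent: "subspace (tangent_space A Y p)"
  unfolding tangent_space_image by (rule linear_subspace_image[OF linear_deriv(2)[OF N(2)] L])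

lemma dim_tangent: "dim (tangent_space A Y p) = dim L"
  unfolding tangent_space_image
proof (rule dim_image_eq[OF linear_deriv(2)[OF N(2)]])
  show "inj_on (dd \<phi> (\<psi> x0)) (span L)"
    by (rule inj_on_inverseI[of _ "dd \<psi> x0"]) (simp add: deriv_right[OF N(2)])
qed

end

context complex_manifold
begin

lemma submanifold_slice:
  assumes "submanifold A Y d" "p \<in> Y"
  obtains N \<psi> \<phi> L where "slice_chart A Y p N \<psi> \<phi> L" "dim L = d"
proof -
  from bspec[OF assms(1)[unfolded submanifold_def] assms(2)] show thesis
  proof (elim exE, goal_cases)
    case (1 N \<psi> \<phi> L)
    show thesis
      by (rule that[of N \<psi> \<phi> L])
        (use 1 assms(2) complex_manifold_axioms in \<open>simp_all add: slice_chart_def slice_chart_axioms_def\<close>)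
  qed
qed

lemma submanifold_tangent:
  assumes "submanifold A Y d" "p \<in> Y"
  shows "subspace (tangent_space A Y p)" "dim (tangent_space A Y p) = d"
proof -
  obtain N \<psi> \<phi> L where "slice_chart A Y p N \<psi> \<phi> L" "dim L = d"
    using submanifold_slice[OF assms] .
  then show "subspace (tangent_space A Y p)" "dim (tangent_space A Y p) = d"
    using slice_chart.subspace_tangent slice_chart.dim_tangent by auto
qed

end

context kaehler_manifold
begin

text \<open>In a slice chart \<open>\<psi>\<close> tangent fields \<open>W\<close> satisfy \<open>D\<psi> W \<in> L\<close> along \<open>Y\<close>; differentiating this along \<open>Y\<close>
  leaves the Hessian of \<open>\<psi>\<close>, which cancels by symmetry.\<close>

lemma torsion_free:
  assumes "submanifold A Y d" and U: "open U" "p \<in> Y \<inter> U"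
    and V: "smooth_field A (Y \<inter> U) V" and W: "smooth_field A (Y \<inter> U) W"
    and tan: "\<And>q. q \<in> Y \<inter> U \<Longrightarrow> V q \<in> tangent_space A Y q" "\<And>q. q \<in> Y \<inter> U \<Longrightarrow> W q \<in> tangent_space A Y q"
  shows "nabla A \<omega> Y W p (V p) - nabla A \<omega> Y V p (W p) \<in> tangent_space A Y p"
proof -
  have pY: "p \<in> Y" using U by simp
  obtain N0 \<psi> \<phi> L where "slice_chart A Y p N0 \<psi> \<phi> L"
    using submanifold_slice[OF assms(1) pY] by metis
  then interpret slice_chart A Y p N0 \<psi> \<phi> L .
  \<comment> \<open>Both fields are treated alike: along \<open>Y\<close> the function
    \<open>dd \<psi> y (h y)\<close> takes values in \<open>L\<close>, so its derivative, a Hessian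
    term plus a term in the derivative of \<open>h\<close>, lies in \<open>L\<close> too.\<close>
  have along: "\<exists>N h. open N \<and> x0 \<in> N \<and> smooth_on N h \<and> h x0 = W p \<and>
      (\<forall>q\<in>Y. q \<in> fst c \<longrightarrow> snd c q \<in> N \<longrightarrow> h (snd c q) = to_chart A c q (W q)) \<and>
      (\<forall>v\<in>tangent_space A Y p. dd (\<lambda>y. dd \<psi> y (W p)) x0 v + dd \<psi> x0 (dd h x0 v) \<in> L)"
    if W: "smooth_field A (Y \<inter> U) W" and tan: "\<And>q. q \<in> Y \<inter> U \<Longrightarrow> W q \<in> tangent_space A Y q" for W
  proof -
    obtain N h where h: "open N" "x0 \<in> N" "N \<subseteq> chart_image c U" "smooth_on N h"
      "\<And>q. q \<in> Y \<Longrightarrow> q \<in> fst c \<Longrightarrow> snd c q \<in> N \<Longrightarrow> h (snd c q) = to_chart A c q (W q)"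
      using smooth_field_rep[OF W U chart_at] by blast
    have h0: "h x0 = W p" using h(5)[OF pY chart_at(2) h(2)] by simp
    have "dd (\<lambda>y. dd \<psi> y (W p)) x0 v + dd \<psi> x0 (dd h x0 v) \<in> L" if v: "v \<in> tangent_space A Y p" for v
    proof -
      obtain \<gamma> where g: "curve_in A Y p v \<gamma>" using v by (auto simp: tangent_space_def)
      have d: "((\<lambda>y. dd \<psi> y (h y)) has_derivative (\<lambda>v. dd (\<lambda>y. dd \<psi> y (h x0)) x0 v + dd \<psi> x0 (dd h x0 v))) (at x0)"
        by (rule has_derivative_linear_family[where L = "dd \<psi>" and D = "\<lambda>a. dd (\<lambda>y. dd \<psi> y a) x0", OF N(1,2)])
          (use linear_deriv(1) smooth_on_has_derivative[OF smooth_on_dd[OF \<psi>(1)] N(2)] smooth_on_has_derivative[OF h(4,2)] in auto)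
      have o: "open (N0 \<inter> N)" "x0 \<in> N0 \<inter> N" using N h by auto
      have "((((\<lambda>y. dd \<psi> y (h y)) \<circ> snd c) \<circ> \<gamma>) has_vector_derivative dd (\<lambda>y. dd \<psi> y (h y)) x0 (to_chart A c p v)) (at 0)"
        by (rule curve_deriv_fun[OF g chart_at o]) (use d in \<open>auto simp: differentiable_def\<close>)
      moreover have "\<forall>\<^sub>F t in nhds 0. (((\<lambda>y. dd \<psi> y (h y)) \<circ> snd c) \<circ> \<gamma>) t \<in> L"
      proof -
        have "open (param c ` (N0 \<inter> N))"
          by (rule open_param_image[OF chart_at(1) o(1)]) (use N in auto)
        moreover have "p \<in> param c ` (N0 \<inter> N)"
          using o(2) chart_at by (metis imageI param_snd)
        ultimately have "\<forall>\<^sub>F t in nhds 0. \<gamma> t \<in> Y \<inter> param c ` (N0 \<inter> N) \<inter> fst c"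
          by (rule curve_eventually[OF g])
        then show ?thesis
        proof (rule eventually_mono)
          fix t assume t: "\<gamma> t \<in> Y \<inter> param c ` (N0 \<inter> N) \<inter> fst c"
          then obtain x where "x \<in> N0" "x \<in> N" "\<gamma> t = param c x" by blast
          then have x: "snd c (\<gamma> t) \<in> N0" "snd c (\<gamma> t) \<in> N" using N(3) chart_at(1) by (auto simp: subset_iff)
          have "\<gamma> t \<in> U" using x(2) h(3) chart_at(1) t by (auto dest!: subsetD)
          then show "(((\<lambda>y. dd \<psi> y (h y)) \<circ> snd c) \<circ> \<gamma>) t \<in> L"
            using tangent_imp[OF tan[of "\<gamma> t"] _ x(1)] t h(5)[of "\<gamma> t"] x(2) by auto
        qed
      qed
      ultimately have "dd (\<lambda>y. dd \<psi> y (h y)) x0 (to_chart A c p v) \<in> L"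
        by (rule vector_derivative_in_subspace[OF L])
      then show ?thesis by (simp add: dd_eqI[OF d] h0)
    qed
    then show ?thesis using h h0 by (intro exI[of _ N] exI[of _ h]) auto
  qed
  obtain N h where h: "open N" "x0 \<in> N" "smooth_on N h"
      "\<forall>q\<in>Y. q \<in> fst c \<longrightarrow> snd c q \<in> N \<longrightarrow> h (snd c q) = to_chart A c q (V q)"
      "\<forall>v\<in>tangent_space A Y p. dd (\<lambda>y. dd \<psi> y (V p)) x0 v + dd \<psi> x0 (dd h x0 v) \<in> L"
    using along[OF V tan(1)] by auto
  obtain M k where k: "open M" "x0 \<in> M" "smooth_on M k"
      "\<forall>q\<in>Y. q \<in> fst c \<longrightarrow> snd c q \<in> M \<longrightarrow> k (snd c q) = to_chart A c q (W q)"
      "\<forall>v\<in>tangent_space A Y p. dd (\<lambda>y. dd \<psi> y (W p)) x0 v + dd \<psi> x0 (dd k x0 v) \<in> L"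
    using along[OF W tan(2)] by auto
  have Vp: "V p \<in> tangent_space A Y p" "W p \<in> tangent_space A Y p" using tan U by auto
  have x: "x0 \<in> chart_image c UNIV" using chart_at by simp
  \<comment> \<open>Symmetry of the Christoffel symbols leaves the coordinate expression of the
    bracket.\<close>
  have "nabla A \<omega> Y W p (V p) - nabla A \<omega> Y V p (W p) = dd k x0 (V p) - dd h x0 (W p)"
    using nabla_rep[OF U Vp(1) k(1-3)] nabla_rep[OF U Vp(2) h(1-3)] h(4) k(4)
      kaehler_jet.Gam_sym[OF jet[OF chart_at(1) x], of "V p" "W p"]
    by (simp add: christoffel_eq[OF chart_at(1) x])
  moreover have "dd \<psi> x0 (dd k x0 (V p) - dd h x0 (W p)) \<in> L"
  proof -
    have "(dd (\<lambda>y. dd \<psi> y (W p)) x0 (V p) + dd \<psi> x0 (dd k x0 (V p)))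
        - (dd (\<lambda>y. dd \<psi> y (V p)) x0 (W p) + dd \<psi> x0 (dd h x0 (W p))) \<in> L"
      using h(5) k(5) Vp by (intro subspace_diff[OF L]) auto
    then show ?thesis
      using second_derivative_symmetric[OF N(1,2) \<psi>(1), of "W p" "V p"]
      by (simp add: linear_diff[OF linear_deriv(1)[OF N(2)]])
  qed
  ultimately show ?thesis by (simp add: in_tangent)
qed

end

section \<open>Existence of adapted frames\<close>

context hermitian_form
begin

lemma linear_om_left: "linear (\<lambda>v. om v w)" and linear_om_right: "linear (om v)"
  using bil by (simp_all add: bilinear_def)

text \<open>The vector dual to a covector under \<open>om\<close>, written out in a unitary frame.
  The explicit formula makes it smooth whenever the frame and the covector are.\<close>

lemma skew_riesz_frame:
  assumes "unitary F CARD('n)" "linear g"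
  shows "om (\<Sum>i<CARD('n). g (Jop (F i)) *\<^sub>R F i - g (F i) *\<^sub>R Jop (F i)) w = g w"
proof -
  have "g w = g (\<Sum>i<CARD('n). H (F i) w *s F i)"
    using unitary_expand[OF assms(1), of w] by simp
  also have "\<dots> = (\<Sum>i<CARD('n). om (F i) (Jop w) * g (F i) + om (F i) w * g (Jop (F i)))"
    using assms(2) by (simp add: linear_sum complex_scale_eq linear_add linear_scale H_def)
  also have "\<dots> = om (\<Sum>i<CARD('n). g (Jop (F i)) *\<^sub>R F i - g (F i) *\<^sub>R Jop (F i)) w"
    by (simp add: linear_sum[OF linear_om_left] om_simps om_Jop_left mult.commute add.commute)
  finally show ?thesis by simp
qed

lemma om_nondegenerate: "(\<And>w. om X w = om Y w) \<Longrightarrow> X = Y"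
  by (rule g_nondegenerate)

end

context kaehler_manifold
begin

lemma form_at_point: "form_in_chart A \<omega> (chart_at A p) (snd (chart_at A p) p) = \<omega> p"
  using chart_at by (simp add: fun_eq_iff form_in_chart_def)

lemma null_space_eq: "null_space A \<omega> Y q = om.skew_complement q (tangent_space A Y q)"
  by (simp add: null_space_def)

lemma subspace_null_space: "subspace (null_space A \<omega> Y q)"
  unfolding null_space_eq by (rule om.subspace_skew_complement)

lemma null_spaceD: "v \<in> null_space A \<omega> Y q \<Longrightarrow> w \<in> tangent_space A Y q \<Longrightarrow> \<omega> q v w = 0"
  by (simp add: null_space_def)

lemma dim_null_space:
  assumes "submanifold A Y d" "q \<in> Y"
  shows "dim (null_space A \<omega> Y q) + d = 2 * CARD('n)"
  using om.dim_skew_complement[OF submanifold_tangent(1)[OF assms]] submanifold_tangent(2)[OF assms]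
  by (simp add: null_space_eq)

lemma tangent_space_from_null:
  assumes "submanifold A Y d" "q \<in> Y"
  shows "tangent_space A Y q = om.skew_complement q (null_space A \<omega> Y q)"
  unfolding null_space_eq by (rule om.skew_complement_twice[OF submanifold_tangent(1)[OF assms], symmetric])

text \<open>The fields are the Hamiltonian vector fields of the functions \<open>ell \<bullet> \<psi>\<close>, with \<open>ell\<close> orthogonal to
  \<open>L\<close>, which vanish on \<open>Y\<close>.\<close>

lemma null_field_exists:
  assumes Y: "submanifold A Y d" "p \<in> Y" and v: "v \<in> null_space A \<omega> Y p"
  shows "\<exists>N X. open N \<and> snd (chart_at A p) p \<in> N \<and> N \<subseteq> chart_image (chart_at A p) UNIV \<and> smooth_on N X \<and>
     X (snd (chart_at A p) p) = v \<and>
     (\<forall>q\<in>Y. q \<in> fst (chart_at A p) \<longrightarrow> snd (chart_at A p) q \<in> N \<longrightarrow>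
        from_chart A (chart_at A p) q (X (snd (chart_at A p) q)) \<in> null_space A \<omega> Y q)"
proof -
  obtain N0 \<psi> \<phi> L where "slice_chart A Y p N0 \<psi> \<phi> L"
    using submanifold_slice[OF Y] by metis
  then interpret slice_chart A Y p N0 \<psi> \<phi> L .
  have N0: "N0 \<subseteq> chart_image c UNIV" by (rule N(3))
  \<comment> \<open>The empty family, from which a full unitary frame is extended.\<close>
  have u0: "unitary_in_chart c x (\<lambda>i. (\<lambda>_ _. 0) i x) 0" if "x \<in> N0" for x
    using hermitian_form.unitary_def[OF hermitian_chart[OF chart_at(1)]] that N0 by blast
  obtain N F where F: "open N" "x0 \<in> N" "N \<subseteq> N0" "\<forall>i<CARD('n). smooth_on N (F i)"
      "\<forall>x\<in>N. unitary_in_chart c x (\<lambda>i. F i x) CARD('n)"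
    using unitary_frame_extend[OF chart_at(1) N(1) N0 N(2), of 0 "\<lambda>_ _. 0" "CARD('n)"] u0 by auto
  \<comment> \<open>The covector of \<open>v\<close> under \<open>\<omega> p\<close>, carried to the
    slice chart. It kills \<open>L\<close> since \<open>v\<close> is null and
    \<open>dd \<phi> (\<psi> x0)\<close> maps \<open>L\<close> onto the tangent space.\<close>
  define ell where "ell = (\<Sum>b\<in>Basis. \<omega> p v (dd \<phi> (\<psi> x0) b) *\<^sub>R b)"
  have lin_ell: "linear (\<lambda>u. \<omega> p v (dd \<phi> (\<psi> x0) u))"
    using linear_compose[OF linear_deriv(2)[OF N(2)] om.linear_om_right[of p v]] by (simp add: o_def)
  have ell: "ell \<bullet> u = \<omega> p v (dd \<phi> (\<psi> x0) u)" for u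
    unfolding linear_basis_expand[OF lin_ell, of u] by (simp add: ell_def inner_sum_left inner_commute[of u] mult.commute)
  have ell_L: "ell \<bullet> l = 0" if "l \<in> L" for l
    using null_spaceD[OF v, of "dd \<phi> (\<psi> x0) l"] that by (simp add: ell tangent_space_image)
  define lam where "lam x w = ell \<bullet> dd \<psi> x w" for x w
  define X where "X x = (\<Sum>i<CARD('n). lam x (Jop (F i x)) *\<^sub>R F i x + (- lam x (F i x)) *\<^sub>R Jop (F i x))" for x
  have lin: "linear (lam x)" if "x \<in> N" for x
    unfolding lam_def using that F(3) linear_deriv(1)[of x]
    by (intro linearI) (auto simp: linear_add linear_scale inner_add_right)
  have lam_smooth: "smooth_on N (\<lambda>x. lam x (h x))" if "smooth_on N h" for h
  proof (rule smooth_on_linear_family[OF F(1) lin _ that])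
    show "smooth_on N (\<lambda>x. lam x a)" for a
      unfolding lam_def
      by (rule smooth_on_bounded_linear[OF bounded_linear_inner_right F(1)],
          rule smooth_on_subset[OF smooth_on_dd[OF \<psi>(1)] F(3)])
  qed
  have smX: "smooth_on N X"
    unfolding X_def using F(1,4)
    by (intro smooth_on_sum smooth_on_add smooth_on_bilinear[OF bounded_bilinear_scaleR] lam_smooth
        smooth_on_linear[OF linear_Jop] smooth_on_bounded_linear[OF bounded_linear_minus[OF bounded_linear_ident]]) auto
  have omX: "form_in_chart A \<omega> c x (X x) w = lam x w" if "x \<in> N" for x w
  proof -
    have "x \<in> chart_image c UNIV" using that F(3) N0 by blast
    then interpret h: hermitian_form "form_in_chart A \<omega> c x" by (rule hermitian_chart[OF chart_at(1)])
    show ?thesis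
      unfolding X_def using h.skew_riesz_frame[OF _ lin[OF that], of "\<lambda>i. F i x" w] F(5) that by simp
  qed
  have "X x0 = v"
  proof (rule om.om_nondegenerate[of p])
    show "\<omega> p (X x0) w = \<omega> p v w" for w
      using omX[OF F(2), of w] deriv_left[OF N(2)] by (simp add: form_at_point lam_def ell)
  qed
  moreover have "from_chart A c q (X (snd c q)) \<in> null_space A \<omega> Y q"
    if q: "q \<in> Y" "q \<in> fst c" "snd c q \<in> N" for q
    unfolding null_space_def
  proof (intro CollectI ballI)
    fix w assume w: "w \<in> tangent_space A Y q"
    have "\<omega> q (from_chart A c q (X (snd c q))) w = form_in_chart A \<omega> c (snd c q) (X (snd c q)) (to_chart A c q w)"
      using q chart_at(1) by (simp add: form_in_chart_def)
    also have "\<dots> = ell \<bullet> dd \<psi> (snd c q) (to_chart A c q w)" using omX q by (simp add: lam_def)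
    also have "\<dots> = 0" using tangent_imp[OF w q(2)] q F(3) by (intro ell_L) auto
    finally show "\<omega> q (from_chart A c q (X (snd c q))) w = 0" .
  qed
  ultimately show ?thesis
    using F(1,2,3) N0 smX by (intro exI[of _ N] exI[of _ X]) auto
qed

text \<open>The bound says that \<open>m\<close> does not exceed the dimension of the null spaces.
  Since these are isotropic, Hermitian products of null fields are real, so each unitary
  Gram-Schmidt step subtracts real multiples and does not leave the null spaces.\<close>

lemma null_frame_exists:
  assumes Y: "submanifold A Y d" "p \<in> Y" and co: "coisotropic A \<omega> Y"
    and m: "m + d \<le> 2 * CARD('n)"
  shows "\<exists>N e. open N \<and> snd (chart_at A p) p \<in> N \<and> N \<subseteq> chart_image (chart_at A p) UNIV \<and>
     (\<forall>i<m. smooth_on N (e i)) \<and> (\<forall>x\<in>N. unitary_in_chart (chart_at A p) x (\<lambda>i. e i x) m) \<and>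
     (\<forall>i<m. \<forall>q\<in>Y. q \<in> fst (chart_at A p) \<longrightarrow> snd (chart_at A p) q \<in> N \<longrightarrow>
        from_chart A (chart_at A p) q (e i (snd (chart_at A p) q)) \<in> null_space A \<omega> Y q)"
  using m
proof (induction m)
  case 0
  have "unitary_in_chart (chart_at A p) x (\<lambda>i. (\<lambda>_ _. 0) i x) 0" if "x \<in> chart_image (chart_at A p) UNIV" for x
    using hermitian_form.unitary_def[OF hermitian_chart[OF chart_at(1) that]] by blast
  then show ?case
    using open_image[OF chart_at(1)] chart_at
    by (intro exI[of _ "chart_image (chart_at A p) UNIV"] exI[of _ "\<lambda>_ _. 0"]) auto
next
  case (Suc m)
  let ?c = "chart_at A p" and ?x0 = "snd (chart_at A p) p"
  have c: "?c \<in> A" "p \<in> fst ?c" using chart_at by auto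
  obtain N1 e where 1: "open N1" "?x0 \<in> N1" "N1 \<subseteq> chart_image ?c UNIV"
     "\<forall>i<m. smooth_on N1 (e i)" "\<forall>x\<in>N1. unitary_in_chart ?c x (\<lambda>i. e i x) m"
     "\<forall>i<m. \<forall>q\<in>Y. q \<in> fst ?c \<longrightarrow> snd ?c q \<in> N1 \<longrightarrow> from_chart A ?c q (e i (snd ?c q)) \<in> null_space A \<omega> Y q"
    using Suc.IH Suc.prems by auto
  have null: "e i ?x0 \<in> null_space A \<omega> Y p" if "i < m" for i
    using 1(6) that Y c 1(2) by fastforce
  have "\<not> null_space A \<omega> Y p \<subseteq> span ((\<lambda>i. e i ?x0) ` {..<m})"
  proof
    assume "null_space A \<omega> Y p \<subseteq> span ((\<lambda>i. e i ?x0) ` {..<m})"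
    then have "dim (null_space A \<omega> Y p) \<le> card ((\<lambda>i. e i ?x0) ` {..<m})"
      by (rule dim_le_card) simp
    also have "\<dots> \<le> m" using card_image_le[of "{..<m}"] by simp
    finally show False using dim_null_space[OF Y] Suc.prems by linarith
  qed
  then obtain v where v: "v \<in> null_space A \<omega> Y p" "v \<notin> span ((\<lambda>i. e i ?x0) ` {..<m})" by blast
  obtain N2 X where 2: "open N2" "?x0 \<in> N2" "N2 \<subseteq> chart_image ?c UNIV" "smooth_on N2 X" "X ?x0 = v"
     "\<forall>q\<in>Y. q \<in> fst ?c \<longrightarrow> snd ?c q \<in> N2 \<longrightarrow> from_chart A ?c q (X (snd ?c q)) \<in> null_space A \<omega> Y q"
    using null_field_exists[OF Y v(1)] by auto
  have isotropic: "\<omega> q a b = 0" if "q \<in> Y" "a \<in> null_space A \<omega> Y q" "b \<in> null_space A \<omega> Y q" for q a b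
    using that co null_spaceD unfolding coisotropic_def by blast
  \<comment> \<open>By isotropy the complex projection is a real combination, and \<open>v\<close>
    was chosen outside the real span.\<close>
  have "X ?x0 \<noteq> (\<Sum>i<m. Hc ?c ?x0 (e i ?x0) (X ?x0) *s e i ?x0)"
  proof
    assume *: "X ?x0 = (\<Sum>i<m. Hc ?c ?x0 (e i ?x0) (X ?x0) *s e i ?x0)"
    have "om.H p (e i ?x0) v *s e i ?x0 = \<omega> p (e i ?x0) (Jop v) *\<^sub>R e i ?x0" if "i < m" for i
      using isotropic[OF Y(2) null[OF that] v(1)] by (simp add: om.H_def complex_scale_eq)
    then have "v = (\<Sum>i<m. \<omega> p (e i ?x0) (Jop v) *\<^sub>R e i ?x0)"
      using * by (simp add: 2(5) form_at_point)
    moreover have "(\<Sum>i<m. \<omega> p (e i ?x0) (Jop v) *\<^sub>R e i ?x0) \<in> span ((\<lambda>i. e i ?x0) ` {..<m})"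
      by (intro span_sum span_scale span_base) auto
    ultimately show False using v(2) by simp
  qed
  note step = gram_schmidt_step[OF c(1), of "N1 \<inter> N2" ?x0 m e X, OF _ _ _ _ _ _ this]
  obtain N' e' where 3: "open N'" "?x0 \<in> N'" "N' \<subseteq> N1 \<inter> N2" "smooth_on N' e'"
    "\<And>x. x \<in> N' \<Longrightarrow> unitary_in_chart ?c x (\<lambda>i. (e(m := e')) i x) (Suc m)"
    "\<And>x. x \<in> N' \<Longrightarrow> \<exists>r. e' x = r *\<^sub>R (X x - (\<Sum>i<m. Hc ?c x (e i x) (X x) *s e i x))"
  proof (rule step)
    show "smooth_on (N1 \<inter> N2) (e i)" if "i < m" for i
      using 1(4) that by (auto intro: smooth_on_subset)
    show "smooth_on (N1 \<inter> N2) X" using 2(4) by (auto intro: smooth_on_subset)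
  qed (use 1 2 in auto)
  have "from_chart A ?c q (e' (snd ?c q)) \<in> null_space A \<omega> Y q"
    if q: "q \<in> Y" "q \<in> fst ?c" "snd ?c q \<in> N'" for q
  proof -
    note lin = linear_from_chart[OF c(1) q(2)]
    let ?x = "snd ?c q"
    have x: "?x \<in> chart_image ?c UNIV" using q by simp
    obtain r where r: "e' ?x = r *\<^sub>R (X ?x - (\<Sum>i<m. Hc ?c ?x (e i ?x) (X ?x) *s e i ?x))" using 3(6) q by blast
    have ne: "from_chart A ?c q (e i ?x) \<in> null_space A \<omega> Y q" if "i < m" for i
      using 1(6) that q 3(3) by blast
    have nX: "from_chart A ?c q (X ?x) \<in> null_space A \<omega> Y q" using 2(6) q 3(3) by blast
    have "from_chart A ?c q (Hc ?c ?x (e i ?x) (X ?x) *s e i ?x) \<in> null_space A \<omega> Y q" if "i < m" for i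
    proof -
      have "form_in_chart A \<omega> ?c ?x (e i ?x) (X ?x) = 0"
        using isotropic[OF q(1) ne[OF that] nX] c q by (simp add: form_in_chart_def)
      then have "Hc ?c ?x (e i ?x) (X ?x) *s e i ?x = Re (Hc ?c ?x (e i ?x) (X ?x)) *\<^sub>R e i ?x"
        by (simp add: complex_scale_eq hermitian_form.H_def[OF hermitian_chart[OF c(1) x]])
      then show ?thesis
        using ne[OF that] by (simp add: linear_scale[OF lin] subspace_scale[OF subspace_null_space])
    qed
    then show ?thesis
      unfolding r using nX
      by (auto simp: linear_scale[OF lin] linear_diff[OF lin] linear_sum[OF lin]
          intro!: subspace_scale[OF subspace_null_space] subspace_diff[OF subspace_null_space] subspace_sum[OF subspace_null_space])
  qed
  moreover have "from_chart A ?c q (e i (snd ?c q)) \<in> null_space A \<omega> Y q"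
    if "i < m" "q \<in> Y" "q \<in> fst ?c" "snd ?c q \<in> N'" for q i
    using 1(6) that 3(3) by blast
  moreover have "smooth_on N' (e i)" if "i < m" for i
    using 1(4) that 3(3) by (auto intro: smooth_on_subset)
  ultimately show ?case
    using 1(3) 3(1-5) by (intro exI[of _ N'] exI[of _ "e(m := e')"]) (auto simp: less_Suc_eq)
qed

lemma unitary_frame_iff: "unitary_frame \<omega> p e \<longleftrightarrow> om.unitary p e CARD('n)"
  unfolding unitary_frame_def om.unitary_def metric_def om.H_def
  by (auto simp: complex_eq_iff om.om_simps om.om_Jop_left split: if_splits)

text \<open>Each span lies in its space and has the right dimension: \<open>n - k\<close> leaf
  vectors for the null space, and \<open>n + k\<close> vectors, all pairing to zero with the leaf
  vectors, for the tangent space.\<close>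

lemma unitary_frame_spans:
  assumes Y: "submanifold A Y (CARD('n) + k)" "q \<in> Y" and u: "om.unitary q E CARD('n)"
    and null: "\<And>j. k \<le> j \<Longrightarrow> j < CARD('n) \<Longrightarrow> E j \<in> null_space A \<omega> Y q"
  shows "null_space A \<omega> Y q = span (E ` {k..<CARD('n)})" (is ?null)
    and "tangent_space A Y q = span (E ` {..<CARD('n)} \<union> (\<lambda>j. Jop (E j)) ` {..<k})" (is ?tan)
proof -
  let ?n = "CARD('n)"
  have k: "k \<le> ?n" using dim_null_space[OF Y] by linarith
  note on = om.unitary_real_orthonormal[OF u]
  have "inj_on (\<lambda>i. E (k + i)) {..<?n - k}" "independent ((\<lambda>i. E (k + i)) ` {..<?n - k})"
    by (rule om.real_orthonormal_independent[where p = q]; use on in auto)+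
  moreover have img: "(\<lambda>i. E (k + i)) ` {..<?n - k} = E ` {k..<?n}"
  proof -
    have "(+) k ` {..<?n - k} = {k..<?n}" using k by (simp add: lessThan_atLeast0)
    then show ?thesis by (metis image_image)
  qed
  ultimately have "independent (E ` {k..<?n})" "card (E ` {k..<?n}) = ?n - k"
    using card_image by fastforce+
  then have "dim (span (E ` {k..<?n})) = ?n - k" by (metis dim_span_eq_card_independent)
  moreover have "span (E ` {k..<?n}) \<subseteq> null_space A \<omega> Y q"
    by (rule span_minimal[OF _ subspace_null_space]) (use null in auto)
  ultimately show null_eq: ?null
    using subspace_dim_equal[OF subspace_span subspace_null_space] dim_null_space[OF Y] by fastforce
  have in_T: "w \<in> tangent_space A Y q" if "\<And>j. k \<le> j \<Longrightarrow> j < ?n \<Longrightarrow> \<omega> q (E j) w = 0" for w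
  proof -
    have "subspace {v. \<omega> q v w = 0}" by (rule subspaceI) (simp_all add: om.om_simps)
    then have "span (E ` {k..<?n}) \<subseteq> {v. \<omega> q v w = 0}" by (rule span_minimal[rotated]) (use that in auto)
    then have "\<omega> q w v = 0" if "v \<in> null_space A \<omega> Y q" for v
      using that null_eq om.skew[of q w v] by auto
    then show ?thesis unfolding tangent_space_from_null[OF Y] by blast
  qed
  \<comment> \<open>The tangent frame as a single real orthonormal family: all of \<open>E\<close>
    first, then the images under J of the transverse vectors.\<close>
  define b where "b i = (if i < ?n then E i else Jop (E (i - ?n)))" for i
  have b_on: "\<omega> q (b i) (Jop (b j)) = (if i = j then 1 else 0)" if "i < ?n + k" "j < ?n + k" for i j
    using that k on[of i j] on[of i "j - ?n"] on[of "i - ?n" j] on[of "i - ?n" "j - ?n"]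
    by (auto simp: b_def om.om_simps om.om_Jop om.om_Jop_left)
  have b_img: "b ` {..<?n + k} = E ` {..<?n} \<union> (\<lambda>j. Jop (E j)) ` {..<k}"
  proof -
    have "{..<?n + k} = {..<?n} \<union> (+) ?n ` {..<k}" by (auto simp: lessThan_atLeast0)
    moreover have "b ` {..<?n} = E ` {..<?n}" by (rule image_cong) (simp_all add: b_def)
    moreover have "b (?n + j) = Jop (E j)" for j by (simp add: b_def)
    then have "b ` (+) ?n ` {..<k} = (\<lambda>j. Jop (E j)) ` {..<k}" by (simp only: image_image)
    ultimately show ?thesis by (simp only: image_Un)
  qed
  have "card (b ` {..<?n + k}) = ?n + k" "independent (b ` {..<?n + k})"
    using om.real_orthonormal_independent[where p = q and m = "?n + k" and b = b, OF b_on] card_image by fastforce+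
  then have "dim (span (b ` {..<?n + k})) = ?n + k" by (metis dim_span_eq_card_independent)
  moreover have "span (b ` {..<?n + k}) \<subseteq> tangent_space A Y q"
  proof (rule span_minimal[OF _ submanifold_tangent(1)[OF Y]])
    show "b ` {..<?n + k} \<subseteq> tangent_space A Y q"
      unfolding b_img using on k by (auto intro!: in_T)
  qed
  ultimately show ?tan
    unfolding b_img[symmetric]
    using subspace_dim_equal[OF subspace_span submanifold_tangent(1)[OF Y]] submanifold_tangent(2)[OF Y] by fastforce
qed

lemma adapted_frame_exists:
  assumes Y: "submanifold A Y (CARD('n) + k)" "p \<in> Y" and co: "coisotropic A \<omega> Y"
  shows "\<exists>U E. adapted_frame A \<omega> Y k U E \<and> p \<in> U"
proof -
  let ?n = "CARD('n)" and ?c = "chart_at A p" and ?x0 = "snd (chart_at A p) p"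
  have c: "?c \<in> A" "p \<in> fst ?c" using chart_at by auto
  have k: "k \<le> ?n" using dim_null_space[OF Y] by linarith
  obtain N1 e1 where 1: "open N1" "?x0 \<in> N1" "N1 \<subseteq> chart_image ?c UNIV"
     "\<forall>i<?n - k. smooth_on N1 (e1 i)" "\<forall>x\<in>N1. unitary_in_chart ?c x (\<lambda>i. e1 i x) (?n - k)"
     "\<forall>i<?n - k. \<forall>q\<in>Y. q \<in> fst ?c \<longrightarrow> snd ?c q \<in> N1 \<longrightarrow> from_chart A ?c q (e1 i (snd ?c q)) \<in> null_space A \<omega> Y q"
    using null_frame_exists[OF Y co, of "?n - k"] k by auto
  obtain N e where N: "open N" "?x0 \<in> N" "N \<subseteq> N1" "\<forall>i<?n. smooth_on N (e i)"
     "\<forall>x\<in>N. unitary_in_chart ?c x (\<lambda>i. e i x) ?n" "\<forall>i<?n - k. e i = e1 i"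
    using unitary_frame_extend[OF c(1) 1(1,3,2), of "?n - k" e1 ?n] 1(4,5) by auto
  \<comment> \<open>The null frame was built first and occupies the low indices of \<open>e\<close>;
    an adapted frame lists the leaf directions last.\<close>
  define s where "s j = (if j < k then ?n - k + j else j - k)" for j
  have s: "s j < ?n" if "j < ?n" for j using that k by (auto simp: s_def)
  have s_eq: "s i = s j \<longleftrightarrow> i = j" if "i < ?n" "j < ?n" for i j using that k by (auto simp: s_def)
  define E where "E j q = from_chart A ?c q (e (s j) (snd ?c q))" for j q
  let ?U = "param ?c ` N"
  have sub: "N \<subseteq> chart_image ?c UNIV" using N 1 by auto
  have pt: "q \<in> fst ?c" "snd ?c q \<in> N" if "q \<in> ?U" for q
    using that sub c by (auto simp: subset_iff)
  have un: "om.unitary q (\<lambda>j. E j q) ?n" if "q \<in> ?U" for q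
    unfolding om.unitary_def
  proof (intro allI impI)
    fix i j assume ij: "i < ?n" "j < ?n"
    have x: "snd ?c q \<in> chart_image ?c UNIV" using pt[OF that] by simp
    interpret h: hermitian_form "form_in_chart A \<omega> ?c (snd ?c q)" by (rule hermitian_chart[OF c(1) x])
    have "om.H q (E i q) (E j q) = h.H (e (s i) (snd ?c q)) (e (s j) (snd ?c q))"
      using pt[OF that] c by (simp add: om.H_def h.H_def E_def form_in_chart_def from_chart_Jop)
    also have "\<dots> = (if i = j then 1 else 0)"
      using h.unitaryD[of "\<lambda>i. e i (snd ?c q)" ?n "s i" "s j"] N(5) pt[OF that] s ij s_eq by simp
    finally show "om.H q (E i q) (E j q) = (if i = j then 1 else 0)" .
  qed
  have null: "E j q \<in> null_space A \<omega> Y q" if "k \<le> j" "j < ?n" "q \<in> Y \<inter> ?U" for j q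
    using that 1(6) N(3,6) pt[of q] k by (auto simp: E_def s_def subset_iff)
  have "adapted_frame A \<omega> Y k ?U E"
    unfolding adapted_frame_def
  proof (intro conjI ballI allI impI)
    show "open ?U" by (rule open_param_image[OF c(1) N(1) sub])
    show "smooth_field A (Y \<inter> ?U) (E j)" if "j < ?n" for j
      unfolding E_def by (rule smooth_field_of_chart[OF c(1) N(1) sub]) (use N(4) s that in auto)
    fix q assume q: "q \<in> Y \<inter> ?U"
    show "unitary_frame \<omega> q (\<lambda>j. E j q)" unfolding unitary_frame_iff using un q by blast
    show "tangent_space A Y q = span ((\<lambda>j. E j q) ` {..<?n} \<union> (\<lambda>j. Jop (E j q)) ` {..<k})"
      "null_space A \<omega> Y q = span ((\<lambda>j. E j q) ` {k..<?n})"
      by (rule unitary_frame_spans[OF Y(1)]; use q un null in blast)+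
  qed
  moreover have "p \<in> ?U" using N(2) c by (metis imageI param_snd)
  ultimately show ?thesis by blast
qed

end

section \<open>The volume form and the Maslov charge\<close>

lemma top_form_add:
  assumes "top_form (\<alpha> :: 'n::finite form)" "length ws = CARD('n)" "i < CARD('n)"
  shows "\<alpha> (ws[i := z *s u + v]) = z * \<alpha> (ws[i := u]) + \<alpha> (ws[i := v])"
  using assms unfolding top_form_def by blast

lemma top_form_alternating:
  assumes "top_form (\<alpha> :: 'n::finite form)" "length ws = CARD('n)" "i < CARD('n)" "j < CARD('n)" "i \<noteq> j" "ws ! i = ws ! j"
  shows "\<alpha> ws = 0"
  using assms unfolding top_form_def by (metis nat_neq_iff)

lemma top_form_zero:
  assumes "top_form (\<alpha> :: 'n::finite form)" "length ws = CARD('n)" "i < CARD('n)"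
  shows "\<alpha> (ws[i := 0]) = 0"
  using top_form_add[OF assms, of 1 0 0] by simp

lemma top_form_scale:
  assumes "top_form (\<alpha> :: 'n::finite form)" "length ws = CARD('n)" "i < CARD('n)"
  shows "\<alpha> (ws[i := z *s u]) = z * \<alpha> (ws[i := u])"
  using top_form_add[OF assms, of z u 0] top_form_zero[OF assms] by simp

lemma top_form_sum:
  assumes "top_form (\<alpha> :: 'n::finite form)" "length ws = CARD('n)" "i < CARD('n)"
  shows "\<alpha> (ws[i := (\<Sum>j\<in>I. z j *s f j)]) = (\<Sum>j\<in>I. z j * \<alpha> (ws[i := f j]))"
  by (induction I rule: infinite_finite_induct)
    (simp_all add: top_form_zero[OF assms] top_form_add[OF assms])

lemma top_form_linear:
  assumes "top_form (\<alpha> :: 'n::finite form)" "length ws = CARD('n)" "i < CARD('n)"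
  shows "linear (\<lambda>a. \<alpha> (ws[i := a]))"
proof (rule linearI)
  show "\<alpha> (ws[i := a + b]) = \<alpha> (ws[i := a]) + \<alpha> (ws[i := b])" for a b
    using top_form_add[OF assms, of 1 a b] by simp
  show "\<alpha> (ws[i := r *\<^sub>R a]) = r *\<^sub>R \<alpha> (ws[i := a])" for r a
    using top_form_scale[OF assms, of "of_real r" a] by (simp add: complex_scale_eq scaleR_conv_of_real)
qed

text \<open>By complex linearity the real and the imaginary part of \<open>u_vec b\<close> each
  contribute half the value at \<open>b\<close>, so contracting with \<open>u_vec b\<close> is the
  same as inserting \<open>b\<close>. The induction runs from the right because the vector
  contracted last ends up next to \<open>ws\<close>.\<close>

lemma interior_u_vec:
  assumes \<alpha>: "top_form (\<alpha> :: 'n::finite form)" and "length bs + length ws = CARD('n)"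
  shows "interior (map u_vec bs) \<alpha> ws = \<alpha> (bs @ ws)"
  using assms(2)
proof (induction bs arbitrary: ws rule: rev_induct)
  case Nil
  then show ?case by (simp add: interior_def)
next
  case (snoc b bs)
  let ?l = "bs @ b # ws"
  have l: "length ?l = CARD('n)" "length bs < CARD('n)" using snoc.prems by auto
  have upd: "bs @ x # ws = ?l[length bs := x]" for x by simp
  have h: "(1/2) *\<^sub>R b = (1/2) *s b" "- ((1/2) *\<^sub>R Jop b) = (- \<i> / 2) *s b"
    by (simp_all add: complex_scale_eq)
  have "interior (map u_vec (bs @ [b])) \<alpha> ws =
      interior (map u_vec bs) \<alpha> (((1/2) *s b) # ws) + \<i> * interior (map u_vec bs) \<alpha> (((- \<i> / 2) *s b) # ws)"
  proof -
    have "fst (u_vec b) = (1/2) *s b" "snd (u_vec b) = (- \<i> / 2) *s b"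
      by (simp_all only: u_vec_def fst_conv snd_conv h)
    then show ?thesis by (simp only: interior_def interior1_def map_append fold_append list.map fold.simps o_apply id_apply)
  qed
  also have "\<dots> = \<alpha> (bs @ ((1/2) *s b) # ws) + \<i> * \<alpha> (bs @ ((- \<i> / 2) *s b) # ws)"
    using snoc.prems by (simp add: snoc.IH)
  also have "\<dots> = \<alpha> ?l"
    unfolding upd[of "_ *s b"] top_form_scale[OF \<alpha> l] by simp
  finally show ?case by simp
qed

text \<open>The block permutation between the two orders in play: the coframe lists transverse
  indices first, while the interior product puts leaf vectors first. Its inverse is
  \<open>rotation m k\<close>.\<close>

definition rotation :: "nat \<Rightarrow> nat \<Rightarrow> nat \<Rightarrow> nat" where
  "rotation k m i = (if i < k then m + i else if i < k + m then i - k else i)"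

lemma rotation_permutes: "rotation k m permutes {..<k + m}"
proof (rule bij_imp_permutes)
  show "bij_betw (rotation k m) {..<k + m} {..<k + m}"
    by (rule bij_betw_byWitness[where f' = "rotation m k"]) (auto simp: rotation_def)
qed (simp add: rotation_def)

lemma sign_square: "complex_of_int (sign \<pi>) * complex_of_int (sign \<pi>) = 1"
  by (simp add: sign_def)

lemma prod_lessThan_add:
  fixes f :: "nat \<Rightarrow> 'a::comm_monoid_mult"
  shows "prod f {..<k + m} = prod f {..<k} * (\<Prod>j<m. f (k + j))"
  by (induction m) (simp_all add: mult.assoc)

text \<open>A term survives only if each covector of index \<open>k + j\<close> meets its dual
  vector \<open>bs ! j\<close>, which forces the permutation to be \<open>rotation k m\<close> after
  a permutation of the first \<open>k\<close> indices.\<close>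

lemma wedge_append:
  assumes "length bs = m" "length ws = k"
    and dual: "\<And>i j. i < k + m \<Longrightarrow> j < m \<Longrightarrow> \<theta> i (bs ! j) = (if i = k + j then 1 else 0)"
  shows "wedge (k + m) \<theta> (bs @ ws) = of_int (sign (rotation k m)) * wedge k \<theta> ws"
proof -
  let ?r = "rotation k m"
  let ?t = "\<lambda>\<pi>. of_int (sign \<pi>) * (\<Prod>i<k + m. \<theta> i ((bs @ ws) ! \<pi> i))"
  let ?S = "{\<pi>. \<pi> permutes {..<k + m}}" and ?P = "{\<sigma>. \<sigma> permutes {..<k}}"
  have perm: "\<sigma> permutes {..<k + m}" if "\<sigma> permutes {..<k}" for \<sigma>
    by (rule permutes_subset[OF that]) auto
  have sub: "(\<lambda>\<sigma>. ?r \<circ> \<sigma>) ` ?P \<subseteq> ?S"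
    using permutes_compose[OF perm rotation_permutes] by auto
  have zero: "?t \<pi> = 0" if "\<pi> \<in> ?S - (\<lambda>\<sigma>. ?r \<circ> \<sigma>) ` ?P" for \<pi>
  proof (rule ccontr)
    assume nz: "?t \<pi> \<noteq> 0"
    have \<pi>: "\<pi> permutes {..<k + m}" using that by simp
    have inv_eq: "\<pi> (k + j) = j" if j: "j < m" for j
    proof -
      have "j \<in> \<pi> ` {..<k + m}" using permutes_image[OF \<pi>] j by simp
      then obtain i where i: "i < k + m" "\<pi> i = j" by auto
      have "\<theta> i ((bs @ ws) ! \<pi> i) \<noteq> 0" using nz i by auto
      then have "i = k + j" using dual[OF i(1) j] i j assms by (auto simp: nth_append split: if_splits)
      then show ?thesis using i by simp
    qed
    let ?\<sigma> = "inv ?r \<circ> \<pi>"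
    have "?\<sigma> permutes {..<k}"
    proof (rule permutes_superset)
      show "?\<sigma> permutes {..<k + m}"
        by (rule permutes_compose[OF \<pi> permutes_inv[OF rotation_permutes]])
      show "?\<sigma> x = x" if x: "x \<in> {..<k + m} - {..<k}" for x
      proof -
        obtain j where j: "x = k + j" "j < m" using x le_Suc_ex[of k x] by auto
        have "?r x = j" using j by (simp add: rotation_def)
        then show ?thesis using inv_eq[OF j(2)] j permutes_inverses(2)[OF rotation_permutes, of k m x] by simp
      qed
    qed
    moreover have "\<pi> = ?r \<circ> ?\<sigma>"
      using permutes_inv_o(1)[OF rotation_permutes, of k m] by (simp add: o_assoc)
    ultimately show False using that by blast
  qed
  have inj: "inj_on (\<lambda>\<sigma>. ?r \<circ> \<sigma>) ?P"
  proof (rule inj_onI)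
    fix \<sigma> \<tau> assume "?r \<circ> \<sigma> = ?r \<circ> \<tau>"
    then have "inv ?r \<circ> (?r \<circ> \<sigma>) = inv ?r \<circ> (?r \<circ> \<tau>)" by simp
    then show "\<sigma> = \<tau>" using permutes_inv_o(2)[OF rotation_permutes, of k m] by (simp add: o_assoc)
  qed
  have "wedge (k + m) \<theta> (bs @ ws) = (\<Sum>\<pi>\<in>(\<lambda>\<sigma>. ?r \<circ> \<sigma>) ` ?P. ?t \<pi>)"
    unfolding wedge_def by (rule sum.mono_neutral_right) (use sub zero finite_permutations in auto)
  also have "\<dots> = (\<Sum>\<sigma>\<in>?P. ?t (?r \<circ> \<sigma>))" by (simp add: sum.reindex[OF inj])
  also have "\<dots> = (\<Sum>\<sigma>\<in>?P. of_int (sign ?r) * (of_int (sign \<sigma>) * (\<Prod>i<k. \<theta> i (ws ! \<sigma> i))))"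
  proof (rule sum.cong[OF refl])
    fix \<sigma> assume "\<sigma> \<in> ?P"
    then have \<sigma>: "\<sigma> permutes {..<k}" by simp
    have "sign (?r \<circ> \<sigma>) = sign ?r * sign \<sigma>"
      using \<sigma> rotation_permutes by (intro sign_compose) (auto intro: permutes_imp_permutation)
    moreover have "(\<Prod>i<k + m. \<theta> i ((bs @ ws) ! (?r \<circ> \<sigma>) i)) = (\<Prod>i<k. \<theta> i (ws ! \<sigma> i))"
    proof -
      have "(\<Prod>i<k. \<theta> i ((bs @ ws) ! (?r \<circ> \<sigma>) i)) = (\<Prod>i<k. \<theta> i (ws ! \<sigma> i))"
        using permutes_in_image[OF \<sigma>] assms by (intro prod.cong) (auto simp: rotation_def nth_append)
      moreover have "(\<Prod>j<m. \<theta> (k + j) ((bs @ ws) ! (?r \<circ> \<sigma>) (k + j))) = 1"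
        using permutes_not_in[OF \<sigma>] dual assms by (intro prod.neutral) (auto simp: rotation_def nth_append)
      ultimately show ?thesis unfolding prod_lessThan_add by simp
    qed
    ultimately show "?t (?r \<circ> \<sigma>) = of_int (sign ?r) * (of_int (sign \<sigma>) * (\<Prod>i<k. \<theta> i (ws ! \<sigma> i)))"
      by simp
  qed
  also have "\<dots> = of_int (sign ?r) * wedge k \<theta> ws"
    by (simp add: wedge_def sum_distrib_left)
  finally show ?thesis .
qed

text \<open>The case of \<open>wedge_append\<close> with no remaining vectors. Up to sign the value
  is 1, which suffices because only squares and moduli are taken of it.\<close>

lemma wedge_dual:
  assumes "length bs = m" "\<And>i j. i < m \<Longrightarrow> j < m \<Longrightarrow> \<theta> i (bs ! j) = (if i = j then 1 else 0)"
  shows "wedge m \<theta> bs * wedge m \<theta> bs = 1"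
proof -
  have "wedge 0 \<theta> [] = 1" by (simp add: wedge_def)
  moreover have "wedge (0 + m) \<theta> (bs @ []) = of_int (sign (rotation 0 m)) * wedge 0 \<theta> []"
    by (rule wedge_append) (use assms in auto)
  ultimately show ?thesis by (simp add: sign_square)
qed

lemma wedge_cong: "(\<And>i w. i < m \<Longrightarrow> \<theta> i w = \<theta>' i w) \<Longrightarrow> wedge m \<theta> ws = wedge m \<theta>' ws"
  unfolding wedge_def by (intro sum.cong prod.cong arg_cong2[of _ _ _ _ "(*)"]) auto

lemma wedge_real:
  assumes "length ws = m" "\<And>i j. i < m \<Longrightarrow> j < m \<Longrightarrow> \<theta> i (ws ! j) \<in> \<real>" shows "wedge m \<theta> ws \<in> \<real>"
  unfolding wedge_def
proof (intro sum_in_Reals Reals_mult prod_in_Reals)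
  fix \<pi> i assume "\<pi> \<in> {\<pi>. \<pi> permutes {..<m}}" "i \<in> {..<m}"
  then show "\<theta> i (ws ! \<pi> i) \<in> \<real>" using assms permutes_in_image[of \<pi> "{..<m}" i] by auto
qed simp

section \<open>The volume form on fields along a submanifold\<close>

locale calabi_yau_manifold = kaehler_manifold A \<omega>
  for A :: "('x::topological_space, 'n::finite) chart set" and \<omega> +
  fixes \<Omega> :: "'x \<Rightarrow> 'n form"
  assumes calabi_yau: "calabi_yau A \<omega> \<Omega>"
begin

lemma top_form_Omega: "top_form (\<Omega> q)"
  and Omega_smooth: "c \<in> A \<Longrightarrow> length ws = CARD('n) \<Longrightarrow>
    smooth_on (chart_image c UNIV) (\<lambda>x. \<Omega> (param c x) (map (from_chart A c (param c x)) ws))"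
  and parallel: "parallel_form A \<omega> \<Omega>"
  and unit_length: "unit_length_form \<omega> \<Omega>"
  using calabi_yau unfolding calabi_yau_def holomorphic_volume_form_def holomorphic_fun_on_def by blast+

text \<open>Holomorphic components provide smoothness on constant vectors. The constant arguments
  are exchanged for fields one slot at a time, by linearity in that slot; \<open>m\<close> counts
  the slots already exchanged.\<close>

lemma Omega_smooth_fields:
  assumes c: "c \<in> A" and N: "open N" "N \<subseteq> chart_image c UNIV" and h: "\<And>i. i < CARD('n) \<Longrightarrow> smooth_on N (h i)"
  shows "smooth_on N (\<lambda>x. \<Omega> (param c x) (map (\<lambda>i. from_chart A c (param c x) (h i x)) [0..<CARD('n)]))"
proof -
  let ?n = "CARD('n)"
  have "smooth_on N (\<lambda>x. \<Omega> (param c x) (map (from_chart A c (param c x))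
      (map (\<lambda>i. if i < m then h i x else ws ! i) [0..<?n])))" if "m \<le> ?n" "length ws = ?n" for m ws
    using that
  proof (induction m arbitrary: ws)
    case 0
    have "map (\<lambda>i. ws ! i) [0..<?n] = ws" using 0 by (metis map_nth)
    then show ?case using smooth_on_subset[OF Omega_smooth[OF c] N(2)] 0 by simp
  next
    case (Suc m)
    let ?l = "\<lambda>x a. map (\<lambda>i. if i < m then h i x else (ws[m := a]) ! i) [0..<?n]"
    let ?L = "\<lambda>x a. \<Omega> (param c x) (map (from_chart A c (param c x)) (?l x a))"
    have upd: "map (from_chart A c (param c x)) (?l x a) =
        (map (from_chart A c (param c x)) (?l x 0))[m := from_chart A c (param c x) a]" for x a
      using Suc.prems by (intro nth_equalityI) (auto simp: nth_list_update)
    have "smooth_on N (\<lambda>x. ?L x (h m x))"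
    proof (rule smooth_on_linear_family[where L = ?L and h = "h m", OF N(1)])
      show "linear (?L x)" if "x \<in> N" for x
      proof -
        have "linear (from_chart A c (param c x))"
          by (rule linear_from_chart[OF c]) (use that N c in auto)
        then have "linear ((\<lambda>a. \<Omega> (param c x) ((map (from_chart A c (param c x)) (?l x 0))[m := a])) \<circ> from_chart A c (param c x))"
          using Suc.prems by (intro linear_compose[rotated] top_form_linear top_form_Omega) auto
        then show ?thesis unfolding o_def by (subst upd)
      qed
      show "smooth_on N (\<lambda>x. ?L x a)" for a using Suc.IH[of "ws[m := a]"] Suc.prems by simp
      show "smooth_on N (h m)" using h Suc.prems by simp
    qed
    moreover have "?l x (h m x) = map (\<lambda>i. if i < Suc m then h i x else ws ! i) [0..<?n]" for x
      using Suc.prems by (intro nth_equalityI) (auto simp: nth_list_update less_Suc_eq)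
    ultimately show ?case by simp
  qed
  \<comment> \<open>Once all slots are exchanged the starting vectors no longer occur, so zeros will
    do.\<close>
  from this[of ?n "replicate ?n 0"] have "smooth_on N (\<lambda>x. \<Omega> (param c x) (map (from_chart A c (param c x))
      (map (\<lambda>i. if i < ?n then h i x else replicate ?n 0 ! i) [0..<?n])))" by simp
  moreover have "map (from_chart A c (param c x)) (map (\<lambda>i. if i < ?n then h i x else replicate ?n 0 ! i) [0..<?n]) =
      map (\<lambda>i. from_chart A c (param c x) (h i x)) [0..<?n]" for x by simp
  ultimately show ?thesis by (simp only:)
qed

lemma smooth_fields_rep:
  fixes E :: "nat \<Rightarrow> 'x \<Rightarrow> complex^'n"
  assumes E: "\<And>i. i < m \<Longrightarrow> smooth_field A (S \<inter> U) (E i)" and U: "open U" "p \<in> S \<inter> U" and c: "c \<in> A" "p \<in> fst c"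
  shows "\<exists>N h. open N \<and> snd c p \<in> N \<and> N \<subseteq> chart_image c U \<and> (\<forall>i<m. smooth_on N (h i)) \<and>
    (\<forall>i<m. \<forall>q\<in>S. q \<in> fst c \<longrightarrow> snd c q \<in> N \<longrightarrow> h i (snd c q) = to_chart A c q (E i q))"
  using E
proof (induction m)
  case 0
  show ?case using open_chart_image[OF c(1) U(1)] U(2) c by (intro exI[of _ "chart_image c U"]) auto
next
  case (Suc m)
  then obtain N h where 1: "open N" "snd c p \<in> N" "N \<subseteq> chart_image c U" "\<forall>i<m. smooth_on N (h i)"
    "\<forall>i<m. \<forall>q\<in>S. q \<in> fst c \<longrightarrow> snd c q \<in> N \<longrightarrow> h i (snd c q) = to_chart A c q (E i q)"
    by auto
  obtain N' k where 2: "open N'" "snd c p \<in> N'" "N' \<subseteq> chart_image c U" "smooth_on N' k"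
    "\<And>q. q \<in> S \<Longrightarrow> q \<in> fst c \<Longrightarrow> snd c q \<in> N' \<Longrightarrow> k (snd c q) = to_chart A c q (E m q)"
    using smooth_field_rep[OF Suc.prems[of m] U c] by auto
  have "smooth_on (N \<inter> N') ((h(m := k)) i)" if "i < Suc m" for i
    using that 1(4) smooth_on_subset[OF 2(4), of "N \<inter> N'"] smooth_on_subset[of N "h i" "N \<inter> N'"]
    by (cases "i = m") auto
  then show ?case
    using 1 2 by (intro exI[of _ "N \<inter> N'"] exI[of _ "h(m := k)"]) (auto simp: less_Suc_eq)
qed

lemma Omega_frame_smooth:
  assumes E: "\<And>i. i < CARD('n) \<Longrightarrow> smooth_field A (Y \<inter> U) (E i)" and U: "open U"
  shows "smooth_fun A (Y \<inter> U) (\<lambda>q. \<Omega> q (map (\<lambda>i. E i q) [0..<CARD('n)]))"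
  unfolding smooth_fun_def smooth_rel_def
proof (intro ballI)
  fix c y assume c: "c \<in> A" and y: "y \<in> chart_image c (Y \<inter> U)"
  have y1: "y \<in> chart_image c UNIV" "param c y \<in> Y \<inter> U" using chart_imageD c y by blast+
  obtain N h where N: "open N" "snd c (param c y) \<in> N" "N \<subseteq> chart_image c U" "\<forall>i<CARD('n). smooth_on N (h i)"
    "\<forall>i<CARD('n). \<forall>q\<in>Y. q \<in> fst c \<longrightarrow> snd c q \<in> N \<longrightarrow> h i (snd c q) = to_chart A c q (E i q)"
    using smooth_fields_rep[where E = E and m = "CARD('n)", OF E U y1(2) c param_in[OF c y1(1)]] by auto
  have sub: "N \<subseteq> chart_image c UNIV" using N(3) chart_imageD(1) by blast
  let ?h = "\<lambda>x. \<Omega> (param c x) (map (\<lambda>i. from_chart A c (param c x) (h i x)) [0..<CARD('n)])"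
  have "smooth_on N ?h" by (rule Omega_smooth_fields[OF c N(1) sub]) (use N(4) in auto)
  moreover have "?h z = ((\<lambda>q. \<Omega> q (map (\<lambda>i. E i q) [0..<CARD('n)])) \<circ> param c) z" if z: "z \<in> N \<inter> chart_image c (Y \<inter> U)" for z
  proof -
    have z1: "z \<in> chart_image c UNIV" "param c z \<in> Y" using chart_imageD z c by blast+
    have "from_chart A c (param c z) (h i z) = E i (param c z)" if "i < CARD('n)" for i
      using N(5) that z1 z c by (metis IntD1 from_to_chart param_in snd_param)
    then have "map (\<lambda>i. from_chart A c (param c z) (h i z)) [0..<CARD('n)] = map (\<lambda>i. E i (param c z)) [0..<CARD('n)]"
      by simp
    then show ?thesis by (simp only: o_apply)
  qed
  ultimately show "\<exists>N h. open N \<and> y \<in> N \<and> smooth_on N h \<and> (\<forall>z\<in>N \<inter> chart_image c (Y \<inter> U).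
      h z = ((\<lambda>q. \<Omega> q (map (\<lambda>i. E i q) [0..<CARD('n)])) \<circ> param c) z)"
    using N(1,2) c y1 by (intro exI[of _ N] exI[of _ ?h]) auto
qed

text \<open>\<open>parallel_form\<close> speaks of fields on open sets, but the frame lives on
  \<open>Y\<close>. Its components are extended in the preferred chart to ambient fields
  \<open>W\<close>, and the same extensions compute the derivatives along \<open>Y\<close> and in
  the ambient manifold.\<close>

lemma Omega_parallel_along:
  assumes E: "\<And>i. i < CARD('n) \<Longrightarrow> smooth_field A (Y \<inter> U) (E i)" and U: "open U" "p \<in> Y \<inter> U"
    and v: "v \<in> tangent_space A Y p"
  shows "deriv_along A Y (\<lambda>q. \<Omega> q (map (\<lambda>i. E i q) [0..<CARD('n)])) p v =
    (\<Sum>i<CARD('n). \<Omega> p ((map (\<lambda>i. E i p) [0..<CARD('n)])[i := nabla A \<omega> Y (E i) p v]))"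
proof -
  let ?n = "CARD('n)" and ?c = "chart_at A p" and ?x0 = "snd (chart_at A p) p"
  have c: "?c \<in> A" "p \<in> fst ?c" using chart_at by auto
  obtain N h where N: "open N" "?x0 \<in> N" "N \<subseteq> chart_image ?c U" "\<forall>i<?n. smooth_on N (h i)"
    "\<forall>i<?n. \<forall>q\<in>Y. q \<in> fst ?c \<longrightarrow> snd ?c q \<in> N \<longrightarrow> h i (snd ?c q) = to_chart A ?c q (E i q)"
    using smooth_fields_rep[where E = E and m = "CARD('n)", OF E U c] by auto
  have sub: "N \<subseteq> chart_image ?c UNIV" using N(3) chart_imageD(1) by blast
  let ?h = "\<lambda>x. \<Omega> (param ?c x) (map (\<lambda>i. from_chart A ?c (param ?c x) (h i x)) [0..<?n])"
  have smh: "smooth_on N ?h" by (rule Omega_smooth_fields[OF c(1) N(1) sub]) (use N(4) in auto)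
  define W where "W i q = from_chart A ?c q (h i (snd ?c q))" for i q
  let ?U = "param ?c ` N"
  have U': "open ?U" "p \<in> ?U" using open_param_image[OF c(1) N(1) sub] N(2) c by (auto simp: image_iff intro!: bexI[of _ ?x0])
  have smW: "smooth_field A (UNIV \<inter> ?U) (W i)" if "i < ?n" for i
    unfolding W_def by (rule smooth_field_of_chart[OF c(1) N(1) sub]) (use that N(4) in simp)
  have vU: "v \<in> tangent_space A UNIV p"
    using v unfolding tangent_space_def curve_in_def by auto
  have Wp: "W i p = E i p" if "i < ?n" for i using that N(2,5) c U(2) by (simp add: W_def)
  have nab: "nabla A \<omega> UNIV (W i) p v = nabla A \<omega> Y (E i) p v" if "i < ?n" for i
  proof -
    have "nabla A \<omega> UNIV (W i) p v = dd (h i) ?x0 v + christoffel A \<omega> ?c ?x0 v (W i p)"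
      by (rule nabla_rep[OF U'(1) _ vU N(1,2)]) (use U'(2) N(4) that c in \<open>auto simp: W_def\<close>)
    also have "\<dots> = nabla A \<omega> Y (E i) p v"
      by (subst nabla_rep[OF U v N(1,2), of "h i"]) (use N(4,5) that Wp in auto)
    finally show ?thesis .
  qed
  have "deriv_along A Y (\<lambda>q. \<Omega> q (map (\<lambda>i. E i q) [0..<?n])) p v = dd ?h ?x0 (to_chart A ?c p v)"
  proof (rule deriv_along_eq[OF v c N(1,2) smooth_on_differentiable[OF smh N(2)]])
    fix q assume q: "q \<in> Y" "q \<in> fst ?c" "snd ?c q \<in> N"
    have "map (\<lambda>i. from_chart A ?c q (h i (snd ?c q))) [0..<?n] = map (\<lambda>i. E i q) [0..<?n]"
      using N(5) q c by simp
    then show "?h (snd ?c q) = \<Omega> q (map (\<lambda>i. E i q) [0..<?n])"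
      by (simp only: param_snd[OF c(1) q(2)])
  qed
  also have "\<dots> = deriv_along A UNIV (\<lambda>q. \<Omega> q (map (\<lambda>W. W q) (map W [0..<?n]))) p v"
    by (rule deriv_along_eq[OF vU c N(1,2) smooth_on_differentiable[OF smh N(2)], symmetric])
      (use c in \<open>simp add: W_def o_def\<close>)
  also have "\<dots> = (\<Sum>i<?n. \<Omega> p ((map (\<lambda>W. W p) (map W [0..<?n]))[i := nabla A \<omega> UNIV (map W [0..<?n] ! i) p v]))"
    using parallel[unfolded parallel_form_def, rule_format, of ?U p "map W [0..<?n]" v] U' smW by auto
  also have "\<dots> = (\<Sum>i<?n. \<Omega> p ((map (\<lambda>i. E i p) [0..<?n])[i := nabla A \<omega> Y (E i) p v]))"
  proof (rule sum.cong[OF refl])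
    fix i assume "i \<in> {..<?n}"
    then have i: "i < ?n" by simp
    have "map (\<lambda>W. W p) (map W [0..<?n]) = map (\<lambda>i. E i p) [0..<?n]" using Wp by simp
    moreover have "map W [0..<?n] ! i = W i" using i by simp
    ultimately show "\<Omega> p ((map (\<lambda>W. W p) (map W [0..<?n]))[i := nabla A \<omega> UNIV (map W [0..<?n] ! i) p v]) =
        \<Omega> p ((map (\<lambda>i. E i p) [0..<?n])[i := nabla A \<omega> Y (E i) p v])"
      by (simp only: nab[OF i])
  qed
  finally show ?thesis .
qed

text \<open>When \<open>z i\<close> is expanded in the frame, every component other than the one
  along \<open>E i\<close> repeats an argument of the alternating form.\<close>

lemma Omega_trace:
  assumes u: "om.unitary p E CARD('n)"
  shows "(\<Sum>i<CARD('n). \<Omega> p ((map E [0..<CARD('n)])[i := z i])) =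
    \<Omega> p (map E [0..<CARD('n)]) * (\<Sum>i<CARD('n). om.H p (E i) (z i))"
proof -
  let ?n = "CARD('n)" and ?l = "map E [0..<CARD('n)]"
  have "\<Omega> p (?l[i := z i]) = \<Omega> p ?l * om.H p (E i) (z i)" if i: "i < ?n" for i
  proof -
    have l: "length ?l = ?n" by simp
    have "\<Omega> p (?l[i := z i]) = \<Omega> p (?l[i := (\<Sum>j<?n. om.H p (E j) (z i) *s E j)])"
      using om.unitary_expand[OF u, of "z i"] by simp
    also have "\<dots> = (\<Sum>j<?n. om.H p (E j) (z i) * \<Omega> p (?l[i := E j]))"
      by (rule top_form_sum[OF top_form_Omega l i])
    also have "\<dots> = (\<Sum>j<?n. if j = i then om.H p (E i) (z i) * \<Omega> p ?l else 0)"
    proof (rule sum.cong[OF refl])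
      fix j assume "j \<in> {..<?n}"
      then have j: "j < ?n" by simp
      show "om.H p (E j) (z i) * \<Omega> p (?l[i := E j]) = (if j = i then om.H p (E i) (z i) * \<Omega> p ?l else 0)"
      proof (cases "j = i")
        case True
        have "?l[i := E i] = ?l" using i by (intro list_update_same_conv[THEN iffD2]) auto
        then show ?thesis using True by simp
      next
        case False
        have "\<Omega> p (?l[i := E j]) = 0"
          by (rule top_form_alternating[OF top_form_Omega _ i j]) (use False i j in auto)
        then show ?thesis using False by simp
      qed
    qed
    also have "\<dots> = \<Omega> p ?l * om.H p (E i) (z i)" using i by (simp add: mult.commute)
    finally show ?thesis .
  qed
  then show ?thesis by (simp add: sum_distrib_left)
qed

lemma coframe_eq: "coframe \<omega> p e j w = om.H p (e j) w"
  by (simp add: coframe_def metric_def om.H_def om.om_Jop)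

text \<open>The choice is satisfiable, as the leaf part of \<open>E\<close> shows. The length is not
  prescribed by the choice but equals the dimension, since orthonormal vectors are
  independent.\<close>

lemma leaf_basis:
  assumes u: "om.unitary q E CARD('n)" and null: "null_space A \<omega> Y q = span (E ` {k..<CARD('n)})"
    and k: "k \<le> CARD('n)"
  shows "length (leaf_basis A \<omega> Y q) = CARD('n) - k"
    and "span (set (leaf_basis A \<omega> Y q)) = null_space A \<omega> Y q"
    and "\<And>i j. i < CARD('n) - k \<Longrightarrow> j < CARD('n) - k \<Longrightarrow>
      \<omega> q (leaf_basis A \<omega> Y q ! i) (Jop (leaf_basis A \<omega> Y q ! j)) = (if i = j then 1 else 0)"
proof -
  let ?n = "CARD('n)" and ?b = "leaf_basis A \<omega> Y q"
  let ?P = "\<lambda>bs. span (set bs) = null_space A \<omega> Y q \<and>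
        (\<forall>i<length bs. \<forall>j<length bs. metric \<omega> q (bs ! i) (bs ! j) = (if i = j then 1 else 0))"
  have len: "length bs = dim (null_space A \<omega> Y q)" if "?P bs" for bs
  proof -
    have on: "\<omega> q (bs ! i) (Jop (bs ! j)) = (if i = j then 1 else 0)" if "i < length bs" "j < length bs" for i j
      using \<open>?P bs\<close> that by (simp add: metric_def)
    have img: "(!) bs ` {..<length bs} = set bs" by (simp add: set_conv_nth image_def lessThan_def) blast
    have "card (set bs) = length bs" "independent (set bs)"
      using om.real_orthonormal_independent[where p = q and m = "length bs" and b = "(!) bs", OF on]
        card_image[of "(!) bs" "{..<length bs}"] img by auto
    then show ?thesis using that by (metis dim_span_eq_card_independent)
  qed
  have "?P (map E [k..<?n])"
    using om.unitary_real_orthonormal(1)[OF u] by (simp add: null metric_def)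
  then have P: "?P ?b" unfolding leaf_basis_def by (rule someI)
  then show "span (set ?b) = null_space A \<omega> Y q" by simp
  show l: "length ?b = ?n - k"
    using len[OF P] len[OF \<open>?P (map E [k..<?n])\<close>] by simp
  show "\<omega> q (?b ! i) (Jop (?b ! j)) = (if i = j then 1 else 0)" if "i < ?n - k" "j < ?n - k" for i j
    using P that l by (simp add: metric_def)
qed

lemma Omega_unit:
  assumes u: "om.unitary q E CARD('n)"
  shows "cmod (\<Omega> q (map E [0..<CARD('n)])) = 1"
proof -
  let ?n = "CARD('n)" and ?l = "map E [0..<CARD('n)]"
  have "unitary_frame \<omega> q E" using u unitary_frame_iff by blast
  then obtain f where f: "cmod f = 1" "\<And>ws. length ws = ?n \<Longrightarrow> \<Omega> q ws = f * wedge ?n (coframe \<omega> q E) ws"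
    using unit_length unfolding unit_length_form_def by blast
  have "wedge ?n (coframe \<omega> q E) ?l * wedge ?n (coframe \<omega> q E) ?l = 1"
    by (rule wedge_dual) (simp_all add: coframe_eq om.unitaryD[OF u])
  then have "cmod (wedge ?n (coframe \<omega> q E) ?l) * cmod (wedge ?n (coframe \<omega> q E) ?l) = 1"
    by (metis norm_mult norm_one)
  then have "cmod (wedge ?n (coframe \<omega> q E) ?l) = 1"
    by (metis abs_norm_cancel abs_square_eq_1 power2_eq_square)
  then show ?thesis using f by (simp add: norm_mult)
qed

text \<open>The basis chosen at \<open>q\<close> is related to \<open>E\<close> only by spanning the
  same leaf space. The two are compared through a mixed frame, and the square removes the resulting
  sign.\<close>

lemma maslov_charge_eq:
  assumes u: "om.unitary q E CARD('n)" and null: "null_space A \<omega> Y q = span (E ` {k..<CARD('n)})"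
    and tan: "\<And>j. j < CARD('n) \<Longrightarrow> E j \<in> tangent_space A Y q"
    and k: "k \<le> CARD('n)" and ws: "length ws = k" "length ws' = k"
  shows "maslov_charge A \<omega> \<Omega> Y q ws ws' =
    (\<Omega> q (map E [0..<CARD('n)]))\<^sup>2 * (wedge k (coframe \<omega> q E) ws * wedge k (coframe \<omega> q E) ws')"
proof -
  let ?n = "CARD('n)" and ?l = "map E [0..<CARD('n)]" and ?b = "leaf_basis A \<omega> Y q"
  note lb = leaf_basis[OF u null k]
  have b_null: "?b ! i \<in> null_space A \<omega> Y q" if "i < ?n - k" for i
    using lb(1,2) that by (metis nth_mem span_base)
  \<comment> \<open>Transverse vectors of \<open>E\<close> followed by the chosen leaf basis: again
    a unitary frame, and its first \<open>k\<close> covectors are those of \<open>E\<close>.\<close>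
  define E' where "E' j = (if j < k then E j else ?b ! (j - k))" for j
  have om_E': "\<omega> q (E' i) (E j) = 0" if "i < ?n" "j < ?n" for i j
    using om.unitary_real_orthonormal(2)[OF u] null_spaceD[OF b_null tan] that by (auto simp: E'_def)
  have E'_n: "E' j \<in> null_space A \<omega> Y q" if "k \<le> j" "j < ?n" for j using b_null that by (simp add: E'_def)
  have null_om: "\<omega> q v w = 0" if "\<And>j. j < ?n \<Longrightarrow> \<omega> q v (E j) = 0" "w \<in> null_space A \<omega> Y q" for v w
  proof -
    have "subspace {w. \<omega> q v w = 0}" by (rule subspaceI) (simp_all add: om.om_simps)
    then have "span (E ` {k..<?n}) \<subseteq> {w. \<omega> q v w = 0}" by (rule span_minimal[rotated]) (use that in auto)
    then show ?thesis using that(2) null by auto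
  qed
  have g_null: "\<omega> q (E j) (Jop w) = 0" if "j < k" "w \<in> null_space A \<omega> Y q" for j w
  proof -
    have "subspace {w. \<omega> q (E j) (Jop w) = 0}" by (rule subspaceI) (simp_all add: om.om_simps om.J_simps)
    then have "span (E ` {k..<?n}) \<subseteq> {w. \<omega> q (E j) (Jop w) = 0}"
      by (rule span_minimal[rotated]) (use that om.unitary_real_orthonormal(1)[OF u] k in auto)
    then show ?thesis using that(2) null by auto
  qed
  have u': "om.unitary q E' ?n"
    unfolding om.unitary_def
  proof (intro allI impI)
    fix i j assume ij: "i < ?n" "j < ?n"
    have im: "\<omega> q (E' i) (E' j) = 0"
    proof (cases "j < k")
      case True then show ?thesis using om_E'[OF ij] by (simp add: E'_def)
    next
      case False then show ?thesis using null_om[of "E' i" "E' j"] om_E' ij E'_n by simp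
    qed
    have re: "\<omega> q (E' i) (Jop (E' j)) = (if i = j then 1 else 0)"
    proof (cases "i < k"; cases "j < k")
      assume "i < k" "j < k" then show ?thesis using om.unitary_real_orthonormal(1)[OF u ij] by (simp add: E'_def)
    next
      assume "i < k" "\<not> j < k" then show ?thesis using g_null[of i "E' j"] E'_n[of j] ij by (auto simp: E'_def)
    next
      assume "\<not> i < k" "j < k"
      then show ?thesis using g_null[of j "E' i"] E'_n[of i] ij om.g_sym[of q "E' i" "E' j"] by (auto simp: E'_def)
    next
      assume "\<not> i < k" "\<not> j < k"
      then show ?thesis using lb(3)[of "i - k" "j - k"] ij by (auto simp: E'_def)
    qed
    show "om.H q (E' i) (E' j) = (if i = j then 1 else 0)"
      using im re by (simp add: om.H_def complex_eq_iff)
  qed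
  have "unitary_frame \<omega> q E'" using u' unitary_frame_iff by blast
  then obtain f where f: "cmod f = 1" "\<And>ws. length ws = ?n \<Longrightarrow> \<Omega> q ws = f * wedge ?n (coframe \<omega> q E') ws"
    using unit_length unfolding unit_length_form_def by blast
  \<comment> \<open>Two unitary frames of the same isotropic subspace differ by a real matrix, so \<open>f\<close> is the value of
    \<open>\<Omega>\<close> on the frame \<open>E\<close> up to a real factor, which has modulus 1.\<close>
  have sq: "(\<Omega> q ?l) ^ 2 = f ^ 2"
  proof -
    have "wedge ?n (coframe \<omega> q E') ?l \<in> \<real>"
      by (rule wedge_real) (simp_all add: coframe_eq om.H_def om_E' complex_is_Real_iff)
    then obtain r where r: "wedge ?n (coframe \<omega> q E') ?l = of_real r" by (auto elim: Reals_cases)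
    have "\<Omega> q ?l = f * of_real r" using f(2)[of ?l] r by simp
    moreover from this have "\<bar>r\<bar> = 1" using Omega_unit[OF u] f(1) by (simp add: norm_mult)
    then have "r ^ 2 = 1" by (simp add: abs_square_eq_1)
    ultimately show ?thesis by (simp add: power_mult_distrib flip: of_real_power)
  qed
  let ?s = "complex_of_int (sign (rotation k (?n - k)))"
  have int: "interior (map u_vec ?b) (\<Omega> q) us = f * (?s * wedge k (coframe \<omega> q E) us)" if "length us = k" for us
  proof -
    have "interior (map u_vec ?b) (\<Omega> q) us = \<Omega> q (?b @ us)"
      by (rule interior_u_vec[OF top_form_Omega]) (use lb(1) that k in simp)
    also have "\<dots> = f * wedge (k + (?n - k)) (coframe \<omega> q E') (?b @ us)"
      using f(2)[of "?b @ us"] lb(1) that k by simp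
    also have "wedge (k + (?n - k)) (coframe \<omega> q E') (?b @ us) = ?s * wedge k (coframe \<omega> q E') us"
    proof (rule wedge_append[OF lb(1) that])
      fix i j assume ij: "i < k + (?n - k)" "j < ?n - k"
      have "coframe \<omega> q E' i (?b ! j) = om.H q (E' i) (E' (k + j))" by (simp add: coframe_eq E'_def)
      then show "coframe \<omega> q E' i (?b ! j) = (if i = k + j then 1 else 0)"
        using om.unitaryD[OF u', of i "k + j"] ij k by simp
    qed
    also have "wedge k (coframe \<omega> q E') us = wedge k (coframe \<omega> q E) us"
      by (rule wedge_cong) (simp add: coframe_eq E'_def)
    finally show ?thesis .
  qed
  show ?thesis
    unfolding maslov_charge_def tensor_square_def int[OF ws(1)] int[OF ws(2)] sq
    using sign_square[of "rotation k (?n - k)"] by (simp add: power2_eq_square algebra_simps)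
qed

end

section \<open>Leafwise mean curvature and the derivative of the Maslov charge\<close>

lemma smooth_rel_square:
  fixes f :: "'a::real_normed_vector \<Rightarrow> complex"
  assumes "smooth_rel S f" shows "smooth_rel S (\<lambda>x. (f x)\<^sup>2)"
  unfolding smooth_rel_def
proof
  fix x assume "x \<in> S"
  then obtain N h where N: "open N" "x \<in> N" "smooth_on N h" "\<forall>y\<in>N \<inter> S. h y = f y"
    using assms unfolding smooth_rel_def by blast
  have "smooth_on N (\<lambda>x. h x * h x)"
    by (rule smooth_on_bilinear[OF bounded_bilinear_mult N(1,3,3)])
  then show "\<exists>N h. open N \<and> x \<in> N \<and> smooth_on N h \<and> (\<forall>y\<in>N \<inter> S. h y = (f y)\<^sup>2)"
    using N by (intro exI[of _ N] exI[of _ "\<lambda>x. h x * h x"]) (auto simp: power2_eq_square)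
qed

lemma smooth_rel_subset: "smooth_rel S f \<Longrightarrow> T \<subseteq> S \<Longrightarrow> smooth_rel T f"
  unfolding smooth_rel_def by (meson IntD1 IntD2 IntI subsetD)

lemma smooth_field_subset:
  assumes "smooth_field A S V" "T \<subseteq> S" shows "smooth_field A T V"
  unfolding smooth_field_def
proof
  fix c assume "c \<in> A"
  then have "smooth_rel (chart_image c S) ((\<lambda>q. to_chart A c q (V q)) \<circ> param c)"
    using assms(1) by (simp add: smooth_field_def)
  then show "smooth_rel (chart_image c T) ((\<lambda>q. to_chart A c q (V q)) \<circ> param c)"
    by (rule smooth_rel_subset) (use assms(2) in \<open>auto simp: chart_image_def\<close>)
qed

text \<open>\<open>u_vec\<close> is the complex linear isomorphism from the tangent space with its J
  onto the vectors of type (1,0), so connection coefficients can be read off from the frame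
  \<open>E\<close> itself.\<close>

lemma u_vec_sum:
  fixes e :: "'a \<Rightarrow> complex^'m::finite"
  shows "(\<Sum>i\<in>I. cscale (z i) (u_vec (e i))) = u_vec (\<Sum>i\<in>I. z i *s e i)"
proof -
  have "cscale (z i) (u_vec (e i)) = u_vec (z i *s e i)" for i
    by (simp add: cscale_def u_vec_def complex_scale_eq linear_add[OF linear_Jop] linear_scale[OF linear_Jop]
        linear_neg[OF linear_Jop] algebra_simps)
  moreover have "(\<Sum>i\<in>I. u_vec (f i)) = u_vec (\<Sum>i\<in>I. f i)" for f :: "'a \<Rightarrow> complex^'m"
    by (induction I rule: infinite_finite_induct)
      (simp_all add: u_vec_def linear_0[OF linear_Jop] linear_add[OF linear_Jop] scaleR_add_right zero_prod_def)
  ultimately show ?thesis by simp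
qed

lemma u_vec_inject: "u_vec v = u_vec w \<longleftrightarrow> v = w"
  by (auto simp: u_vec_def)

locale adapted_frame_at = calabi_yau_manifold A \<omega> \<Omega>
  for A :: "('x::topological_space, 'n::finite) chart set" and \<omega> and \<Omega> :: "'x \<Rightarrow> 'n form" +
  fixes Y :: "'x set" and k :: nat and U :: "'x set" and E :: "nat \<Rightarrow> 'x \<Rightarrow> complex^'n" and p :: 'x
  assumes Y: "submanifold A Y (CARD('n) + k)"
    and frame: "adapted_frame A \<omega> Y k U E"
    and p: "p \<in> Y \<inter> U"
begin

abbreviation D where "D j v \<equiv> nabla A \<omega> Y (E j) p v"
abbreviation T where "T \<equiv> tangent_space A Y p"
abbreviation \<alpha> where "\<alpha> \<equiv> leafwise_mean_curvature_form A \<omega> Y p"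
abbreviation null where "null \<equiv> null_space A \<omega> Y p"

lemma pY: "p \<in> Y" using p by simp

lemma U: "open U" and E_field: "j < CARD('n) \<Longrightarrow> smooth_field A (Y \<inter> U) (E j)"
  and unitary_E: "q \<in> Y \<inter> U \<Longrightarrow> om.unitary q (\<lambda>j. E j q) CARD('n)"
  and tangent_E: "q \<in> Y \<inter> U \<Longrightarrow>
    tangent_space A Y q = span ((\<lambda>j. E j q) ` {..<CARD('n)} \<union> (\<lambda>j. Jop (E j q)) ` {..<k})"
  and null_E: "q \<in> Y \<inter> U \<Longrightarrow> null_space A \<omega> Y q = span ((\<lambda>j. E j q) ` {k..<CARD('n)})"
  using frame unitary_frame_iff unfolding adapted_frame_def by blast+

lemma k: "k \<le> CARD('n)" using dim_null_space[OF Y pY] by linarith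

lemma E_tan: "q \<in> Y \<inter> U \<Longrightarrow> j < CARD('n) \<Longrightarrow> E j q \<in> tangent_space A Y q"
  unfolding tangent_E by (rule span_base) auto

lemma E_null: "q \<in> Y \<inter> U \<Longrightarrow> k \<le> j \<Longrightarrow> j < CARD('n) \<Longrightarrow> E j q \<in> null_space A \<omega> Y q"
  unfolding null_E by (rule span_base) auto

lemma orthonormal: "i < CARD('n) \<Longrightarrow> j < CARD('n) \<Longrightarrow> \<omega> p (E i p) (Jop (E j p)) = (if i = j then 1 else 0)"
  and isotropic: "i < CARD('n) \<Longrightarrow> j < CARD('n) \<Longrightarrow> \<omega> p (E i p) (E j p) = 0"
  using om.unitary_real_orthonormal[OF unitary_E[OF p]] by auto

lemma null_sub_T: "v \<in> null \<Longrightarrow> v \<in> T"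
  unfolding null_E[OF p] tangent_E[OF p] by (erule subsetD[OF span_mono, rotated]) auto

lemma in_T_iff: "w \<in> T \<longleftrightarrow> (\<forall>j\<in>{k..<CARD('n)}. \<omega> p (E j p) w = 0)"
proof
  assume "w \<in> T" then show "\<forall>j\<in>{k..<CARD('n)}. \<omega> p (E j p) w = 0"
    using null_spaceD[OF E_null[OF p]] by auto
next
  assume *: "\<forall>j\<in>{k..<CARD('n)}. \<omega> p (E j p) w = 0"
  have "subspace {v. \<omega> p v w = 0}" by (rule subspaceI) (simp_all add: om.om_simps)
  then have "span ((\<lambda>j. E j p) ` {k..<CARD('n)}) \<subseteq> {v. \<omega> p v w = 0}" by (rule span_minimal[rotated]) (use * in auto)
  then have "\<omega> p w v = 0" if "v \<in> null" for v using that null_E[OF p] om.skew[of p w v] by auto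
  then show "w \<in> T" unfolding tangent_space_from_null[OF Y pY] by blast
qed

lemma null_expand:
  assumes "v \<in> null" shows "v = (\<Sum>j\<in>{k..<CARD('n)}. \<omega> p (E j p) (Jop v) *\<^sub>R E j p)"
proof -
  have img: "(\<lambda>i. E (k + i) p) ` {..<CARD('n) - k} = (\<lambda>j. E j p) ` {k..<CARD('n)}"
  proof -
    have eq: "(+) k ` {..<CARD('n) - k} = {k..<CARD('n)}" using k by (simp add: lessThan_atLeast0)
    show ?thesis by (simp only: eq[symmetric] image_image)
  qed
  have "v = (\<Sum>i<CARD('n) - k. \<omega> p (E (k + i) p) (Jop v) *\<^sub>R E (k + i) p)"
  proof (rule om.real_orthonormal_expand)
    show "\<omega> p (E (k + i) p) (Jop (E (k + j) p)) = (if i = j then 1 else 0)" if "i < CARD('n) - k" "j < CARD('n) - k" for i j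
      using orthonormal[of "k + i" "k + j"] that by auto
    show "v \<in> span ((\<lambda>i. E (k + i) p) ` {..<CARD('n) - k})" using assms null_E[OF p] img by simp
  qed
  also have "\<dots> = (\<Sum>j\<in>{k..<CARD('n)}. \<omega> p (E j p) (Jop v) *\<^sub>R E j p)"
    by (rule sum.reindex_bij_witness[of _ "\<lambda>j. j - k" "\<lambda>i. k + i"]) auto
  finally show ?thesis .
qed

text \<open>The normal space is J of the leaf directions, and an orthonormal frame of it gives the
  projection.\<close>

lemma normal_part_eq: "normal_part A \<omega> Y p z = (\<Sum>j\<in>{k..<CARD('n)}. \<omega> p (E j p) z *\<^sub>R Jop (E j p))" (is "_ = ?m")
  unfolding normal_part_def
proof (rule the_equality)
  have m: "\<forall>t\<in>T. metric \<omega> p ?m t = 0"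
    using in_T_iff by (auto simp: metric_def linear_sum[OF om.linear_om_left] om.om_simps om.om_Jop intro!: sum.neutral)
  have "\<omega> p (E i p) ?m = \<omega> p (E i p) z" if "i \<in> {k..<CARD('n)}" for i
  proof -
    have "\<omega> p (E i p) ?m = (\<Sum>j\<in>{k..<CARD('n)}. if j = i then \<omega> p (E i p) z else 0)"
      unfolding linear_sum[OF om.linear_om_right]
      by (rule sum.cong) (use that orthonormal in \<open>auto simp: om.om_simps\<close>)
    then show ?thesis using that by simp
  qed
  then have zm: "z - ?m \<in> T" unfolding in_T_iff by (simp add: om.om_simps)
  then show "(\<forall>t\<in>T. metric \<omega> p ?m t = 0) \<and> z - ?m \<in> T" using m by blast
  \<comment> \<open>Two candidates differ by a vector that is tangent and also orthogonal to the
    tangent space.\<close>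
  fix m' assume m': "(\<forall>t\<in>T. metric \<omega> p m' t = 0) \<and> z - m' \<in> T"
  have "?m - m' \<in> T" using subspace_diff[OF submanifold_tangent(1)[OF Y pY], of "z - m'" "z - ?m"] m' zm by simp
  then have "metric \<omega> p ?m (?m - m') = 0" "metric \<omega> p m' (?m - m') = 0" using m m' by auto
  then have "\<omega> p (?m - m') (Jop (?m - m')) = 0" by (simp add: metric_def om.om_simps)
  then show "m' = ?m" using om.pos[of "?m - m'" p] by (cases "?m - m' = 0") auto
qed

text \<open>A tangent \<open>W\<close> and a null \<open>E j\<close> pair to zero along
  \<open>Y\<close>; differentiating this moves the derivative onto the frame. Hence the normal part
  of the covariant derivative depends only on \<open>W p\<close>, and \<open>second_ff\<close> does
  not depend on the extension.\<close>

lemma nabla_tangent_normal: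
  assumes V: "open U'" "p \<in> U'" "smooth_field A (Y \<inter> U') W" "\<And>q. q \<in> Y \<inter> U' \<Longrightarrow> W q \<in> tangent_space A Y q"
    and v: "v \<in> T" and j: "k \<le> j" "j < CARD('n)"
  shows "\<omega> p (E j p) (nabla A \<omega> Y W p v) = \<omega> p (W p) (D j v)"
proof -
  let ?U = "U \<inter> U'"
  have "\<omega> p (nabla A \<omega> Y W p v) (E j p) + \<omega> p (W p) (D j v) = 0"
  proof (rule nabla_compatible[of ?U])
    show "\<omega> q (W q) (E j q) = 0" if "q \<in> Y \<inter> ?U" for q
      using null_spaceD[OF E_null[of q j] V(4)[of q]] that j om.skew[of q "W q" "E j q"] by simp
  qed (use V U p v j smooth_field_subset[OF V(3), of "Y \<inter> ?U"] smooth_field_subset[OF E_field[OF j(2)], of "Y \<inter> ?U"] in auto)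
  then show ?thesis using om.skew[of p "E j p" "nabla A \<omega> Y W p v"] by simp
qed

lemma second_ff_eq:
  assumes v: "v \<in> T" and w: "w \<in> null"
  shows "second_ff A \<omega> Y p v w = (\<Sum>j\<in>{k..<CARD('n)}. \<omega> p w (D j v) *\<^sub>R Jop (E j p))"
  unfolding second_ff_def
proof (rule the_equality)
  show "\<forall>U W. open U \<and> p \<in> U \<and> smooth_field A (Y \<inter> U) W \<and> (\<forall>q\<in>Y \<inter> U. W q \<in> tangent_space A Y q) \<and> W p = w \<longrightarrow>
      (\<Sum>j\<in>{k..<CARD('n)}. \<omega> p w (D j v) *\<^sub>R Jop (E j p)) = normal_part A \<omega> Y p (nabla A \<omega> Y W p v)"
    unfolding normal_part_eq using nabla_tangent_normal v by (auto intro!: sum.cong)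
  fix s assume s: "\<forall>U W. open U \<and> p \<in> U \<and> smooth_field A (Y \<inter> U) W \<and> (\<forall>q\<in>Y \<inter> U. W q \<in> tangent_space A Y q) \<and> W p = w \<longrightarrow>
      s = normal_part A \<omega> Y p (nabla A \<omega> Y W p v)"
  \<comment> \<open>Uniqueness in the description needs one admissible extension of
    \<open>w\<close>: the combination of leaf fields with coefficients frozen at \<open>p\<close>.
    They are written as complex scalars to match \<open>smooth_field_scaleC\<close>.\<close>
  define W where "W q = (\<Sum>j\<in>{k..<CARD('n)}. complex_of_real (\<omega> p (E j p) (Jop w)) *s E j q)" for q
  have Wp: "W p = w" unfolding W_def using null_expand[OF w] by (simp add: om.scaleC_of_real)
  have sm: "smooth_field A (Y \<inter> U) W"
    unfolding W_def by (intro smooth_field_sum smooth_field_scaleC E_field) auto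
  have tn: "W q \<in> tangent_space A Y q" if q: "q \<in> Y \<inter> U" for q
  proof -
    have "subspace (tangent_space A Y q)" using submanifold_tangent(1)[OF Y] q by simp
    then show ?thesis
      unfolding W_def om.scaleC_of_real using E_tan[OF q] by (intro subspace_sum subspace_scale) auto
  qed
  have "s = normal_part A \<omega> Y p (nabla A \<omega> Y W p v)" using s U p sm tn Wp by blast
  also have "\<dots> = (\<Sum>j\<in>{k..<CARD('n)}. \<omega> p w (D j v) *\<^sub>R Jop (E j p))"
    unfolding normal_part_eq
    using nabla_tangent_normal[OF U _ sm tn v] p Wp by (intro sum.cong) auto
  finally show "s = (\<Sum>j\<in>{k..<CARD('n)}. \<omega> p w (D j v) *\<^sub>R Jop (E j p))" .
qed

text \<open>The coefficient of the leafwise mean curvature vector along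
  \<open>Jop (E j p)\<close>.\<close>

definition leaf_trace where "leaf_trace j = (\<Sum>i\<in>{k..<CARD('n)}. \<omega> p (E i p) (D j (E i p)))"

lemma D_linear:
  assumes "j < CARD('n)" obtains K where "linear K" "\<And>v. v \<in> T \<Longrightarrow> D j v = K v"
  using nabla_linear[OF E_field[OF assms] U p] by metis

lemma mean_curvature_vector:
  "leafwise_mean_curvature_vector A \<omega> Y p = (\<Sum>j\<in>{k..<CARD('n)}. leaf_trace j *\<^sub>R Jop (E j p))"
proof -
  let ?b = "leaf_basis A \<omega> Y p"
  note lb = leaf_basis[OF unitary_E[OF p] null_E[OF p] k]
  have b: "?b ! i \<in> null" if "i < CARD('n) - k" for i using lb(1,2) that by (metis nth_mem span_base)
  have img: "(!) ?b ` {..<CARD('n) - k} = set ?b" using lb(1) by (auto simp: set_conv_nth)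
  \<comment> \<open>The trace is the same in every orthonormal basis: expand one argument in
    \<open>E\<close>, exchange the sums, and recollect the other argument from the chosen
    basis.\<close>
  have trace: "(\<Sum>i<CARD('n) - k. \<omega> p (?b ! i) (D j (?b ! i))) = leaf_trace j" if j: "j < CARD('n)" for j
  proof -
    obtain K where K: "linear K" "\<And>v. v \<in> T \<Longrightarrow> D j v = K v" using D_linear[OF j] by blast
    have "(\<Sum>i<CARD('n) - k. \<omega> p (?b ! i) (D j (?b ! i))) = (\<Sum>i<CARD('n) - k. \<omega> p (?b ! i) (K (?b ! i)))"
      using K(2) null_sub_T[OF b] by simp
    also have "\<dots> = (\<Sum>i<CARD('n) - k. \<Sum>l\<in>{k..<CARD('n)}. \<omega> p (E l p) (Jop (?b ! i)) * \<omega> p (E l p) (K (?b ! i)))"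
    proof (rule sum.cong[OF refl])
      fix i assume "i \<in> {..<CARD('n) - k}"
      then have "?b ! i = (\<Sum>l\<in>{k..<CARD('n)}. \<omega> p (E l p) (Jop (?b ! i)) *\<^sub>R E l p)" using null_expand[OF b] by simp
      then have "\<omega> p (?b ! i) x = \<omega> p (\<Sum>l\<in>{k..<CARD('n)}. \<omega> p (E l p) (Jop (?b ! i)) *\<^sub>R E l p) x" for x by simp
      then show "\<omega> p (?b ! i) (K (?b ! i)) = (\<Sum>l\<in>{k..<CARD('n)}. \<omega> p (E l p) (Jop (?b ! i)) * \<omega> p (E l p) (K (?b ! i)))"
        by (simp add: linear_sum[OF om.linear_om_left] om.om_simps)
    qed
    also have "\<dots> = (\<Sum>l\<in>{k..<CARD('n)}. \<Sum>i<CARD('n) - k. \<omega> p (E l p) (Jop (?b ! i)) * \<omega> p (E l p) (K (?b ! i)))"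
      by (rule sum.swap)
    also have "\<dots> = (\<Sum>l\<in>{k..<CARD('n)}. \<omega> p (E l p) (K (E l p)))"
    proof (rule sum.cong[OF refl])
      fix l assume l: "l \<in> {k..<CARD('n)}"
      have "E l p = (\<Sum>i<CARD('n) - k. \<omega> p (?b ! i) (Jop (E l p)) *\<^sub>R ?b ! i)"
        using l lb(2,3) img E_null[OF p, of l] by (intro om.real_orthonormal_expand) auto
      then have "\<omega> p (E l p) (K (E l p)) = \<omega> p (E l p) (K (\<Sum>i<CARD('n) - k. \<omega> p (?b ! i) (Jop (E l p)) *\<^sub>R ?b ! i))" by simp
      also have "\<dots> = (\<Sum>i<CARD('n) - k. \<omega> p (E l p) (Jop (?b ! i)) * \<omega> p (E l p) (K (?b ! i)))"
        using om.g_sym[of p _ "E l p"]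
        by (simp add: linear_sum[OF K(1)] linear_scale[OF K(1)] linear_sum[OF om.linear_om_right] om.om_simps)
      finally show "(\<Sum>i<CARD('n) - k. \<omega> p (E l p) (Jop (?b ! i)) * \<omega> p (E l p) (K (?b ! i))) = \<omega> p (E l p) (K (E l p))" by simp
    qed
    also have "\<dots> = leaf_trace j"
      unfolding leaf_trace_def using K(2) E_tan[OF p] by (intro sum.cong) auto
    finally show ?thesis .
  qed
  have "leafwise_mean_curvature_vector A \<omega> Y p = (\<Sum>i<CARD('n) - k. second_ff A \<omega> Y p (?b ! i) (?b ! i))"
    unfolding leafwise_mean_curvature_vector_def by (simp add: sum_list_sum_nth lb(1) lessThan_atLeast0)
  also have "\<dots> = (\<Sum>i<CARD('n) - k. \<Sum>j\<in>{k..<CARD('n)}. \<omega> p (?b ! i) (D j (?b ! i)) *\<^sub>R Jop (E j p))"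
    using second_ff_eq[OF null_sub_T[OF b] b] by simp
  also have "\<dots> = (\<Sum>j\<in>{k..<CARD('n)}. \<Sum>i<CARD('n) - k. \<omega> p (?b ! i) (D j (?b ! i)) *\<^sub>R Jop (E j p))"
    by (rule sum.swap)
  also have "\<dots> = (\<Sum>j\<in>{k..<CARD('n)}. leaf_trace j *\<^sub>R Jop (E j p))"
    using trace by (simp flip: scaleR_sum_left)
  finally show ?thesis .
qed

lemma mean_curvature_form:
  "\<alpha> w = - (\<Sum>j\<in>{k..<CARD('n)}. leaf_trace j * \<omega> p (E j p) (Jop w))"
  unfolding leafwise_mean_curvature_form_def mean_curvature_vector
  by (simp add: linear_sum[OF om.linear_om_left] om.om_simps om.om_Jop_left sum_negf)

lemma mean_curvature_form_zero:
  assumes "\<And>v. v \<in> null \<Longrightarrow> \<alpha> v = 0"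
  shows "\<alpha> w = 0"
proof -
  have "leaf_trace j = 0" if j: "j \<in> {k..<CARD('n)}" for j
  proof -
    have "(\<Sum>i\<in>{k..<CARD('n)}. leaf_trace i * \<omega> p (E i p) (Jop (E j p))) = (\<Sum>i\<in>{k..<CARD('n)}. if i = j then leaf_trace j else 0)"
      by (rule sum.cong) (use j orthonormal in auto)
    then show ?thesis using assms[OF E_null[OF p, of j]] j by (simp add: mean_curvature_form)
  qed
  then show ?thesis by (simp add: mean_curvature_form)
qed

text \<open>Torsion-freeness exchanges the direction of differentiation with the differentiated field; the
  bracket of two fields tangent to \<open>Y\<close> pairs to zero with the null direction \<open>E i\<close>.\<close>

lemma mean_curvature_form_connection:
  assumes v: "v \<in> null"
  shows "\<alpha> v = - (\<Sum>i\<in>{k..<CARD('n)}. \<omega> p (E i p) (D i v))"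
proof -
  have exchange: "\<omega> p (E i p) (D j (E i p)) = \<omega> p (E i p) (D i (E j p))" if "i \<in> {k..<CARD('n)}" "j \<in> {k..<CARD('n)}" for i j
  proof -
    have "D j (E i p) - D i (E j p) \<in> T"
      using torsion_free[OF Y U p E_field E_field E_tan E_tan, of i j] that by auto
    then have "\<omega> p (E i p) (D j (E i p) - D i (E j p)) = 0" using in_T_iff that by blast
    then show ?thesis by (simp add: om.om_simps)
  qed
  have "(\<Sum>j\<in>{k..<CARD('n)}. leaf_trace j * \<omega> p (E j p) (Jop v)) =
      (\<Sum>j\<in>{k..<CARD('n)}. \<Sum>i\<in>{k..<CARD('n)}. \<omega> p (E j p) (Jop v) * \<omega> p (E i p) (D i (E j p)))"
    unfolding leaf_trace_def sum_distrib_right by (intro sum.cong refl) (subst exchange, assumption, assumption, rule mult.commute)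
  also have "\<dots> = (\<Sum>i\<in>{k..<CARD('n)}. \<Sum>j\<in>{k..<CARD('n)}. \<omega> p (E j p) (Jop v) * \<omega> p (E i p) (D i (E j p)))"
    by (rule sum.swap)
  also have "\<dots> = (\<Sum>i\<in>{k..<CARD('n)}. \<omega> p (E i p) (D i v))"
  proof (rule sum.cong[OF refl])
    fix i assume "i \<in> {k..<CARD('n)}"
    then obtain K where K: "linear K" "\<And>v. v \<in> T \<Longrightarrow> D i v = K v" using D_linear[of i] by auto
    have "D i v = K v" using K(2) null_sub_T[OF v] by blast
    also have "\<dots> = K (\<Sum>j\<in>{k..<CARD('n)}. \<omega> p (E j p) (Jop v) *\<^sub>R E j p)" using null_expand[OF v] by simp
    also have "\<dots> = (\<Sum>j\<in>{k..<CARD('n)}. \<omega> p (E j p) (Jop v) *\<^sub>R D i (E j p))"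
      using K(2) E_tan[OF p] by (simp add: linear_sum[OF K(1)] linear_scale[OF K(1)])
    finally show "(\<Sum>j\<in>{k..<CARD('n)}. \<omega> p (E j p) (Jop v) * \<omega> p (E i p) (D i (E j p))) = \<omega> p (E i p) (D i v)"
      by (simp add: linear_sum[OF om.linear_om_right] om.om_simps)
  qed
  finally show ?thesis by (simp add: mean_curvature_form)
qed

text \<open>This differentiates the unit length of \<open>E j\<close>. Pairing \<open>E j\<close>
  with \<open>\<i> *s E j\<close> expresses the squared norm through the Kaehler form, to which
  \<open>nabla_compatible\<close> applies.\<close>

lemma connection_imaginary:
  assumes v: "v \<in> T" and j: "j < CARD('n)"
  shows "om.H p (E j p) (D j v) = \<i> * of_real (\<omega> p (E j p) (D j v))"
proof -
  have "\<omega> p (D j v) (\<i> *s E j p) + \<omega> p (E j p) (nabla A \<omega> Y (\<lambda>q. \<i> *s E j q) p v) = 0"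
  proof (rule nabla_compatible[OF U p v E_field[OF j] smooth_field_scaleC[OF E_field[OF j]]])
    show "\<omega> q (E j q) (\<i> *s E j q) = 1" if "q \<in> Y \<inter> U" for q
      using om.unitary_real_orthonormal(1)[OF unitary_E[OF that] j j] by (simp add: Jop_def)
  qed
  then have "\<omega> p (D j v) (Jop (E j p)) + \<omega> p (E j p) (Jop (D j v)) = 0"
    by (simp add: nabla_scaleC[OF U p v E_field[OF j]] Jop_def)
  then have "\<omega> p (E j p) (Jop (D j v)) = 0"
    using om.g_sym[of p "D j v" "E j p"] by simp
  then show ?thesis by (simp add: om.H_def complex_eq_iff)
qed

text \<open>As the connection commutes with J, the derivative of \<open>u_vec (E j q)\<close> is
  \<open>u_vec\<close> of the derivative of \<open>E j\<close>.\<close>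

lemma connection_coeffs_iff:
  assumes v: "v \<in> T"
  shows "connection_coeffs A \<omega> Y E p v \<kappa> \<longleftrightarrow> (\<forall>j<CARD('n). D j v = (\<Sum>i<CARD('n). \<kappa> i j *s E i p))"
proof -
  have "nabla_u A \<omega> Y (E j) p v = u_vec (D j v)" if j: "j < CARD('n)" for j
  proof -
    have h: "fst (u_vec (E j q)) = (1/2) *s E j q" "snd (u_vec (E j q)) = (- \<i> / 2) *s E j q" for q
      by (simp_all add: u_vec_def complex_scale_eq)
    show ?thesis
      unfolding nabla_u_def h nabla_scaleC[OF U p v E_field[OF j]]
      by (simp add: u_vec_def complex_scale_eq)
  qed
  then show ?thesis unfolding connection_coeffs_def by (simp add: u_vec_sum u_vec_inject)
qed

section \<open>The charge in an adapted frame and its derivative\<close>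

abbreviation Om where "Om q \<equiv> \<Omega> q (map (\<lambda>i. E i q) [0..<CARD('n)])"

lemma Om_nonzero: "q \<in> Y \<inter> U \<Longrightarrow> Om q \<noteq> 0"
  using Omega_unit[OF unitary_E[of q]] by auto

lemma Om_smooth: "smooth_fun A (Y \<inter> U) Om"
  by (rule Omega_frame_smooth[where E = E, OF E_field U])

lemma Om_square_smooth: "smooth_fun A (Y \<inter> U) (\<lambda>q. (Om q)\<^sup>2)"
  using Om_smooth smooth_rel_square unfolding smooth_fun_def o_def by blast

lemma Om_square_deriv:
  assumes v: "v \<in> T"
  shows "deriv_along A Y (\<lambda>q. (Om q)\<^sup>2) p v = 2 * (Om p)\<^sup>2 * (\<Sum>i<CARD('n). om.H p (E i p) (D i v))"
proof -
  let ?c = "chart_at A p" and ?x0 = "snd (chart_at A p) p"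
  obtain N h where N: "open N" "?x0 \<in> N" "N \<subseteq> chart_image ?c U" "smooth_on N h"
    "\<And>q. q \<in> Y \<Longrightarrow> q \<in> fst ?c \<Longrightarrow> snd ?c q \<in> N \<Longrightarrow> h (snd ?c q) = Om q"
    using smooth_fun_rep[OF Om_smooth U p chart_at] by blast
  have d: "((\<lambda>x. h x * h x) has_derivative (\<lambda>v. h ?x0 * dd h ?x0 v + dd h ?x0 v * h ?x0)) (at ?x0)"
    by (intro has_derivative_mult smooth_on_has_derivative[OF N(4,2)])
  have "deriv_along A Y (\<lambda>q. (Om q)\<^sup>2) p v = dd (\<lambda>x. h x * h x) ?x0 (to_chart A ?c p v)"
    by (rule deriv_along_eq[OF v chart_at N(1,2)])
      (use d N(5) in \<open>auto simp: differentiable_def power2_eq_square\<close>)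
  also have "\<dots> = 2 * Om p * dd h ?x0 (to_chart A ?c p v)"
    using N(5)[OF pY chart_at(2) N(2)] by (simp add: dd_eqI[OF d])
  also have "dd h ?x0 (to_chart A ?c p v) = deriv_along A Y Om p v"
    by (rule deriv_along_eq[OF v chart_at N(1,2) smooth_on_differentiable[OF N(4,2)], symmetric]) (rule N(5))
  also have "\<dots> = Om p * (\<Sum>i<CARD('n). om.H p (E i p) (D i v))"
    using Omega_parallel_along[where E = E, OF E_field U p v] Omega_trace[OF unitary_E[OF p], of "\<lambda>i. D i v"] by simp
  finally show ?thesis by (simp add: power2_eq_square)
qed

lemma maslov_charge_frame:
  assumes q: "q \<in> Y \<inter> U" and "length ws = k" "length ws' = k"
  shows "maslov_charge A \<omega> \<Omega> Y q ws ws' = (Om q)\<^sup>2 * tensor_square (canonical_frame \<omega> k E q) ws ws'"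
  unfolding tensor_square_def canonical_frame_def
  by (rule maslov_charge_eq[OF unitary_E[OF q] null_E[OF q] E_tan[OF q] k assms(2,3)])

text \<open>Evaluation on the transverse vectors exhibits the canonical frame as nonzero, so that
  coefficient functions can be read off from values of the charge.\<close>

lemma canonical_frame_value:
  assumes q: "q \<in> Y \<inter> U"
  defines "ws \<equiv> map (\<lambda>i. E i q) [0..<k]"
  shows "tensor_square (canonical_frame \<omega> k E q) ws ws = 1"
  unfolding tensor_square_def canonical_frame_def
  by (rule wedge_dual) (use k om.unitaryD[OF unitary_E[OF q]] in \<open>auto simp: ws_def coframe_eq\<close>)

lemma sum_split: "(\<Sum>i<CARD('n). f i) = (\<Sum>a<k. f a) + (\<Sum>i\<in>{k..<CARD('n)}. f i)" for f :: "nat \<Rightarrow> complex"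
  using k by (simp add: lessThan_atLeast0 sum.atLeastLessThan_concat)

lemma mean_curvature_zero_iff:
  assumes v: "v \<in> null"
  shows "\<alpha> v = 0 \<longleftrightarrow> (\<Sum>i\<in>{k..<CARD('n)}. om.H p (E i p) (D i v)) = 0"
proof -
  have "(\<Sum>i\<in>{k..<CARD('n)}. om.H p (E i p) (D i v)) = \<i> * of_real (\<Sum>i\<in>{k..<CARD('n)}. \<omega> p (E i p) (D i v))"
    using connection_imaginary[OF null_sub_T[OF v]] by (simp add: sum_distrib_left)
  then show ?thesis using mean_curvature_form_connection[OF v] by (simp del: of_real_sum)
qed

lemma canonical_derivative_exists:
  assumes v: "v \<in> null" and zero: "\<alpha> v = 0"
  shows "has_canonical_sq_derivative A \<omega> Y k (maslov_charge A \<omega> \<Omega> Y) p v (\<lambda>ws ws'. 0)"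
proof -
  \<comment> \<open>The components of the differentiated frame vectors; their transverse diagonal
    cancels the first \<open>k\<close> terms of the trace coming from the volume form.\<close>
  let ?\<kappa> = "\<lambda>i j. om.H p (E i p) (D j v)"
  have vT: "v \<in> T" by (rule null_sub_T[OF v])
  have "connection_coeffs A \<omega> Y E p v ?\<kappa>"
    unfolding connection_coeffs_iff[OF vT] using om.unitary_expand[OF unitary_E[OF p]] by blast
  moreover have "deriv_along A Y (\<lambda>q. (Om q)\<^sup>2) p v - 2 * (Om p)\<^sup>2 * (\<Sum>a<k. ?\<kappa> a a) = 0"
    using zero unfolding Om_square_deriv[OF vT] mean_curvature_zero_iff[OF v] by (simp add: sum_split)
  ultimately show ?thesis
    unfolding has_canonical_sq_derivative_def
    using frame p Om_square_smooth maslov_charge_frame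
    by (intro exI[of _ U] exI[of _ E] exI[of _ "\<lambda>q. (Om q)\<^sup>2"] exI[of _ ?\<kappa>]) auto
qed

text \<open>\<open>h\<close> and \<open>\<kappa>\<close> come from an existential statement and are
  arbitrary at first. Evaluating on the transverse vectors identifies \<open>h\<close> with the
  square of \<open>Om\<close>, and orthonormality determines the transverse diagonal of
  \<open>\<kappa>\<close>.\<close>

lemma mean_curvature_zero_of_derivative:
  assumes v: "v \<in> null"
    and h: "\<And>q ws ws'. q \<in> Y \<inter> U \<Longrightarrow> length ws = k \<Longrightarrow> length ws' = k \<Longrightarrow>
      maslov_charge A \<omega> \<Omega> Y q ws ws' = h q * tensor_square (canonical_frame \<omega> k E q) ws ws'"
    and \<kappa>: "connection_coeffs A \<omega> Y E p v \<kappa>"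
    and zero: "\<And>ws ws'. length ws = k \<Longrightarrow> length ws' = k \<Longrightarrow>
      0 = (deriv_along A Y h p v - 2 * h p * (\<Sum>a<k. \<kappa> a a)) * tensor_square (canonical_frame \<omega> k E p) ws ws'"
  shows "\<alpha> v = 0"
proof -
  have vT: "v \<in> T" by (rule null_sub_T[OF v])
  have h_eq: "h q = (Om q)\<^sup>2" if q: "q \<in> Y \<inter> U" for q
    using h[OF q, of "map (\<lambda>i. E i q) [0..<k]" "map (\<lambda>i. E i q) [0..<k]"] canonical_frame_value[OF q]
      maslov_charge_frame[OF q, of "map (\<lambda>i. E i q) [0..<k]" "map (\<lambda>i. E i q) [0..<k]"] by simp
  have "\<kappa> a a = om.H p (E a p) (D a v)" if "a < k" for a
    using \<kappa>[unfolded connection_coeffs_iff[OF vT]] om.H_frame_sum[OF unitary_E[OF p], of a "\<lambda>i. \<kappa> i a"] that k by simp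
  then have "(\<Sum>a<k. \<kappa> a a) = (\<Sum>a<k. om.H p (E a p) (D a v))" by simp
  moreover have "deriv_along A Y h p v = deriv_along A Y (\<lambda>q. (Om q)\<^sup>2) p v"
    by (rule deriv_along_cong[OF U]) (use p h_eq in auto)
  moreover have "deriv_along A Y h p v - 2 * h p * (\<Sum>a<k. \<kappa> a a) = 0"
    using zero[of "map (\<lambda>i. E i p) [0..<k]" "map (\<lambda>i. E i p) [0..<k]"] canonical_frame_value[OF p] by simp
  ultimately have "(Om p)\<^sup>2 * (\<Sum>i\<in>{k..<CARD('n)}. om.H p (E i p) (D i v)) = 0"
    by (simp add: h_eq[OF p] Om_square_deriv[OF vT] sum_split algebra_simps)
  then show ?thesis using Om_nonzero[OF p] mean_curvature_zero_iff[OF v] by simp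
qed

end

theorem theorem7p3:
  fixes A :: "('x::{t2_space, second_countable_topology}, 'n::finite) chart set"
    and \<omega> :: "'x \<Rightarrow> complex^'n \<Rightarrow> complex^'n \<Rightarrow> real"
    and \<Omega> :: "'x \<Rightarrow> 'n form"
    and Y :: "'x set"
    and k :: nat
  assumes "calabi_yau A \<omega> \<Omega>"
    and "submanifold A Y (CARD('n) + k)"
    and "coisotropic A \<omega> Y"
  shows "leafwise_special A \<omega> \<Omega> Y k \<longleftrightarrow> leafwise_minimal A \<omega> Y"
proof -
  have "complex_atlas A" "kaehler A \<omega>"
    using assms(1) unfolding calabi_yau_def kaehler_def by blast+
  then interpret calabi_yau_manifold A \<omega> \<Omega>
    using assms(1) by unfold_locales
  have frame: "adapted_frame_at A \<omega> \<Omega> Y k U E p" if "adapted_frame A \<omega> Y k U E" "p \<in> Y" "p \<in> U" for U E p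
    using that assms(2) by unfold_locales auto
  have frame_exists: "\<exists>U E. adapted_frame_at A \<omega> \<Omega> Y k U E p" if p: "p \<in> Y" for p
  proof -
    obtain U E where "adapted_frame A \<omega> Y k U E" "p \<in> U"
      using adapted_frame_exists[OF assms(2) p assms(3)] by blast
    then show ?thesis using frame[OF _ p] by blast
  qed
  show ?thesis
  proof
    assume special: "leafwise_special A \<omega> \<Omega> Y k"
    show "leafwise_minimal A \<omega> Y"
      unfolding leafwise_minimal_def
    proof (intro ballI)
      fix p w assume p: "p \<in> Y"
      have "leafwise_mean_curvature_form A \<omega> Y p v = 0" if v: "v \<in> null_space A \<omega> Y p" for v
      proof -
        have "has_canonical_sq_derivative A \<omega> Y k (maslov_charge A \<omega> \<Omega> Y) p v (\<lambda>ws ws'. 0)"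
          using special p v unfolding leafwise_special_def by blast
        then obtain U E h \<kappa> where *: "adapted_frame A \<omega> Y k U E" "p \<in> U"
          "\<forall>q\<in>Y \<inter> U. \<forall>ws ws'. length ws = k \<and> length ws' = k \<longrightarrow>
             maslov_charge A \<omega> \<Omega> Y q ws ws' = h q * tensor_square (canonical_frame \<omega> k E q) ws ws'"
          "connection_coeffs A \<omega> Y E p v \<kappa>"
          "\<forall>ws ws'. length ws = k \<and> length ws' = k \<longrightarrow>
             0 = (deriv_along A Y h p v - 2 * h p * (\<Sum>a<k. \<kappa> a a)) * tensor_square (canonical_frame \<omega> k E p) ws ws'"
          unfolding has_canonical_sq_derivative_def by (elim exE conjE)
        show ?thesis
        \<comment> \<open>The frame supplied with the derivative is itself the one to work in, which
          avoids comparing the connection in two adapted frames.\<close>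
        proof (rule adapted_frame_at.mean_curvature_zero_of_derivative[OF frame[OF *(1) p *(2)] v _ *(4)])
          show "maslov_charge A \<omega> \<Omega> Y q ws ws' = h q * tensor_square (canonical_frame \<omega> k E q) ws ws'"
            if "q \<in> Y \<inter> U" "length ws = k" "length ws' = k" for q ws ws'
            using *(3) that by blast
        qed (use *(5) in blast)
      qed
      then show "leafwise_mean_curvature_form A \<omega> Y p w = 0"
        using frame_exists[OF p] adapted_frame_at.mean_curvature_form_zero by blast
    qed
  next
    assume minimal: "leafwise_minimal A \<omega> Y"
    show "leafwise_special A \<omega> \<Omega> Y k"
      unfolding leafwise_special_def
    proof (intro ballI)
      fix p v assume p: "p \<in> Y" and v: "v \<in> null_space A \<omega> Y p"
      then have "leafwise_mean_curvature_form A \<omega> Y p v = 0"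
        using minimal assms(3) unfolding leafwise_minimal_def coisotropic_def by blast
      then show "has_canonical_sq_derivative A \<omega> Y k (maslov_charge A \<omega> \<Omega> Y) p v (\<lambda>ws ws'. 0)"
        using frame_exists[OF p] adapted_frame_at.canonical_derivative_exists[OF _ v] by blast
    qed
  qed
qed

end
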